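(* Fix a finite alphabet $\Sigma$. There is a polynomial-time algorithm which, given two regular commutative grammars $G$ and $H$ over $\Sigma$, decides whether $\mathrm{out}(G)\cap\mathrm{out}(H)=\emptyset$.
   Context: A commutative grammar is $G=(\Sigma,S,s_0,\delta)$ where $\Sigma$ is a finite alphabet, $S$ a finite set of states, $s_0\in S$, and $\delta\subseteq S\times\mathbb{N}^\Sigma\times\mathbb{N}^S$ a finite set of transitions $\tau=(s,a,t)$ with $\mathrm{source}(\tau)=s$, $\mathrm{out}(\tau)=a$, $\mathrm{target}(\tau)=t$; every state is the source of some transition, and every transition has $|a|\le1$, $|t|\le 2$ (where $|v|=\sum_x v(x)$). It is regular if $|t|\le1$ for all transitions. For $D\in\mathbb{N}^\delta$ let $\mathrm{source}(D)(s)=\sum_{\mathrm{source}(\tau)=s}D(\tau)$, $\mathrm{out}(D)=\sum_\tau D(\tau)\mathrm{out}(\tau)$, $\mathrm{target}(D)=\sum_\tau D(\tau)\mathrm{target}(\tau)$, $\mathrm{supp}(D)=\{s:\mathrm{source}(D)(s)>0\}$. $D$ is a run if $\mathrm{source}(D)=\mathrm{target}(D)+\{s_0\}$ and $D$ is connected from $s_0$, i.e. every $t\in\mathrm{supp}(D)$ equals $s_0$ or is reachable by transitions $\tau_1,\ldots,\tau_m$ with $D(\tau_i)>0$, $\mathrm{source}(\tau_1)=s_0$, $\mathrm{source}(\tau_{i+1})\in\mathrm{target}(\tau_i)$, $t\in\mathrm{target}(\tau_m)$. $\mathrm{out}(G)=\{\mathrm{out}(D):D\text{ a run}\}$. *)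

theory Defs
  imports Main "HOL-Library.Multiset"
begin

text \<open>A vector in N^Sigma is represented as a multiset over the alphabet type, a vector
in N^S as a multiset over the state type. A transition is (source, out, target).
A grammar is (Sigma, S, s0, delta).\<close>

type_synonym ('s, 'a) trans = "'s \<times> 'a multiset \<times> 's multiset"
type_synonym ('s, 'a) cgrammar = "'a set \<times> 's set \<times> 's \<times> ('s, 'a) trans set"

definition tsource :: "('s, 'a) trans \<Rightarrow> 's" where "tsource \<tau> = fst \<tau>"
definition tout :: "('s, 'a) trans \<Rightarrow> 'a multiset" where "tout \<tau> = fst (snd \<tau>)"
definition ttarget :: "('s, 'a) trans \<Rightarrow> 's multiset" where "ttarget \<tau> = snd (snd \<tau>)"

definition comm_grammar :: "('s, 'a) cgrammar \<Rightarrow> bool" where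
  "comm_grammar G = (case G of (\<Sigma>, S, s0, \<delta>) \<Rightarrow>
     finite \<Sigma> \<and> finite S \<and> s0 \<in> S \<and> finite \<delta> \<and>
     (\<forall>\<tau>\<in>\<delta>. tsource \<tau> \<in> S \<and> set_mset (tout \<tau>) \<subseteq> \<Sigma> \<and> set_mset (ttarget \<tau>) \<subseteq> S
              \<and> size (tout \<tau>) \<le> 1 \<and> size (ttarget \<tau>) \<le> 2) \<and>
     (\<forall>s\<in>S. \<exists>\<tau>\<in>\<delta>. tsource \<tau> = s))"

definition regular_grammar :: "('s, 'a) cgrammar \<Rightarrow> bool" where
  "regular_grammar G = (comm_grammar G \<and>
     (case G of (\<Sigma>, S, s0, \<delta>) \<Rightarrow> (\<forall>\<tau>\<in>\<delta>. size (ttarget \<tau>) \<le> 1)))"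

definition msource :: "('s, 'a) trans multiset \<Rightarrow> 's multiset" where
  "msource D = image_mset tsource D"
definition mout :: "('s, 'a) trans multiset \<Rightarrow> 'a multiset" where
  "mout D = sum_mset (image_mset tout D)"
definition mtarget :: "('s, 'a) trans multiset \<Rightarrow> 's multiset" where
  "mtarget D = sum_mset (image_mset ttarget D)"

definition connected_from :: "'s \<Rightarrow> ('s, 'a) trans multiset \<Rightarrow> bool" where
  "connected_from s0 D = (\<forall>t \<in> set_mset (msource D). t = s0 \<or>
     (\<exists>\<tau>s. \<tau>s \<noteq> [] \<and> set \<tau>s \<subseteq> set_mset D \<and> tsource (hd \<tau>s) = s0 \<and>
        (\<forall>i. Suc i < length \<tau>s \<longrightarrow> tsource (\<tau>s ! Suc i) \<in># ttarget (\<tau>s ! i)) \<and>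
        t \<in># ttarget (last \<tau>s)))"

definition is_run :: "('s, 'a) cgrammar \<Rightarrow> ('s, 'a) trans multiset \<Rightarrow> bool" where
  "is_run G D = (case G of (\<Sigma>, S, s0, \<delta>) \<Rightarrow>
     set_mset D \<subseteq> \<delta> \<and> msource D = mtarget D + {#s0#} \<and> connected_from s0 D)"

definition cg_out :: "('s, 'a) cgrammar \<Rightarrow> 'a multiset set" where
  "cg_out G = {mout D | D. is_run G D}"

datatype dir = Lft | Rgt | Stay

text \<open>A machine is (number of states, number of tape symbols, transition function).
State 0 is initial, 1 accepting, 2 rejecting (both halting). Symbol 0 is the blank;
input symbols are 1, 2, 3.\<close>

type_synonym tm = "nat \<times> nat \<times> (nat \<Rightarrow> nat \<Rightarrow> nat \<times> nat \<times> dir)"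
type_synonym config = "nat \<times> nat list \<times> nat list"

definition valid_tm :: "tm \<Rightarrow> bool" where
  "valid_tm M = (case M of (nQ, nG, d) \<Rightarrow> 3 \<le> nQ \<and> 4 \<le> nG \<and>
     (\<forall>q<nQ. \<forall>a<nG. fst (d q a) < nQ \<and> fst (snd (d q a)) < nG))"

definition tape_read :: "nat list \<Rightarrow> nat" where
  "tape_read rs = (case rs of [] \<Rightarrow> 0 | x # _ \<Rightarrow> x)"

definition tm_step :: "tm \<Rightarrow> config \<Rightarrow> config" where
  "tm_step M c = (case M of (nQ, nG, d) \<Rightarrow> (case c of (q, ls, rs) \<Rightarrow>
     if q = 1 \<or> q = 2 then c else
     (case d q (tape_read rs) of (q', w, mv) \<Rightarrow>
       (case mv of
          Stay \<Rightarrow> (q', ls, w # tl rs)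
        | Rgt \<Rightarrow> (q', w # ls, tl rs)
        | Lft \<Rightarrow> (case ls of [] \<Rightarrow> (q', [], w # tl rs)
                           | l # ls' \<Rightarrow> (q', ls', l # w # tl rs))))))"

definition tm_decides_within :: "tm \<Rightarrow> nat \<Rightarrow> nat list \<Rightarrow> bool \<Rightarrow> bool" where
  "tm_decides_within M T x b =
     (\<exists>n\<le>T. fst ((tm_step M ^^ n) (0, [], x)) = (if b then 1 else 2))"

fun bin :: "nat \<Rightarrow> nat list" where
  "bin n = (if n = 0 then [] else (n mod 2 + 1) # bin (n div 2))"

definition tok :: "nat \<Rightarrow> nat list" where
  "tok n = bin n @ [3]"

definition enc_natlist :: "nat list \<Rightarrow> nat list" where
  "enc_natlist xs = tok (length xs) @ concat (map tok xs)"

definition enc_trans :: "(nat, nat) trans \<Rightarrow> nat list" where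
  "enc_trans \<tau> = tok (tsource \<tau>) @ enc_natlist (sorted_list_of_multiset (tout \<tau>))
                  @ enc_natlist (sorted_list_of_multiset (ttarget \<tau>))"

text \<open>A grammar is given by its initial state and a list of its transitions
(the state set is the set of sources, the alphabet is fixed).\<close>

definition enc_grammar :: "nat \<Rightarrow> (nat, nat) trans list \<Rightarrow> nat list" where
  "enc_grammar s0 ts = tok s0 @ tok (length ts) @ concat (map enc_trans ts)"

end

(* A run of a regular commutative grammar is the edge multiset of a walk from the initial state to a
   transition with empty target, so outputs are the Parikh images of such walks. If two grammars
   have a common output, they have one produced by walks of polynomial length: a run splits into a
   kept part of polynomial size that already uses all its transitions, and free simple cycles; a
   long family of small integer vectors (the outputs of the free cycles, counted negatively for the
   second grammar) with a small sum contains a nonempty subfamily of sum zero, and its cycles can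
   be removed from both runs. For a fixed alphabet it therefore suffices to tabulate the Parikh
   vectors of all walks up to a polynomial length. The vectors are stored as numbers in a base
   larger than this length. The tabulation is a nest of counted loops over registers and bit arrays
   with polynomially bounded indices, and each elementary command costs a Turing machine one sweep
   over the tape. *)
theory Submission
  imports Defs "HOL-Library.Nat_Bijection" "HOL-Library.Countable" "HOL-Library.More_List"
begin

section \<open>Zero-sum submultisets of integer vectors\<close>

text \<open>The zero-sum argument is one-dimensional at heart: integers of absolute value at most
  \<open>B\<close> with total at most \<open>B\<close> can be ordered so that all prefix sums stay
  within \<open>2 * B\<close>, and two equal prefix sums enclose a zero-sum block. Sums of blocks
  are then the vectors of the next dimension, with \<open>B\<close> replaced by
  \<open>B * (4 * B + 2)\<close>; the exponent grows about fivefold per letter, which is polynomial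
  only for a fixed alphabet. The total is small because equal outputs make the signed sum of the
  free cycles equal to the difference of the outputs of the two kept parts. Keeping every used
  transition is what preserves connectedness when cycles are removed. On the machine side the
  obstacle is to bound the running time without analysing runs. Values are unary (positions of
  marks), loops are counted and cannot be left early, and \<open>CAP\<close> bounds every register,
  so a time bound in the final value of \<open>CAP\<close> can be read off the syntax. The price is
  that each arithmetic step has to be shown to stay below \<open>CAP\<close>, where
  \<open>Inc\<close> would silently do nothing.\<close>

lemma sum_mset_ge_0: "\<forall>x\<in>#X. 0 \<le> g x \<Longrightarrow> 0 \<le> (\<Sum>x\<in>#X. g x :: int)"
  by (induction X) auto

lemma bounded_prefix_sums:
  fixes X :: "'v multiset" and g :: "'v \<Rightarrow> int"
  assumes el: "\<forall>x\<in>#X. \<bar>g x\<bar> \<le> B" and tot: "\<bar>\<Sum>x\<in>#X. g x\<bar> \<le> B"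
    and "m \<le> size X"
  shows "\<exists>xs. length xs = m \<and> mset xs \<subseteq># X \<and> (\<forall>i\<le>m. \<bar>sum_list (map g (take i xs))\<bar> \<le> 2 * B)"
  using assms(3)
proof (induction m)
  case 0
  have "0 \<le> B" using tot by linarith
  then show ?case by simp
next
  case (Suc m)
  then obtain xs where xs: "length xs = m" "mset xs \<subseteq># X"
    "\<forall>i\<le>m. \<bar>sum_list (map g (take i xs))\<bar> \<le> 2 * B" by auto
  define Y where "Y = X - mset xs"
  have X: "X = mset xs + Y" using xs(2) by (simp add: Y_def)
  have Yne: "Y \<noteq> {#}" using X xs(1) Suc.prems by auto
  define \<sigma> where "\<sigma> = sum_list (map g xs)"
  have sX: "(\<Sum>x\<in>#X. g x) = \<sigma> + (\<Sum>x\<in>#Y. g x)"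
    by (simp add: X \<sigma>_def flip: sum_mset_sum_list mset_map)
  have \<sigma>b: "\<bar>\<sigma>\<bar> \<le> 2 * B" using xs(1,3) by (auto simp: \<sigma>_def)
  have "\<exists>y\<in>#Y. \<bar>\<sigma> + g y\<bar> \<le> 2 * B"
  proof (cases "\<bar>\<sigma>\<bar> \<le> B")
    case True
    obtain y where "y \<in># Y" using Yne by auto
    moreover have "\<bar>g y\<bar> \<le> B" using el X calculation by auto
    ultimately show ?thesis using True by (intro bexI[of _ y]) auto
  next
    case False
    show ?thesis
    proof (cases "\<sigma> > B")
      case True
      have "\<exists>y\<in>#Y. g y < 0"
      proof (rule ccontr)
        assume "\<not> ?thesis"
        then have "(\<Sum>x\<in>#Y. g x) \<ge> 0" by (auto intro!: sum_mset_ge_0 simp: not_less)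
        then show False using sX tot True by linarith
      qed
      then obtain y where y: "y \<in># Y" "g y < 0" by auto
      moreover have "\<bar>g y\<bar> \<le> B" using el y(1) X by (metis union_iff)
      ultimately show ?thesis using True \<sigma>b by (intro bexI[of _ y]) auto
    next
      case F2: False
      have "\<exists>y\<in>#Y. g y > 0"
      proof (rule ccontr)
        assume "\<not> ?thesis"
        then have "(\<Sum>x\<in>#Y. - g x) \<ge> 0" by (auto intro!: sum_mset_ge_0 simp: not_less)
        moreover have "(\<Sum>x\<in>#Y. - g x) = - (\<Sum>x\<in>#Y. g x)" by (induction Y) auto
        ultimately show False using sX tot False F2 by linarith
      qed
      then obtain y where y: "y \<in># Y" "g y > 0" by auto
      moreover have "\<bar>g y\<bar> \<le> B" using el y(1) X by (metis union_iff)
      ultimately show ?thesis using False F2 \<sigma>b by (intro bexI[of _ y]) auto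
    qed
  qed
  then obtain y where y: "y \<in># Y" "\<bar>\<sigma> + g y\<bar> \<le> 2 * B" by auto
  have "\<bar>sum_list (map g (take i (xs @ [y])))\<bar> \<le> 2 * B" if "i \<le> Suc m" for i
    using xs y that by (cases "i = Suc m") (auto simp: \<sigma>_def)
  moreover have "mset (xs @ [y]) \<subseteq># X" using y(1) by (simp add: X)
  ultimately show ?case using xs(1) by (intro exI[of _ "xs @ [y]"]) auto
qed

text \<open>A list of \<open>4 * B + 1\<close> elements has \<open>4 * B + 2\<close> prefix sums,
  counting the empty one, but only \<open>4 * B + 1\<close> integers have absolute value at most
  \<open>2 * B\<close>. The segment between two equal prefix sums has sum zero.\<close>

lemma small_zero_sum_submultiset:
  fixes X :: "'v multiset" and g :: "'v \<Rightarrow> int" and B :: nat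
  assumes el: "\<forall>x\<in>#X. \<bar>g x\<bar> \<le> int B" and tot: "\<bar>\<Sum>x\<in>#X. g x\<bar> \<le> int B"
    and sz: "4 * B + 1 \<le> size X"
  shows "\<exists>Y. Y \<subseteq># X \<and> Y \<noteq> {#} \<and> size Y \<le> 4 * B + 1 \<and> (\<Sum>x\<in>#Y. g x) = 0"
proof -
  let ?R = "4 * B + 1"
  obtain xs where xs: "length xs = ?R" "mset xs \<subseteq># X"
    "\<forall>i\<le>?R. \<bar>sum_list (map g (take i xs))\<bar> \<le> 2 * int B"
    using bounded_prefix_sums[OF el tot sz] by auto
  let ?f = "\<lambda>i. sum_list (map g (take i xs))"
  have "?f ` {0..?R} \<subseteq> {- 2 * int B..2 * int B}" using xs(3) by fastforce
  then have "card (?f ` {0..?R}) \<le> card {- 2 * int B..2 * int B}" by (intro card_mono) auto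
  then have "card (?f ` {0..?R}) < card {0..?R}" by simp
  then have "\<not> inj_on ?f {0..?R}" using pigeonhole by blast
  then obtain i j where ij: "i < j" "j \<le> ?R" "?f i = ?f j"
    unfolding inj_on_def by (metis atLeastAtMost_iff linorder_neqE_nat)
  define ys where "ys = take (j - i) (drop i xs)"
  have tj: "take j xs = take i xs @ ys"
    using ij by (simp add: ys_def flip: take_add)
  have split: "xs = take i xs @ ys @ drop j xs"
    by (metis append.assoc append_take_drop_id tj)
  have "mset xs = mset (take i xs @ ys @ drop j xs)" using split by simp
  then have "mset ys \<subseteq># mset xs" by simp
  then have "mset ys \<subseteq># X" using xs(2) by (rule subset_mset.order_trans)
  moreover have "length ys = j - i" using ij xs(1) by (simp add: ys_def)
  moreover have "sum_list (map g ys) = 0" using ij(3) tj by simp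
  ultimately show ?thesis using ij
    by (intro exI[of _ "mset ys"]) (auto simp flip: sum_mset_sum_list mset_map)
qed

text \<open>Removing a zero-sum block leaves the total unchanged, so the hypotheses survive and
  blocks can be peeled off until few elements remain.\<close>

lemma zero_sum_blocks:
  fixes X :: "'v multiset" and g :: "'v \<Rightarrow> int" and B :: nat
  assumes el: "\<forall>x\<in>#X. \<bar>g x\<bar> \<le> int B" and tot: "\<bar>\<Sum>x\<in>#X. g x\<bar> \<le> int B"
  shows "\<exists>L \<B>. X = L + \<Sum>\<^sub># \<B> \<and> size L \<le> 4 * B + 1 \<and>
    (\<forall>Y\<in>#\<B>. Y \<noteq> {#} \<and> size Y \<le> 4 * B + 1 \<and> (\<Sum>x\<in>#Y. g x) = 0)"
  using assms
proof (induction "size X" arbitrary: X rule: less_induct)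
  case less
  show ?case
  proof (cases "size X \<le> 4 * B + 1")
    case True
    then show ?thesis by (intro exI[of _ X] exI[of _ "{#}"]) simp
  next
    case False
    then obtain Y where Y: "Y \<subseteq># X" "Y \<noteq> {#}" "size Y \<le> 4 * B + 1" "(\<Sum>x\<in>#Y. g x) = 0"
      using small_zero_sum_submultiset[OF less.prems] by auto
    define X' where "X' = X - Y"
    have X: "X = X' + Y" using Y(1) by (simp add: X'_def)
    have "size X' < size X" using Y(2) by (simp add: X nonempty_has_size)
    then obtain L \<B> where LB: "X' = L + \<Sum>\<^sub># \<B>" "size L \<le> 4 * B + 1"
      "\<forall>Y\<in>#\<B>. Y \<noteq> {#} \<and> size Y \<le> 4 * B + 1 \<and> (\<Sum>x\<in>#Y. g x) = 0"
      using less.hyps[of X'] less.prems Y(4) by (auto simp: X)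
    then show ?thesis using X Y by (intro exI[of _ L] exI[of _ "add_mset Y \<B>"]) auto
  qed
qed

text \<open>Zero-sum families are found among sums of blocks or outputs of cycles; this pulls them
  back to the blocks or cycles themselves.\<close>

lemma image_mset_subseteq_lift:
  assumes "Y \<subseteq># image_mset h X"
  shows "\<exists>Z. Z \<subseteq># X \<and> Y = image_mset h Z"
  using assms
proof (induction Y arbitrary: X)
  case empty
  then show ?case by (intro exI[of _ "{#}"]) simp
next
  case (add y Y)
  then have "y \<in># image_mset h X" by (meson insert_subset_eq_iff)
  then obtain x where x: "x \<in># X" "y = h x" by auto
  then obtain X' where X': "X = add_mset x X'" by (metis mset_add)
  have "Y \<subseteq># image_mset h X'" using add.prems by (simp add: X' x(2))
  then obtain Z where "Z \<subseteq># X'" "Y = image_mset h Z" using add.IH by blast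
  then show ?case by (intro exI[of _ "add_mset x Z"]) (simp add: X' x(2))
qed

lemma sum_mset_abs_le:
  fixes g :: "'v \<Rightarrow> int"
  assumes "\<forall>x\<in>#X. \<bar>g x\<bar> \<le> B" shows "\<bar>\<Sum>x\<in>#X. g x\<bar> \<le> int (size X) * B"
  using assms by (induction X) (auto simp: algebra_simps)

lemma Union_mset_mono_sub: "\<A> \<subseteq># \<B> \<Longrightarrow> \<Sum>\<^sub># \<A> \<subseteq># (\<Sum>\<^sub># \<B> :: 'v multiset)"
  by (metis mset_subset_eq_add_left subset_mset.add_diff_inverse sum_mset.union)

lemma size_Union_mset_le:
  "(\<forall>Y\<in>#\<B>. size Y \<le> r) \<Longrightarrow> size (\<Sum>\<^sub># \<B> :: 'v multiset) \<le> size \<B> * r"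
  by (induction \<B>) auto

text \<open>A block has at most \<open>4 * B + 1\<close> vectors, so its sum has coordinates at most
  \<open>B * (4 * B + 1)\<close>. The total of all blocks is the total of \<open>X\<close> minus
  that of the leftover, which costs one more \<open>B\<close>. In the factor \<open>1 + ...\<close>
  the 1 pays for the leftover and the rest is the number of blocks needed in dimension
  \<open>k\<close>.\<close>

fun zs_bound :: "nat \<Rightarrow> nat \<Rightarrow> nat" where
  "zs_bound 0 B = 1"
| "zs_bound (Suc k) B = (4 * B + 1) * (1 + zs_bound k (B * (4 * B + 2)))"

text \<open>Induction on the dimension: blocks that vanish in coordinate \<open>k\<close> are treated as single
  vectors of the remaining coordinates.\<close>

lemma zero_sum_submultiset:
  fixes X :: "(nat \<Rightarrow> int) multiset" and B :: nat
  assumes "\<forall>x\<in>#X. \<forall>a<k. \<bar>x a\<bar> \<le> int B" and "\<forall>a<k. \<bar>\<Sum>x\<in>#X. x a\<bar> \<le> int B"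
    and "zs_bound k B \<le> size X"
  shows "\<exists>Y. Y \<subseteq># X \<and> Y \<noteq> {#} \<and> (\<forall>a<k. (\<Sum>x\<in>#Y. x a) = 0)"
  using assms
proof (induction k arbitrary: X B)
  case 0
  then have "X \<noteq> {#}" by auto
  then show ?case by auto
next
  case (Suc k)
  let ?R = "4 * B + 1" and ?B' = "B * (4 * B + 2)"
  have "\<forall>x\<in>#X. \<bar>x k\<bar> \<le> int B" "\<bar>\<Sum>x\<in>#X. x k\<bar> \<le> int B" using Suc.prems by auto
  then obtain L \<B> where LB: "X = L + \<Sum>\<^sub># \<B>" "size L \<le> ?R"
    "\<forall>Y\<in>#\<B>. Y \<noteq> {#} \<and> size Y \<le> ?R \<and> (\<Sum>x\<in>#Y. x k) = 0"
    using zero_sum_blocks[of X "\<lambda>x. x k" B] by auto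
  define h where "h Y = (\<lambda>a. \<Sum>x\<in>#Y. x a)" for Y :: "(nat \<Rightarrow> int) multiset"
  define X' where "X' = image_mset h \<B>"
  have hsum: "(\<Sum>x\<in>#image_mset h \<C>. x a) = (\<Sum>x\<in>#\<Sum>\<^sub># \<C>. x a)" for \<C> a
    by (induction \<C>) (auto simp: h_def)
  have inX: "x \<in># X" if "Y \<in># \<B>" "x \<in># Y" for x Y
    using that LB(1) by (auto simp: in_Union_mset_iff)
  have "\<bar>h Y a\<bar> \<le> int ?B'" if "Y \<in># \<B>" "a < k" for Y a
  proof -
    have "\<bar>h Y a\<bar> \<le> int (size Y) * int B"
      unfolding h_def using Suc.prems(1) inX[OF that(1)] that(2)
      by (intro sum_mset_abs_le) auto
    also have "\<dots> \<le> int ?R * int B" using LB(3) that by (intro mult_right_mono) auto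
    also have "\<dots> \<le> int ?B'" by (simp add: algebra_simps)
    finally show ?thesis .
  qed
  then have 1: "\<forall>x\<in>#X'. \<forall>a<k. \<bar>x a\<bar> \<le> int ?B'" by (auto simp: X'_def)
  have 2: "\<forall>a<k. \<bar>\<Sum>x\<in>#X'. x a\<bar> \<le> int ?B'"
  proof (intro allI impI)
    fix a assume a: "a < k"
    have "\<bar>\<Sum>x\<in>#L. x a\<bar> \<le> int (size L) * int B"
      using Suc.prems(1) LB(1) a by (intro sum_mset_abs_le) auto
    also have "\<dots> \<le> int ?R * int B" using LB(2) by (intro mult_right_mono) auto
    finally have L: "\<bar>\<Sum>x\<in>#L. x a\<bar> \<le> int ?R * int B" .
    have "(\<Sum>x\<in>#X. x a) = (\<Sum>x\<in>#L. x a) + (\<Sum>x\<in>#X'. x a)"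
      unfolding X'_def hsum by (simp add: LB(1))
    moreover have "\<bar>\<Sum>x\<in>#X. x a\<bar> \<le> int B" using Suc.prems(2) a by auto
    ultimately have "\<bar>\<Sum>x\<in>#X'. x a\<bar> \<le> int B + int ?R * int B" using L by linarith
    then show "\<bar>\<Sum>x\<in>#X'. x a\<bar> \<le> int ?B'" by (simp add: algebra_simps)
  qed
  have 3: "zs_bound k ?B' \<le> size X'"
  proof -
    have "size X \<le> ?R + size \<B> * ?R"
      using LB(2) size_Union_mset_le[of \<B> ?R] LB(3) by (auto simp: LB(1))
    then have "?R * (1 + zs_bound k ?B') \<le> ?R * (1 + size \<B>)"
      using Suc.prems(3) by (auto simp: algebra_simps)
    then have "1 + zs_bound k ?B' \<le> 1 + size \<B>" by (subst (asm) mult_le_cancel1) simp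
    then show ?thesis by (simp add: X'_def)
  qed
  obtain Y' where Y': "Y' \<subseteq># X'" "Y' \<noteq> {#}" "\<forall>a<k. (\<Sum>x\<in>#Y'. x a) = 0"
    using Suc.IH[OF 1 2 3] by auto
  obtain \<C> where C: "\<C> \<subseteq># \<B>" "Y' = image_mset h \<C>"
    using Y'(1) image_mset_subseteq_lift unfolding X'_def by blast
  have "\<Sum>\<^sub># \<C> \<subseteq># \<Sum>\<^sub># \<B>" using C(1) by (rule Union_mset_mono_sub)
  then have "\<Sum>\<^sub># \<C> \<subseteq># X" using LB(1) by (metis mset_subset_eq_add_right subset_mset.order_trans)
  moreover have "\<Sum>\<^sub># \<C> \<noteq> {#}"
  proof -
    obtain Y where "Y \<in># \<C>" using Y'(2) C(2) by auto
    moreover then have "Y \<noteq> {#}" using LB(3) C(1) by (auto dest: mset_subset_eqD)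
    ultimately show ?thesis by auto
  qed
  moreover have "(\<Sum>x\<in>#\<Sum>\<^sub># \<C>. x a) = 0" if "a < Suc k" for a
  \<comment> \<open>Coordinate \<open>k\<close> vanishes on each block separately, the other
    coordinates by the choice of \<open>Y'\<close> in the induction hypothesis.\<close>
  proof (cases "a = k")
    case True
    have "\<forall>Y\<in>#\<C>. h Y k = 0" using LB(3) C(1) by (auto simp: h_def dest: mset_subset_eqD)
    then have "(\<Sum>Y\<in>#\<C>. h Y k) = 0" by (induction \<C>) auto
    then show ?thesis using hsum[where \<C>=\<C> and a=k] True by (simp add: multiset.map_comp comp_def)
  next
    case False
    then show ?thesis using Y'(3) that C(2) hsum[where \<C>=\<C> and a=a] by auto
  qed
  ultimately show ?case by (intro exI[of _ "\<Sum>\<^sub># \<C>"]) auto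
qed

text \<open>For \<open>B\<close> at least 2, \<open>4 * B + 1\<close> is at most
  \<open>B ^ 4\<close> and \<open>B * (4 * B + 2)\<close> at most \<open>B ^ 5\<close>. So the
  recursion of \<open>zs_bound\<close> contributes a factor \<open>B ^ 4\<close>, one more
  \<open>B\<close> for the summand 1, and a fifth power in the argument.\<close>

fun zs_exp :: "nat \<Rightarrow> nat" where
  "zs_exp 0 = 0"
| "zs_exp (Suc k) = 5 + 5 * zs_exp k"

lemma zs_bound_mono: "B \<le> C \<Longrightarrow> zs_bound k B \<le> zs_bound k C"
proof (induction k arbitrary: B C)
  case (Suc k)
  have "B * (4 * B + 2) \<le> C * (4 * C + 2)" using Suc.prems by (intro mult_le_mono) auto
  then show ?case unfolding zs_bound.simps using Suc by (intro mult_le_mono add_left_mono) auto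
qed simp

lemma zs_bound_le: "2 \<le> B \<Longrightarrow> zs_bound k B \<le> B ^ zs_exp k"
proof (induction k arbitrary: B)
  case (Suc k)
  have b3: "8 \<le> B ^ 3" using power_mono[of 2 B 3] Suc.prems by simp
  have "4 * B + 1 \<le> 8 * B" using Suc.prems by simp
  also have "\<dots> \<le> B ^ 3 * B" using b3 by (rule mult_right_mono) simp
  finally have r: "4 * B + 1 \<le> B ^ 4" by (simp add: power_Suc eval_nat_numeral algebra_simps)
  have "B * (4 * B + 2) \<le> B * (8 * B)" using Suc.prems by (intro mult_left_mono) auto
  also have "\<dots> \<le> B * (B ^ 3 * B)" using b3 by (intro mult_left_mono mult_right_mono) auto
  also have "\<dots> = B ^ 5" by (simp add: eval_nat_numeral algebra_simps)
  finally have "zs_bound k (B * (4 * B + 2)) \<le> zs_bound k (B ^ 5)" by (rule zs_bound_mono)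
  also have "\<dots> \<le> (B ^ 5) ^ zs_exp k" using Suc.prems
    by (intro Suc.IH) (meson le_trans self_le_power zero_less_numeral less_le_trans one_le_numeral)
  finally have z: "zs_bound k (B * (4 * B + 2)) \<le> B ^ (5 * zs_exp k)" by (simp add: power_mult)
  have "1 \<le> B ^ (5 * zs_exp k)" using Suc.prems by simp
  then have "1 + zs_bound k (B * (4 * B + 2)) \<le> 2 * B ^ (5 * zs_exp k)" using z by linarith
  also have "\<dots> \<le> B * B ^ (5 * zs_exp k)" using Suc.prems by (rule mult_right_mono) simp
  finally have "zs_bound (Suc k) B \<le> B ^ 4 * (B * B ^ (5 * zs_exp k))"
    unfolding zs_bound.simps by (rule mult_le_mono[OF r])
  also have "\<dots> = B ^ zs_exp (Suc k)" by (simp add: power_add eval_nat_numeral algebra_simps)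
  finally show ?case .
qed simp

section \<open>Runs, walks and small common outputs\<close>

text \<open>\<open>T\<close> is what is left at the end: \<open>{#t#}\<close> if the walk stops in
  \<open>t\<close>, \<open>{#}\<close> if its last transition has empty target. One predicate thus
  covers open walks, closed walks and complete runs, and \<open>T\<close> fits directly into the
  flow equation.\<close>

fun walk :: "'s \<Rightarrow> ('s, 'a) trans list \<Rightarrow> 's multiset \<Rightarrow> bool" where
  "walk s [] T \<longleftrightarrow> T = {#s#}"
| "walk s (\<tau> # ps) T \<longleftrightarrow> tsource \<tau> = s \<and>
     (ttarget \<tau> = {#} \<and> ps = [] \<and> T = {#} \<or> (\<exists>s'. ttarget \<tau> = {#s'#} \<and> walk s' ps T))"

lemma msource_simps [simp]:
  "msource {#} = {#}" "msource (add_mset \<tau> D) = add_mset (tsource \<tau>) (msource D)"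
  "msource (D + E) = msource D + msource E" "size (msource D) = size D"
  by (simp_all add: msource_def)

lemma mtarget_simps [simp]:
  "mtarget {#} = {#}" "mtarget (add_mset \<tau> D) = ttarget \<tau> + mtarget D"
  "mtarget (D + E) = mtarget D + mtarget E"
  by (simp_all add: mtarget_def)

lemma mout_simps [simp]:
  "mout {#} = {#}" "mout (add_mset \<tau> D) = tout \<tau> + mout D"
  "mout (D + E) = mout D + mout E"
  by (simp_all add: mout_def)

lemma size_mtarget_le: "\<forall>\<tau>\<in>#D. size (ttarget \<tau>) \<le> 1 \<Longrightarrow> size (mtarget D) \<le> size D"
  by (induction D) auto

lemma size_mout_le: "\<forall>\<tau>\<in>#D. size (tout \<tau>) \<le> 1 \<Longrightarrow> size (mout D) \<le> size D"
  by (induction D) auto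

lemma walk_append: "walk s ps {#u#} \<Longrightarrow> walk u qs T \<Longrightarrow> walk s (ps @ qs) T"
  by (induction ps arbitrary: s) auto

lemma walk_append_ConsD:
  "walk s (ps @ q # qs) T \<Longrightarrow> walk s ps {#tsource q#} \<and> walk (tsource q) (q # qs) T"
proof (induction ps arbitrary: s)
  case (Cons \<tau> ps)
  then show ?case by auto
qed auto

lemma walk_flow: "walk s ps T \<Longrightarrow> msource (mset ps) + T = mtarget (mset ps) + {#s#}"
proof (induction ps arbitrary: s)
  case (Cons \<tau> ps)
  then show ?case by (auto simp: add_mset_commute)
qed auto

lemma walk_chain: "walk s ps T \<Longrightarrow> Suc i < length ps \<Longrightarrow> tsource (ps ! Suc i) \<in># ttarget (ps ! i)"
proof (induction ps arbitrary: s i)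
  case (Cons \<tau> ps)
  then obtain s' where s': "ttarget \<tau> = {#s'#}" "walk s' ps T" by auto
  show ?case
  proof (cases i)
    case 0
    then show ?thesis using s' Cons.prems by (cases ps) auto
  next
    case (Suc j)
    then show ?thesis using Cons.IH[OF s'(2), of j] Cons.prems by auto
  qed
qed auto

lemma walk_last: "walk s ps {#t#} \<Longrightarrow> ps \<noteq> [] \<Longrightarrow> t \<in># ttarget (last ps)"
proof (induction ps arbitrary: s)
  case (Cons \<tau> ps)
  then show ?case by (cases ps) auto
qed auto

lemma walk_target_in_sources:
  "walk s ps {#} \<Longrightarrow> \<tau> \<in> set ps \<Longrightarrow> t \<in># ttarget \<tau> \<Longrightarrow> t \<in> tsource ` set ps"
proof (induction ps arbitrary: s)
  case (Cons p ps)
  show ?case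
  proof (cases "\<tau> = p")
    case True
    then have "ttarget p = {#t#}" "walk t ps {#}" using Cons.prems by auto
    then show ?thesis by (cases ps) auto
  next
    case False
    then have "\<tau> \<in> set ps" using Cons.prems by auto
    moreover then obtain s' where "walk s' ps {#}" using Cons.prems by auto
    ultimately show ?thesis using Cons.IH Cons.prems(3) by auto
  qed
qed auto

lemma flow_contains_walk:
  assumes "\<forall>\<tau>\<in>#D. size (ttarget \<tau>) \<le> 1" "msource D + T = mtarget D + {#s#}" "size T \<le> 1"
  shows "\<exists>ps. walk s ps T \<and> mset ps \<subseteq># D"
  using assms
proof (induction "size D" arbitrary: D s)
  case 0
  then show ?case by (intro exI[of _ "[]"]) auto
next
  case (Suc m)
  show ?case
  proof (cases "T = {#s#}")
    case True
    then show ?thesis by (intro exI[of _ "[]"]) auto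
  next
    case False
    have "s \<notin># T"
    proof
      assume "s \<in># T"
      then obtain T' where "T = add_mset s T'" by (metis mset_add)
      then show False using Suc.prems(3) False by simp
    qed
    moreover have "s \<in># msource D + T" by (simp add: Suc.prems(2))
    ultimately have "s \<in># msource D" by auto
    then obtain \<tau> where \<tau>: "\<tau> \<in># D" "tsource \<tau> = s" by (auto simp: msource_def)
    then obtain D' where D': "D = add_mset \<tau> D'" by (metis mset_add)
    have flow: "msource D' + T = mtarget D' + ttarget \<tau>"
      using Suc.prems(2) \<tau>(2) by (simp add: D' ac_simps)
    have sm: "size (mtarget D') \<le> size D'" using Suc.prems(1) D' by (intro size_mtarget_le) auto
    show ?thesis
    proof (cases "ttarget \<tau> = {#}")
      case True
      \<comment> \<open>A transition with empty target uses up the surplus of one: the other targets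
        number at most \<open>size D'\<close>, so nothing is left for \<open>T\<close>.\<close>
      have "size D' + size T = size (mtarget D')" using arg_cong[OF flow, of size] True by simp
      then have "size T = 0" using sm by linarith
      then have "T = {#}" by simp
      then show ?thesis using True \<tau> by (intro exI[of _ "[\<tau>]"]) (auto simp: D')
    next
      case False
      then have "size (ttarget \<tau>) \<noteq> 0" by simp
      moreover have "size (ttarget \<tau>) \<le> 1" using Suc.prems(1) \<tau>(1) by auto
      ultimately have "size (ttarget \<tau>) = 1" by linarith
      then obtain s' where s': "ttarget \<tau> = {#s'#}" by (metis size_1_singleton_mset)
      have "\<exists>ps. walk s' ps T \<and> mset ps \<subseteq># D'"
        using Suc.hyps(2) Suc.prems D' flow s' by (intro Suc.hyps(1)) auto
      then obtain ps where "walk s' ps T" "mset ps \<subseteq># D'" by auto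
      then show ?thesis using \<tau>(2) s' by (intro exI[of _ "\<tau> # ps"]) (auto simp: D')
    qed
  qed
qed

text \<open>Sources and targets of \<open>C\<close> are equally many and no transition has two
  targets, so \<open>\<tau>\<close> has exactly one. Without \<open>\<tau>\<close> the rest is a
  flow from that target back to the source of \<open>\<tau>\<close>.\<close>

lemma circulation_contains_closed_walk:
  assumes "\<forall>\<tau>\<in>#C. size (ttarget \<tau>) \<le> 1" "msource C = mtarget C" "\<tau> \<in># C"
  shows "\<exists>ps. ps \<noteq> [] \<and> walk (tsource \<tau>) ps {#tsource \<tau>#} \<and> mset ps \<subseteq># C"
proof -
  obtain C' where C': "C = add_mset \<tau> C'" using assms(3) by (metis mset_add)
  have sm: "size (mtarget C') \<le> size C'" using assms(1) C' by (intro size_mtarget_le) auto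
  have "size (msource C) = size (mtarget C)" using assms(2) by simp
  then have "1 \<le> size (ttarget \<tau>)" using sm by (simp add: C')
  then have "size (ttarget \<tau>) = 1" using assms(1,3) by (simp add: order_antisym)
  then obtain v where v: "ttarget \<tau> = {#v#}" by (metis size_1_singleton_mset)
  have "msource C' + {#tsource \<tau>#} = mtarget C' + {#v#}" using assms(2) v by (simp add: C')
  then obtain ps where "walk v ps {#tsource \<tau>#}" "mset ps \<subseteq># C'"
    using flow_contains_walk[of C' "{#tsource \<tau>#}" v] assms(1) C' by auto
  then show ?thesis using v by (intro exI[of _ "\<tau> # ps"]) (auto simp: C')
qed

text \<open>Euler's argument: take a longest walk inside \<open>D\<close>. The rest is a
  circulation; if it were nonempty, connectedness would make it meet the walk, and a closed walk
  could be spliced in.\<close>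

lemma eulerian_walk:
  assumes reg: "\<forall>\<tau>\<in>#D. size (ttarget \<tau>) \<le> 1" and flow: "msource D = mtarget D + {#s0#}"
    and conn: "connected_from s0 D"
  shows "\<exists>ps. walk s0 ps {#} \<and> mset ps = D"
proof -
  let ?P = "\<lambda>ps. walk s0 ps {#} \<and> mset ps \<subseteq># D"
  obtain ps0 where "?P ps0" using flow_contains_walk[OF reg, of "{#}" s0] flow by auto
  moreover have "\<forall>ps. ?P ps \<longrightarrow> length ps < Suc (size D)"
    using size_mset_mono by (auto simp: less_Suc_eq_le simp flip: size_mset)
  ultimately obtain ps where ps: "?P ps" and max: "\<forall>qs. ?P qs \<longrightarrow> length qs \<le> length ps"
    using ex_has_greatest_nat[of ?P ps0 length "Suc (size D)"] by blast
  define C where "C = D - mset ps"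
  have D: "D = mset ps + C" using ps by (simp add: C_def)
  have circ: "msource C = mtarget C"
    using flow walk_flow[of s0 ps "{#}"] ps by (simp add: D)
  have "C = {#}"
  proof (rule ccontr)
    assume "C \<noteq> {#}"
    then obtain \<tau>0 where \<tau>0: "\<tau>0 \<in># C" by auto
    let ?U = "tsource ` set ps"
    have "ps \<noteq> []" using ps by auto
    then have s0U: "s0 \<in> ?U" using ps by (cases ps) auto
    \<comment> \<open>Otherwise every transition of \<open>D\<close> that starts in a visited state
      lies on the walk, so the visited states are closed under the transitions of \<open>D\<close>,
      and connectedness puts the source of \<open>\<tau>0\<close> among them.\<close>
    have "\<exists>\<tau>\<in>#C. tsource \<tau> \<in> ?U"
    proof (rule ccontr)
      assume no: "\<not> ?thesis"
      have step: "t \<in> ?U" if "\<tau> \<in># D" "tsource \<tau> \<in> ?U" "t \<in># ttarget \<tau>" for \<tau> t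
      proof -
        have "\<tau> \<in> set ps" using that no D by auto
        then show ?thesis using walk_target_in_sources that(3) ps by metis
      qed
      have "tsource \<tau>0 \<in># msource D" using \<tau>0 by (auto simp: D msource_def)
      then consider "tsource \<tau>0 = s0" | \<tau>s where "\<tau>s \<noteq> []" "set \<tau>s \<subseteq> set_mset D"
        "tsource (hd \<tau>s) = s0"
        "\<forall>i. Suc i < length \<tau>s \<longrightarrow> tsource (\<tau>s ! Suc i) \<in># ttarget (\<tau>s ! i)"
        "tsource \<tau>0 \<in># ttarget (last \<tau>s)"
        using conn unfolding connected_from_def by blast
      then have "tsource \<tau>0 \<in> ?U"
      proof cases
        case 2
        have "i < length \<tau>s \<Longrightarrow> tsource (\<tau>s ! i) \<in> ?U" for i
        proof (induction i)
          case 0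
          then show ?case using 2 s0U by (simp add: hd_conv_nth)
        next
          case (Suc i)
          then show ?case using step[of "\<tau>s ! i"] 2
            by (meson Suc_lessD nth_mem subsetD)
        qed
        then have "tsource (last \<tau>s) \<in> ?U" using 2(1) by (simp add: last_conv_nth)
        then show ?thesis using step 2 by (meson last_in_set subsetD)
      qed (use s0U in simp)
      then show False using no \<tau>0 by auto
    qed
    then obtain \<tau> q where \<tau>: "\<tau> \<in># C" "q \<in> set ps" "tsource \<tau> = tsource q" by auto
    obtain c where c: "c \<noteq> []" "walk (tsource q) c {#tsource q#}" "mset c \<subseteq># C"
      using circulation_contains_closed_walk[OF _ circ \<tau>(1)] reg D \<tau>(3) by auto
    obtain as bs where ab: "ps = as @ q # bs" using \<tau>(2) by (meson split_list)
    have w: "walk s0 as {#tsource q#}" "walk (tsource q) (q # bs) {#}"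
      using walk_append_ConsD ps ab by metis+
    have "walk s0 (as @ c @ q # bs) {#}"
      using walk_append[OF w(1) walk_append[OF c(2) w(2)]] .
    moreover have e: "mset (as @ c @ q # bs) = mset ps + mset c" using ab by simp
    have "mset (as @ c @ q # bs) \<subseteq># D" unfolding e D using c(3) by simp
    ultimately show False using max c(1) ab by fastforce
  qed
  then show ?thesis using ps D by auto
qed

text \<open>The part of the walk before a transition with source \<open>t\<close> is the required
  chain.\<close>

lemma walk_connected:
  assumes "walk s0 ps {#}"
  shows "connected_from s0 (mset ps)"
  unfolding connected_from_def
proof
  fix t assume "t \<in># msource (mset ps)"
  then obtain q where q: "q \<in> set ps" "t = tsource q" by (auto simp: msource_def)
  then obtain as bs where ab: "ps = as @ q # bs" by (meson split_list)
  have w: "walk s0 as {#t#}" using walk_append_ConsD assms ab q(2) by metis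
  show "t = s0 \<or> (\<exists>\<tau>s. \<tau>s \<noteq> [] \<and> set \<tau>s \<subseteq> set_mset (mset ps) \<and> tsource (hd \<tau>s) = s0 \<and>
        (\<forall>i. Suc i < length \<tau>s \<longrightarrow> tsource (\<tau>s ! Suc i) \<in># ttarget (\<tau>s ! i)) \<and>
        t \<in># ttarget (last \<tau>s))"
  proof (cases "as = []")
    case True
    then show ?thesis using w by auto
  next
    case False
    have "tsource (hd as) = s0" using w False by (cases as) auto
    then show ?thesis using False ab walk_chain[OF w] walk_last[OF w] by (intro disjI2 exI[of _ as]) auto
  qed
qed

lemma is_run_iff_walk:
  assumes "\<forall>\<tau>\<in>\<delta>. size (ttarget \<tau>) \<le> 1"
  shows "is_run (\<Sigma>, S, s0, \<delta>) D \<longleftrightarrow> (\<exists>ps. walk s0 ps {#} \<and> set ps \<subseteq> \<delta> \<and> D = mset ps)"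
proof
  assume "is_run (\<Sigma>, S, s0, \<delta>) D"
  then show "\<exists>ps. walk s0 ps {#} \<and> set ps \<subseteq> \<delta> \<and> D = mset ps"
    using eulerian_walk[of D s0] assms unfolding is_run_def by fastforce
next
  assume "\<exists>ps. walk s0 ps {#} \<and> set ps \<subseteq> \<delta> \<and> D = mset ps"
  then show "is_run (\<Sigma>, S, s0, \<delta>) D"
    using walk_flow walk_connected unfolding is_run_def by fastforce
qed

section \<open>Runs as a kept part plus removable cycles\<close>

lemma walk_cycle_decomposition:
  assumes "walk s ps T" "set ps \<subseteq> \<delta>" "finite \<delta>"
  shows "\<exists>P \<C>. mset ps = P + \<Sum>\<^sub># \<C> \<and> size P \<le> card \<delta> \<and>
    (\<forall>C\<in>#\<C>. msource C = mtarget C \<and> C \<noteq> {#} \<and> size C \<le> card \<delta>)"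
  using assms(1,2)
proof (induction "length ps" arbitrary: ps rule: less_induct)
  case less
  show ?case
  proof (cases "length ps \<le> card \<delta>")
    case True
    then show ?thesis by (intro exI[of _ "mset ps"] exI[of _ "{#}"]) auto
  next
    case False
    \<comment> \<open>The first \<open>card \<delta> + 1\<close> transitions have at most
      \<open>card \<delta>\<close> distinct sources, so a source recurs at distance at most
      \<open>card \<delta>\<close>. The segment in between is a closed walk, and cutting it out
      leaves a walk.\<close>
    let ?f = "\<lambda>i. tsource (ps ! i)"
    have "?f ` {0..card \<delta>} \<subseteq> tsource ` \<delta>" using False less.prems(2) by fastforce
    then have "card (?f ` {0..card \<delta>}) \<le> card (tsource ` \<delta>)"
      using assms(3) by (intro card_mono) auto
    also have "\<dots> \<le> card \<delta>" using assms(3) by (rule card_image_le)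
    finally have "\<not> inj_on ?f {0..card \<delta>}" by (intro pigeonhole) simp
    then obtain i j where ij: "i < j" "j \<le> card \<delta>" "?f i = ?f j"
      unfolding inj_on_def by (metis atLeastAtMost_iff linorder_neqE_nat)
    define as bs cs where "as = take i ps" and "bs = take (j - i) (drop i ps)" and "cs = drop j ps"
    have len: "j < length ps" using ij False by simp
    have cs: "cs = ps ! j # drop (Suc j) ps" using len by (simp add: cs_def Cons_nth_drop_Suc)
    have bs: "bs = ps ! i # take (j - i - 1) (drop (Suc i) ps)"
      using ij len by (simp add: bs_def Cons_nth_drop_Suc[symmetric] take_Cons')
    have "take j ps = as @ bs" using ij by (simp add: as_def bs_def flip: take_add)
    then have ps: "ps = as @ bs @ cs" by (metis append.assoc append_take_drop_id cs_def)
    have lbs: "length bs = j - i" using ij len by (simp add: bs_def)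
    have bc: "bs @ cs = ps ! i # (take (j - i - 1) (drop (Suc i) ps) @ cs)"
      by (subst bs) simp
    have "walk s (as @ bs @ cs) T" using less.prems(1) by (simp only: ps[symmetric])
    then have w1: "walk s as {#?f i#}" "walk (?f i) (bs @ cs) T"
      unfolding bc using walk_append_ConsD by fast+
    have w2: "walk (?f i) bs {#?f j#}" "walk (?f j) cs T"
      using w1(2) unfolding cs using walk_append_ConsD by fast+
    have "walk s (as @ cs) T" using walk_append w1(1) w2(2) ij(3) by metis
    moreover have "length (as @ cs) < length ps" using arg_cong[OF ps, of length] lbs ij by simp
    moreover have "set (as @ cs) \<subseteq> \<delta>" using arg_cong[OF ps, of set] less.prems(2) by auto
    ultimately obtain P \<C> where PC: "mset (as @ cs) = P + \<Sum>\<^sub># \<C>" "size P \<le> card \<delta>"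
      "\<forall>C\<in>#\<C>. msource C = mtarget C \<and> C \<noteq> {#} \<and> size C \<le> card \<delta>"
      using less.hyps by blast
    have "mset ps = P + \<Sum>\<^sub># (add_mset (mset bs) \<C>)"
    proof -
      have "mset ps = mset bs + mset (as @ cs)" by (subst ps) simp
      then show ?thesis using PC(1) by simp
    qed
    moreover have "msource (mset bs) = mtarget (mset bs)"
      using walk_flow[OF w2(1)] ij(3) by simp
    moreover have "bs \<noteq> []" by (simp add: bs)
    moreover have "length bs \<le> card \<delta>" using lbs ij by simp
    ultimately show ?thesis using PC
      by (intro exI[of _ P] exI[of _ "add_mset (mset bs) \<C>"]) auto
  qed
qed

text \<open>One member of \<open>\<C>\<close> is chosen for each element of \<open>A\<close>;
  \<open>mset_set\<close> counts every chosen member once, so the selection stays inside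
  \<open>\<C>\<close>.\<close>

lemma cover_by_few:
  assumes "finite A" "A \<subseteq> set_mset (\<Sum>\<^sub># \<C>)"
  shows "\<exists>\<K>. \<K> \<subseteq># \<C> \<and> size \<K> \<le> card A \<and> A \<subseteq> set_mset (\<Sum>\<^sub># \<K>)"
proof -
  have "\<forall>a\<in>A. \<exists>C. C \<in># \<C> \<and> a \<in># C" using assms(2) by (auto simp: in_Union_mset_iff)
  then obtain f where f: "\<forall>a\<in>A. f a \<in># \<C> \<and> a \<in># f a" by metis
  have "mset_set (f ` A) \<subseteq># mset_set (set_mset \<C>)"
    using f assms(1) by (intro subset_imp_msubset_mset_set) auto
  also have "\<dots> \<subseteq># \<C>" by (rule mset_set_set_mset_msubset)
  finally have "mset_set (f ` A) \<subseteq># \<C>" .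
  moreover have "size (mset_set (f ` A)) \<le> card A" using assms(1) by (simp add: card_image_le)
  moreover have "A \<subseteq> set_mset (\<Sum>\<^sub># (mset_set (f ` A)))"
    using f assms(1) by (auto simp: in_Union_mset_iff)
  ultimately show ?thesis by blast
qed

lemma circulation_Union:
  "\<forall>C\<in>#\<C>. msource C = mtarget C \<Longrightarrow> msource (\<Sum>\<^sub># \<C>) = mtarget (\<Sum>\<^sub># \<C>)"
  by (induction \<C>) auto

text \<open>\<open>K\<close> consists of the short remainder of the walk and of one cycle for each
  transition that occurs in any cycle. Dropping free cycles then changes neither the set of
  transitions used, which preserves connectedness, nor the flow balance.\<close>

lemma run_decomposition:
  assumes reg: "\<forall>\<tau>\<in>\<delta>. size (ttarget \<tau>) \<le> 1" and fin: "finite \<delta>"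
    and run: "is_run (\<Sigma>, S, s0, \<delta>) D"
  shows "\<exists>K \<F>. D = K + \<Sum>\<^sub># \<F> \<and> size K \<le> card \<delta> + card \<delta> * card \<delta> \<and>
    (\<forall>C\<in>#\<F>. C \<noteq> {#} \<and> size C \<le> card \<delta>) \<and>
    (\<forall>\<F>'. \<F>' \<subseteq># \<F> \<longrightarrow> is_run (\<Sigma>, S, s0, \<delta>) (K + \<Sum>\<^sub># \<F>'))"
proof -
  obtain ps where ps: "walk s0 ps {#}" "set ps \<subseteq> \<delta>" "D = mset ps"
    using run is_run_iff_walk[OF reg] by blast
  obtain P \<C> where PC: "D = P + \<Sum>\<^sub># \<C>" "size P \<le> card \<delta>"
    "\<forall>C\<in>#\<C>. msource C = mtarget C \<and> C \<noteq> {#} \<and> size C \<le> card \<delta>"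
    using walk_cycle_decomposition[OF ps(1,2) fin] ps(3) by auto
  have sub: "set_mset (\<Sum>\<^sub># \<C>) \<subseteq> \<delta>" using ps(2) PC(1) ps(3)
    by (metis set_mset_mset set_mset_union Un_subset_iff)
  obtain \<K> where K: "\<K> \<subseteq># \<C>" "size \<K> \<le> card (set_mset (\<Sum>\<^sub># \<C>))"
    "set_mset (\<Sum>\<^sub># \<C>) \<subseteq> set_mset (\<Sum>\<^sub># \<K>)"
    using cover_by_few[of "set_mset (\<Sum>\<^sub># \<C>)" \<C>] by auto
  have szK: "size \<K> \<le> card \<delta>" using K(2) card_mono[OF fin sub] by simp
  define \<F> where "\<F> = \<C> - \<K>"
  have C: "\<C> = \<K> + \<F>" using K(1) by (simp add: \<F>_def)
  define Kp where "Kp = P + \<Sum>\<^sub># \<K>"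
  have D: "D = Kp + \<Sum>\<^sub># \<F>" by (simp add: PC(1) C Kp_def)
  have "size (\<Sum>\<^sub># \<K>) \<le> size \<K> * card \<delta>"
    using PC(3) C by (intro size_Union_mset_le) auto
  also have "\<dots> \<le> card \<delta> * card \<delta>" using szK by (rule mult_right_mono) simp
  finally have 1: "size Kp \<le> card \<delta> + card \<delta> * card \<delta>" using PC(2) by (simp add: Kp_def)
  have "is_run (\<Sigma>, S, s0, \<delta>) (Kp + \<Sum>\<^sub># \<F>')" if F': "\<F>' \<subseteq># \<F>" for \<F>'
  proof -
    have "\<Sum>\<^sub># \<F>' \<subseteq># \<Sum>\<^sub># \<F>" using F' by (rule Union_mset_mono_sub)
    then have le: "set_mset (\<Sum>\<^sub># \<F>') \<subseteq> set_mset (\<Sum>\<^sub># \<F>)" by (rule set_mset_mono)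
    have sK: "set_mset (\<Sum>\<^sub># \<F>) \<subseteq> set_mset (\<Sum>\<^sub># \<K>)" using K(3) C by auto
    have sD: "set_mset (Kp + \<Sum>\<^sub># \<F>') = set_mset D"
      using le sK by (auto simp: D Kp_def)
    have cF: "msource (\<Sum>\<^sub># \<F>) = mtarget (\<Sum>\<^sub># \<F>)" "msource (\<Sum>\<^sub># \<F>') = mtarget (\<Sum>\<^sub># \<F>')"
      using PC(3) C F' by (auto intro!: circulation_Union dest: mset_subset_eqD)
    have flow: "msource D = mtarget D + {#s0#}" and cn: "connected_from s0 D" and "set_mset D \<subseteq> \<delta>"
      using run by (auto simp: is_run_def)
    have "msource (Kp + \<Sum>\<^sub># \<F>') = mtarget (Kp + \<Sum>\<^sub># \<F>') + {#s0#}"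
      using flow cF by (simp add: D)
    moreover have "connected_from s0 (Kp + \<Sum>\<^sub># \<F>')"
      using cn unfolding connected_from_def msource_def set_image_mset sD .
    ultimately show ?thesis using sD \<open>set_mset D \<subseteq> \<delta>\<close> by (auto simp: is_run_def)
  qed
  then show ?thesis using D 1 PC(3) C by (intro exI[of _ Kp] exI[of _ \<F>]) auto
qed

text \<open>Size of a kept part plus fewer than \<open>zs_bound\<close> many free cycles of size at
  most \<open>n\<close>. The size \<open>n + n * n\<close> of the kept part is also the coordinate
  bound of the zero-sum argument.\<close>

definition run_bound :: "nat \<Rightarrow> nat \<Rightarrow> nat" where
  "run_bound k n = (n + n * n) + zs_bound k (n + n * n) * n"

text \<open>A pair of runs with equal output of minimal total size has few free cycles: otherwise a
  zero-sum family of cycles (those of the second grammar counted negatively) could be removed from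
  both runs at once.\<close>

lemma small_common_output:
  fixes \<delta>1 \<delta>2 :: "('s, nat) trans set"
  assumes G: "\<forall>\<tau>\<in>\<delta>1. size (ttarget \<tau>) \<le> 1 \<and> size (tout \<tau>) \<le> 1 \<and> set_mset (tout \<tau>) \<subseteq> {0..<k}"
    "finite \<delta>1" "card \<delta>1 \<le> n"
   and H: "\<forall>\<tau>\<in>\<delta>2. size (ttarget \<tau>) \<le> 1 \<and> size (tout \<tau>) \<le> 1 \<and> set_mset (tout \<tau>) \<subseteq> {0..<k}"
    "finite \<delta>2" "card \<delta>2 \<le> n"
   and ne: "cg_out (\<Sigma>1, S1, s1, \<delta>1) \<inter> cg_out (\<Sigma>2, S2, s2, \<delta>2) \<noteq> {}"
  shows "\<exists>D1 D2. is_run (\<Sigma>1, S1, s1, \<delta>1) D1 \<and> is_run (\<Sigma>2, S2, s2, \<delta>2) D2 \<and> mout D1 = mout D2 \<and>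
    size D1 \<le> run_bound k n \<and> size D2 \<le> run_bound k n"
proof -
  let ?R1 = "is_run (\<Sigma>1, S1, s1, \<delta>1)" and ?R2 = "is_run (\<Sigma>2, S2, s2, \<delta>2)"
  let ?P = "\<lambda>(D1, D2). ?R1 D1 \<and> ?R2 D2 \<and> mout D1 = mout D2"
  let ?m = "\<lambda>(D1, D2). size D1 + size D2"
  obtain D0 where "?P D0" using ne by (auto simp: cg_out_def)
  then obtain D where PD: "?P D" and min: "\<forall>E. ?P E \<longrightarrow> ?m D \<le> ?m E"
    using ex_has_least_nat[of ?P D0 ?m] by blast
  obtain D1 D2 where DD: "D = (D1, D2)" by force
  have run: "?R1 D1" "?R2 D2" "mout D1 = mout D2" using PD DD by auto
  obtain K1 F1 where 1: "D1 = K1 + \<Sum>\<^sub># F1" "size K1 \<le> card \<delta>1 + card \<delta>1 * card \<delta>1"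
    "\<forall>C\<in>#F1. C \<noteq> {#} \<and> size C \<le> card \<delta>1" "\<forall>F'. F' \<subseteq># F1 \<longrightarrow> ?R1 (K1 + \<Sum>\<^sub># F')"
    using run_decomposition[OF _ G(2) run(1)] G(1) by auto
  obtain K2 F2 where 2: "D2 = K2 + \<Sum>\<^sub># F2" "size K2 \<le> card \<delta>2 + card \<delta>2 * card \<delta>2"
    "\<forall>C\<in>#F2. C \<noteq> {#} \<and> size C \<le> card \<delta>2" "\<forall>F'. F' \<subseteq># F2 \<longrightarrow> ?R2 (K2 + \<Sum>\<^sub># F')"
    using run_decomposition[OF _ H(2) run(2)] H(1) by auto
  let ?B = "n + n * n"
  have szK1: "size K1 \<le> ?B" using 1(2) G(3) by (meson add_mono mult_le_mono order_trans)
  have szK2: "size K2 \<le> ?B" using 2(2) H(3) by (meson add_mono mult_le_mono order_trans)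
  have sub1: "set_mset D1 \<subseteq> \<delta>1" and sub2: "set_mset D2 \<subseteq> \<delta>2" using run by (auto simp: is_run_def)
  have out1: "count (mout E) a \<le> size E" if "set_mset E \<subseteq> set_mset D1" for E a
    using order_trans[OF count_le_size size_mout_le[of E]] that sub1 G(1) by auto
  have out2: "count (mout E) a \<le> size E" if "set_mset E \<subseteq> set_mset D2" for E a
    using order_trans[OF count_le_size size_mout_le[of E]] that sub2 H(1) by auto
  have in1: "set_mset C \<subseteq> set_mset D1" if "C \<in># F1" for C using that 1(1)
    by (auto simp: in_Union_mset_iff)
  have in2: "set_mset C \<subseteq> set_mset D2" if "C \<in># F2" for C using that 2(1)
    by (auto simp: in_Union_mset_iff)
  define h1 where "h1 C = (\<lambda>a. int (count (mout C) a))" for C :: "('s, nat) trans multiset"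
  define h2 where "h2 C = (\<lambda>a. - int (count (mout C) a))" for C :: "('s, nat) trans multiset"
  define X where "X = image_mset h1 F1 + image_mset h2 F2"
  have sum1: "(\<Sum>x\<in>#image_mset h1 F. x a) = int (count (mout (\<Sum>\<^sub># F)) a)" for F a
    by (induction F) (auto simp: h1_def)
  have sum2: "(\<Sum>x\<in>#image_mset h2 F. x a) = - int (count (mout (\<Sum>\<^sub># F)) a)" for F a
    by (induction F) (auto simp: h2_def)
  have szX: "size X < zs_bound k ?B"
  proof (rule ccontr)
    assume "\<not> ?thesis"
    then have big: "zs_bound k ?B \<le> size X" by simp
    have el: "\<forall>x\<in>#X. \<forall>a<k. \<bar>x a\<bar> \<le> int ?B"
    proof (intro ballI allI impI)
      fix x a assume "x \<in># X"
      then consider C where "C \<in># F1" "x = h1 C" | C where "C \<in># F2" "x = h2 C" by (auto simp: X_def)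
      then have "\<bar>x a\<bar> \<le> int n"
      proof cases
        case 1
        then have "count (mout C) a \<le> n" using \<open>\<forall>C\<in>#F1. _\<close> out1[OF in1, of C a] G(3) by fastforce
        then show ?thesis by (simp add: 1 h1_def)
      next
        case 2
        then have "count (mout C) a \<le> n" using \<open>\<forall>C\<in>#F2. _\<close> out2[OF in2, of C a] H(3) by fastforce
        then show ?thesis by (simp add: 2 h2_def)
      qed
      also have "int n \<le> int ?B" by (simp only: of_nat_le_iff)
      finally show "\<bar>x a\<bar> \<le> int ?B" .
    qed
    have tot: "\<forall>a<k. \<bar>\<Sum>x\<in>#X. x a\<bar> \<le> int ?B"
    proof (intro allI impI)
      fix a
      \<comment> \<open>The whole outputs agree, so the signed sum of the free cycles is the
        difference of the outputs of the kept parts. This is the reason why the total is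
        small.\<close>
      have "(\<Sum>x\<in>#X. x a) = int (count (mout (\<Sum>\<^sub># F1)) a) - int (count (mout (\<Sum>\<^sub># F2)) a)"
        unfolding X_def by (simp only: image_mset_union sum_mset.union sum1 sum2)
      also have "\<dots> = int (count (mout K2) a) - int (count (mout K1) a)"
        using arg_cong[OF run(3), of "\<lambda>M. count M a"] by (simp add: 1(1) 2(1))
      finally have e: "(\<Sum>x\<in>#X. x a) = int (count (mout K2) a) - int (count (mout K1) a)" .
      have "count (mout K1) a \<le> ?B" "count (mout K2) a \<le> ?B"
        using out1[of K1 a] out2[of K2 a] szK1 szK2 1(1) 2(1) by fastforce+
      then show "\<bar>\<Sum>x\<in>#X. x a\<bar> \<le> int ?B" using e by linarith
    qed
    obtain Y where Y: "Y \<subseteq># X" "Y \<noteq> {#}" "\<forall>a<k. (\<Sum>x\<in>#Y. x a) = 0"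
      using zero_sum_submultiset[OF el tot big] by auto
    \<comment> \<open>A vector can come from both grammars (the zero vector, for instance), so
      \<open>Y\<close> does not determine the origin of its elements. As many as possible are
      ascribed to the first grammar and the excess to the second.\<close>
    define Y2 where "Y2 = Y - image_mset h1 F1"
    define Y1 where "Y1 = Y - Y2"
    have Yeq: "Y = Y1 + Y2" by (simp add: Y1_def Y2_def)
    have "Y2 \<subseteq># image_mset h2 F2" using Y(1) by (simp add: Y2_def X_def subset_eq_diff_conv add.commute)
    moreover have "a - (a - b) \<le> b" for a b :: nat by arith
    then have "Y1 \<subseteq># image_mset h1 F1" unfolding Y1_def Y2_def
      by (intro mset_subset_eqI) (simp only: count_diff)
    ultimately obtain E1 E2 where E: "E1 \<subseteq># F1" "Y1 = image_mset h1 E1" "E2 \<subseteq># F2"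
      "Y2 = image_mset h2 E2"
      using image_mset_subseteq_lift by metis
    obtain F1' where F1: "F1 = F1' + E1" using E(1) by (metis subset_mset.diff_add)
    obtain F2' where F2: "F2 = F2' + E2" using E(3) by (metis subset_mset.diff_add)
    have "count (mout (\<Sum>\<^sub># E1)) a = count (mout (\<Sum>\<^sub># E2)) a" for a
    proof (cases "a < k")
      case True
      then have "(\<Sum>x\<in>#Y. x a) = 0" using Y(3) by auto
      then have "int (count (mout (\<Sum>\<^sub># E1)) a) + - int (count (mout (\<Sum>\<^sub># E2)) a) = 0"
        unfolding Yeq E by (simp only: image_mset_union sum_mset.union sum1 sum2)
      then show ?thesis by simp
    next
      case False
      have "set_mset (mout (\<Sum>\<^sub># E1)) \<subseteq> {0..<k}" "set_mset (mout (\<Sum>\<^sub># E2)) \<subseteq> {0..<k}"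
        using sub1 sub2 G(1) H(1) unfolding 1(1) 2(1) F1 F2 mout_def by fastforce+
      then have "a \<notin># mout (\<Sum>\<^sub># E1)" "a \<notin># mout (\<Sum>\<^sub># E2)" using False by auto
      then show ?thesis by (simp add: not_in_iff)
    qed
    then have mE: "mout (\<Sum>\<^sub># E1) = mout (\<Sum>\<^sub># E2)" by (intro multiset_eqI) auto
    have "?P (K1 + \<Sum>\<^sub># F1', K2 + \<Sum>\<^sub># F2')"
      using 1(4) 2(4) run(3) mE by (auto simp: F1 F2 1(1) 2(1))
    \<comment> \<open>Minimality forces the removed cycles to have total size zero, whereas
      \<open>Y\<close> is nonempty and no cycle is empty.\<close>
    then have "?m D \<le> ?m (K1 + \<Sum>\<^sub># F1', K2 + \<Sum>\<^sub># F2')" using min by blast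
    then have "\<Sum>\<^sub># E1 = {#}" "\<Sum>\<^sub># E2 = {#}" by (auto simp: DD 1(1) 2(1) F1 F2)
    moreover have "E1 \<noteq> {#} \<or> E2 \<noteq> {#}" using Y(2) Yeq E by auto
    then obtain C where "C \<in># E1 \<or> C \<in># E2" by auto
    then have "C \<noteq> {#} \<and> (C \<in># E1 \<or> C \<in># E2)" using 1(3) 2(3) F1 F2 by auto
    ultimately show False by auto
  qed
  have "size D1 \<le> ?B + size F1 * n" "size D2 \<le> ?B + size F2 * n"
    using szK1 szK2 size_Union_mset_le[of F1 n] size_Union_mset_le[of F2 n] 1(3) 2(3) G(3) H(3)
    by (fastforce simp: 1(1) 2(1) intro!: add_mono)+
  moreover have "size F1 * n \<le> zs_bound k ?B * n" "size F2 * n \<le> zs_bound k ?B * n"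
    using szX by (auto simp: X_def intro!: mult_right_mono)
  ultimately have "size D1 \<le> run_bound k n" "size D2 \<le> run_bound k n"
    unfolding run_bound_def by linarith+
  then show ?thesis using run by blast
qed

lemma run_bound_le:
  assumes "2 \<le> n" shows "run_bound k n \<le> n ^ (4 + 3 * zs_exp k)"
proof -
  have n1: "n + n * n \<le> n ^ 3"
  proof -
    have "n + n * n \<le> 2 * (n * n)" using assms by simp
    also have "\<dots> \<le> n * (n * n)" using assms by (rule mult_right_mono) simp
    finally show ?thesis by (simp add: power3_eq_cube)
  qed
  have "zs_bound k (n + n * n) \<le> zs_bound k (n ^ 3)" using n1 by (rule zs_bound_mono)
  also have "\<dots> \<le> (n ^ 3) ^ zs_exp k" using assms
    by (intro zs_bound_le) (meson le_trans self_le_power zero_less_numeral less_le_trans one_le_numeral)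
  finally have "zs_bound k (n + n * n) * n \<le> n ^ (3 * zs_exp k) * n"
    by (intro mult_right_mono) (auto simp: power_mult)
  also have "\<dots> = n ^ (1 + 3 * zs_exp k)" by simp
  also have "\<dots> \<le> n ^ (3 + 3 * zs_exp k)" using assms by (intro power_increasing) auto
  finally have a: "zs_bound k (n + n * n) * n \<le> n ^ (3 + 3 * zs_exp k)" .
  have "n ^ 3 \<le> n ^ (3 + 3 * zs_exp k)" using assms by (intro power_increasing) auto
  then have "run_bound k n \<le> 2 * n ^ (3 + 3 * zs_exp k)" using a n1 unfolding run_bound_def by linarith
  also have "\<dots> \<le> n * n ^ (3 + 3 * zs_exp k)" using assms by (rule mult_right_mono) simp
  also have "\<dots> = n ^ (4 + 3 * zs_exp k)" by (simp add: power_add power4_eq_xxxx eval_nat_numeral)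
  finally show ?thesis .
qed

section \<open>Register programs and their compilation to a Turing machine\<close>

text \<open>A tape cell carries a set of flags below \<open>nflags\<close>, written as a number by \<open>set_encode\<close>; the
  blank is the empty set and the input symbols 1, 2, 3 are \<open>{0}\<close>, \<open>{1}\<close>, \<open>{0, 1}\<close>. Flags 2 to 31 are
  registers: the value of register \<open>r\<close> is the position of the only cell with flag \<open>r\<close>. All other
  flags are bit arrays. Register \<open>CAP\<close> bounds all others (\<open>Inc\<close> has no effect at this bound), and
  \<open>HOME\<close> is always 0. \<open>Loop\<close> occurs only in continuations, for a \<open>For\<close> loop that is already running.\<close>

datatype com = Skip | Inc nat | IncCap | Zero nat | Put bool nat nat
  | CIf nat nat com com | Seq com com | For nat nat com | Loop nat nat com

record st =
  reg :: "nat \<Rightarrow> nat"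
  arr :: "nat \<Rightarrow> nat \<Rightarrow> bool"

abbreviation (input) CAP :: nat where "CAP \<equiv> 2"
abbreviation (input) HOME :: nat where "HOME \<equiv> 3"
abbreviation (input) ANS :: nat where "ANS \<equiv> 36"

definition nflags :: nat where "nflags = 40"

definition is_reg :: "nat \<Rightarrow> bool" where "is_reg f \<longleftrightarrow> 2 \<le> f \<and> f < 32"

text \<open>A register is a flag carried by exactly one cell. So \<open>CIf r f\<close> with a
  register \<open>f\<close> tests whether two registers are equal, and with \<open>f = HOME\<close>
  whether \<open>r\<close> is zero.\<close>

definition flag :: "st \<Rightarrow> nat \<Rightarrow> nat \<Rightarrow> bool" where
  "flag s f p = (if is_reg f then reg s f = p else arr s f p)"

definition set_reg :: "nat \<Rightarrow> nat \<Rightarrow> st \<Rightarrow> st" where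
  "set_reg r v s = s\<lparr>reg := (reg s)(r := v)\<rparr>"

primrec exec :: "com \<Rightarrow> st \<Rightarrow> st" where
  "exec Skip = (\<lambda>s. s)"
| "exec (Inc r) = (\<lambda>s. if reg s r = reg s CAP then s else set_reg r (Suc (reg s r)) s)"
| "exec IncCap = (\<lambda>s. set_reg CAP (Suc (reg s CAP)) s)"
| "exec (Zero r) = (\<lambda>s. set_reg r 0 s)"
| "exec (Put b f r) = (\<lambda>s. s\<lparr>arr := (arr s)(f := (arr s f)(reg s r := b))\<rparr>)"
| "exec (CIf r f a b) = (\<lambda>s. if flag s f (reg s r) then exec a s else exec b s)"
| "exec (Seq a b) = (\<lambda>s. exec b (exec a s))"
| "exec (For i r c) =
     (\<lambda>s. ((\<lambda>s. set_reg i (Suc (reg s i)) (exec c s)) ^^ reg s r) (set_reg i 0 s))"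
| "exec (Loop i r c) = (\<lambda>s. s)"

primrec mods :: "com \<Rightarrow> nat set" where
  "mods Skip = {}"
| "mods (Inc r) = {r}"
| "mods IncCap = {CAP}"
| "mods (Zero r) = {r}"
| "mods (Put b f r) = {}"
| "mods (CIf r f a b) = mods a \<union> mods b"
| "mods (Seq a b) = mods a \<union> mods b"
| "mods (For i r c) = insert i (mods c)"
| "mods (Loop i r c) = {}"

primrec puts :: "com \<Rightarrow> nat set" where
  "puts Skip = {}"
| "puts (Inc r) = {}"
| "puts IncCap = {}"
| "puts (Zero r) = {}"
| "puts (Put b f r) = {f}"
| "puts (CIf r f a b) = puts a \<union> puts b"
| "puts (Seq a b) = puts a \<union> puts b"
| "puts (For i r c) = puts c"
| "puts (Loop i r c) = {}"

text \<open>Counter and bound of a loop are left alone by its body, so the end of a loop can be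
  recognised by comparing their marks. The lower bound 4 protects \<open>CAP\<close> and
  \<open>HOME\<close>: the former is changed by \<open>IncCap\<close> only, the latter
  never.\<close>

primrec wf_com :: "com \<Rightarrow> bool" where
  "wf_com Skip = True"
| "wf_com (Inc r) = (4 \<le> r \<and> r < 32)"
| "wf_com IncCap = True"
| "wf_com (Zero r) = (4 \<le> r \<and> r < 32)"
| "wf_com (Put b f r) = (32 \<le> f \<and> f < 40 \<and> 2 \<le> r \<and> r < 32)"
| "wf_com (CIf r f a b) = (2 \<le> r \<and> r < 32 \<and> f < 40 \<and> wf_com a \<and> wf_com b)"
| "wf_com (Seq a b) = (wf_com a \<and> wf_com b)"
| "wf_com (For i r c) = (4 \<le> i \<and> i < 32 \<and> 2 \<le> r \<and> r < 32 \<and> i \<noteq> r \<and>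
     i \<notin> mods c \<and> r \<notin> mods c \<and> wf_com c)"
| "wf_com (Loop i r c) = False"

definition st_inv :: "st \<Rightarrow> bool" where
  "st_inv s \<longleftrightarrow> reg s HOME = 0 \<and> (\<forall>r. reg s r \<le> reg s CAP)"

lemma reg_set_reg [simp]: "reg (set_reg r v s) = (reg s)(r := v)"
  and arr_set_reg [simp]: "arr (set_reg r v s) = arr s"
  by (simp_all add: set_reg_def)

section \<open>Frame properties and the invariant rule for loops\<close>

lemma exec_reg: "r \<notin> mods c \<Longrightarrow> reg (exec c s) r = reg s r"
proof (induction c arbitrary: s)
  case (For i q c)
  have "reg (((\<lambda>s. set_reg i (Suc (reg s i)) (exec c s)) ^^ n) s') r = reg s' r" for n s'
    using For by (induction n) auto
  then show ?case using For.prems by simp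
qed auto

lemma exec_arr: "f \<notin> puts c \<Longrightarrow> arr (exec c s) f = arr s f"
proof (induction c arbitrary: s)
  case (For i q c)
  have "arr (((\<lambda>s. set_reg i (Suc (reg s i)) (exec c s)) ^^ n) s') f = arr s' f" for n s'
    using For by (induction n) auto
  then show ?case using For.prems by simp
qed auto

text \<open>Counter and register invariant are treated together: the counter stays below
  \<open>CAP\<close> only because it never exceeds the unchanged bound register.\<close>

lemma For_iterate:
  assumes "wf_com (For i r c)" "st_inv s" "j \<le> reg s r"
    and IH: "\<And>s. st_inv s \<Longrightarrow> st_inv (exec c s) \<and> reg s CAP \<le> reg (exec c s) CAP"
  defines "t \<equiv> ((\<lambda>s. set_reg i (Suc (reg s i)) (exec c s)) ^^ j) (set_reg i 0 s)"
  shows "st_inv t \<and> reg s CAP \<le> reg t CAP \<and> reg t i = j \<and> reg t r = reg s r"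
  using assms(3) unfolding t_def
proof (induction j)
  case 0
  then show ?case using assms(1,2) by (auto simp: st_inv_def)
next
  case (Suc j)
  define u where "u = ((\<lambda>s. set_reg i (Suc (reg s i)) (exec c s)) ^^ j) (set_reg i 0 s)"
  have u: "st_inv u" "reg s CAP \<le> reg u CAP" "reg u i = j" "reg u r = reg s r"
    using Suc by (auto simp: u_def)
  have v: "st_inv (exec c u)" "reg u CAP \<le> reg (exec c u) CAP" using IH[OF u(1)] by auto
  have "reg (exec c u) i = j" "reg (exec c u) r = reg s r"
    using exec_reg assms(1) u by auto
  moreover have "Suc j \<le> reg (exec c u) CAP"
    using Suc.prems calculation(2) v(1) unfolding st_inv_def by (metis le_trans)
  ultimately show ?case using assms(1) u v
    by (auto simp: st_inv_def simp flip: u_def)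
qed

lemma exec_inv: "wf_com c \<Longrightarrow> st_inv s \<Longrightarrow> st_inv (exec c s) \<and> reg s CAP \<le> reg (exec c s) CAP"
proof (induction c arbitrary: s)
  case (Inc r)
  then show ?case by (auto simp: st_inv_def Suc_le_eq le_neq_implies_less)
next
  case (Seq a b)
  then show ?case by (metis exec.simps(7) le_trans wf_com.simps(7))
next
  case (For i r c)
  then show ?case using For_iterate[OF For.prems order_refl] by auto
qed (auto simp: st_inv_def le_SucI)

text \<open>The step receives the frame facts for the body, so an invariant need not mention the
  registers and arrays that the body leaves alone.\<close>

lemma For_rule:
  assumes wf: "wf_com (For i r c)" and inv: "st_inv s"
    and init: "I 0 (set_reg i 0 s)"
    and step: "\<And>j t. j < reg s r \<Longrightarrow> st_inv t \<Longrightarrow> I j t \<Longrightarrow> reg t i = j \<Longrightarrow>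
      (\<And>q. q \<notin> mods c \<Longrightarrow> q \<noteq> i \<Longrightarrow> reg t q = reg s q) \<Longrightarrow>
      (\<And>f. f \<notin> puts c \<Longrightarrow> arr t f = arr s f) \<Longrightarrow> I (Suc j) (set_reg i (Suc j) (exec c t))"
  shows "I (reg s r) (exec (For i r c) s)"
proof -
  define g where "g j = ((\<lambda>s. set_reg i (Suc (reg s i)) (exec c s)) ^^ j) (set_reg i 0 s)" for j
  have IH: "st_inv s \<Longrightarrow> st_inv (exec c s) \<and> reg s CAP \<le> reg (exec c s) CAP" for s
    using wf by (intro exec_inv) auto
  have g: "st_inv (g j)" "reg (g j) i = j" if "j \<le> reg s r" for j
    using For_iterate[OF wf inv that IH] unfolding g_def by auto
  have gs: "g (Suc j) = set_reg i (Suc j) (exec c (g j))" if "j \<le> reg s r" for j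
    using g(2)[OF that] exec_reg wf by (simp add: g_def)
  have fr: "reg (g j) q = reg s q" if "q \<notin> mods c" "q \<noteq> i" for j q
    unfolding g_def using that by (induction j) (auto simp: exec_reg)
  have fa: "arr (g j) f = arr s f" if "f \<notin> puts c" for j f
    unfolding g_def using that by (induction j) (auto simp: exec_arr)
  have "j \<le> reg s r \<Longrightarrow> I j (g j)" for j
  proof (induction j)
    case 0
    then show ?case using init by (simp add: g_def)
  next
    case (Suc j)
    then show ?case using step[of j "g j"] g fr fa gs by auto
  qed
  then show ?thesis by (simp add: g_def)
qed

section \<open>Finite control of the Turing machine\<close>

datatype ctl = Start | Acc | Rej | Init | Run "com list" | Drop nat "com list"
  | Back "nat option" "com list"

instance com :: countable by countable_datatype
instance ctl :: countable by countable_datatype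

abbreviation seek :: "nat \<Rightarrow> ctl \<Rightarrow> nat set \<Rightarrow> ctl \<times> nat set \<times> dir \<Rightarrow> ctl \<times> nat set \<times> dir" where
  "seek r q S act \<equiv> (if r \<in> S then act else (q, S, Rgt))"

text \<open>The control state contains the stack of commands still to be executed; only finitely many stacks
  can occur (\<open>conts\<close>). Every primitive command scans right for the mark of a register, changes the
  tape locally and returns to the leftmost cell; \<open>Back (Some r)\<close> puts the mark of \<open>r\<close> there.\<close>

fun delta :: "com \<Rightarrow> ctl \<Rightarrow> nat set \<Rightarrow> ctl \<times> nat set \<times> dir" where
  "delta prog Start S = (Init, S \<union> {3..<32}, Rgt)"
| "delta prog Init S = (if S = {} then (Back None [prog], {CAP}, Stay) else (Init, S, Rgt))"
| "delta prog Acc S = (Acc, S, Stay)"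
| "delta prog Rej S = (Rej, S, Stay)"
| "delta prog (Drop r k) S = (Back None k, insert r S, Stay)"
| "delta prog (Back F k) S = (if HOME \<in> S then (Run k, S \<union> set_option F, Stay) else (Back F k, S, Lft))"
| "delta prog (Run []) S = (if ANS \<in> S then Acc else Rej, S, Stay)"
| "delta prog (Run (Skip # k)) S = (Run k, S, Stay)"
| "delta prog (Run (Seq a b # k)) S = (Run (a # b # k), S, Stay)"
| "delta prog (Run (For i r c # k)) S = (Run (Zero i # Loop i r c # k), S, Stay)"
| "delta prog (Run (Inc r # k)) S = seek r (Run (Inc r # k)) S
     (if CAP \<in> S then (Back None k, S, Stay) else (Drop r k, S - {r}, Rgt))"
| "delta prog (Run (IncCap # k)) S = seek CAP (Run (IncCap # k)) S (Drop CAP k, S - {CAP}, Rgt)"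
| "delta prog (Run (Zero r # k)) S = seek r (Run (Zero r # k)) S (Back (Some r) k, S - {r}, Stay)"
| "delta prog (Run (Put b f r # k)) S = seek r (Run (Put b f r # k)) S
     (Back None k, if b then insert f S else S - {f}, Stay)"
| "delta prog (Run (CIf r f a b # k)) S = seek r (Run (CIf r f a b # k)) S
     (Back None ((if f \<in> S then a else b) # k), S, Stay)"
| "delta prog (Run (Loop i r c # k)) S = seek r (Run (Loop i r c # k)) S
     (Back None (if i \<in> S then k else c # Inc i # Loop i r c # k), S, Stay)"

fun nxt :: "com list \<Rightarrow> com list set" where
  "nxt [] = {}"
| "nxt (Seq a b # k) = {a # b # k}"
| "nxt (CIf r f a b # k) = {a # k, b # k}"
| "nxt (For i r c # k) = {Zero i # Loop i r c # k}"
| "nxt (Loop i r c # k) = {k, c # Inc i # Loop i r c # k}"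
| "nxt (_ # k) = {k}"

text \<open>All stacks that occur from \<open>c # k\<close> until \<open>k\<close> is uncovered. A
  running \<open>Loop\<close> puts its body on top of itself again and again, but the part
  underneath is always the same, which keeps the set finite.\<close>

primrec conts :: "com \<Rightarrow> com list \<Rightarrow> com list set" where
  "conts Skip = (\<lambda>k. {Skip # k})"
| "conts (Inc r) = (\<lambda>k. {Inc r # k})"
| "conts IncCap = (\<lambda>k. {IncCap # k})"
| "conts (Zero r) = (\<lambda>k. {Zero r # k})"
| "conts (Put b f r) = (\<lambda>k. {Put b f r # k})"
| "conts (CIf r f a b) = (\<lambda>k. {CIf r f a b # k} \<union> conts a k \<union> conts b k)"
| "conts (Seq a b) = (\<lambda>k. {Seq a b # k} \<union> conts a (b # k) \<union> conts b k)"
| "conts (For i r c) = (\<lambda>k. {For i r c # k, Zero i # Loop i r c # k, Loop i r c # k,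
     Inc i # Loop i r c # k} \<union> conts c (Inc i # Loop i r c # k))"
| "conts (Loop i r c) = (\<lambda>k. {Loop i r c # k, Inc i # Loop i r c # k} \<union>
     conts c (Inc i # Loop i r c # k))"

lemma finite_conts: "finite (conts c k)"
  by (induction c arbitrary: k) auto

lemma conts_self: "c # k \<in> conts c k"
  by (cases c) auto

text \<open>Each successor of a stack of \<open>c\<close> is again one of these stacks, or execution
  of \<open>c\<close> is over and \<open>k\<close> remains. This yields a finite state set closed
  under the transition function.\<close>

lemma conts_closed: "q \<in> conts c k \<Longrightarrow> nxt q \<subseteq> insert k (conts c k)"
proof (induction c arbitrary: k q)
  case (CIf r f a b)
  then consider "q = CIf r f a b # k" | "q \<in> conts a k" | "q \<in> conts b k" by auto
  then show ?case
  proof cases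
    case 2 then show ?thesis using CIf.IH(1)[OF 2] by auto
  next
    case 3 then show ?thesis using CIf.IH(2)[OF 3] by auto
  qed (auto simp: conts_self)
next
  case (Seq a b)
  then consider "q = Seq a b # k" | "q \<in> conts a (b # k)" | "q \<in> conts b k" by auto
  then show ?case
  proof cases
    case 2 then show ?thesis using Seq.IH(1)[OF 2] conts_self[of b k] by auto
  next
    case 3 then show ?thesis using Seq.IH(2)[OF 3] by auto
  qed (auto simp: conts_self)
next
  case (For i r c)
  show ?case
  proof (cases "q \<in> conts c (Inc i # Loop i r c # k)")
    case True
    then show ?thesis using For.IH[OF True] by auto
  qed (use For.prems in \<open>auto simp: conts_self\<close>)
next
  case (Loop i r c)
  show ?case
  proof (cases "q \<in> conts c (Inc i # Loop i r c # k)")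
    case True
    then show ?thesis using Loop.IH[OF True] by auto
  qed (use Loop.prems in \<open>auto simp: conts_self\<close>)
qed auto

definition prog_conts :: "com \<Rightarrow> com list set" where
  "prog_conts prog = insert [] (conts prog [])"

fun aux_states :: "com list \<Rightarrow> ctl set" where
  "aux_states (Inc r # k) = {Drop r k}"
| "aux_states (IncCap # k) = {Drop CAP k}"
| "aux_states (Zero r # k) = {Back (Some r) k}"
| "aux_states _ = {}"

definition states :: "com \<Rightarrow> ctl set" where
  "states prog = {Start, Acc, Rej, Init} \<union> Run ` prog_conts prog \<union> Back None ` prog_conts prog \<union>
     (\<Union>k\<in>prog_conts prog. aux_states k)"

lemma finite_states: "finite (states prog)"
proof -
  have "finite (aux_states k)" for k by (cases k rule: aux_states.cases) auto
  then show ?thesis by (auto simp: states_def prog_conts_def finite_conts)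
qed

lemma prog_conts_closed: "k \<in> prog_conts prog \<Longrightarrow> nxt k \<subseteq> prog_conts prog"
  using conts_closed[of k prog "[]"] by (auto simp: prog_conts_def)

lemma prog_conts_start: "[prog] \<in> prog_conts prog"
  by (simp add: prog_conts_def conts_self)

lemma aux_states_next:
  "q \<in> aux_states k \<Longrightarrow> (\<exists>r k'. q = Drop r k' \<and> k' \<in> nxt k) \<or> (\<exists>r k'. q = Back (Some r) k' \<and> k' \<in> nxt k)"
  by (cases k rule: aux_states.cases) auto

lemma Run_states [simp]: "Run k \<in> states prog \<longleftrightarrow> k \<in> prog_conts prog"
  by (auto simp: states_def dest: aux_states_next)

lemma BackNone_states [simp]: "Back None k \<in> states prog \<longleftrightarrow> k \<in> prog_conts prog"
  by (auto simp: states_def dest: aux_states_next)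

lemma delta_closed:
  assumes "q \<in> states prog"
  shows "fst (delta prog q S) \<in> states prog"
proof (cases q)
  case (Run k)
  then have k: "k \<in> prog_conts prog" using assms by simp
  have n: "k' \<in> nxt k \<Longrightarrow> k' \<in> prog_conts prog" for k' using prog_conts_closed[OF k] by auto
  have a: "q' \<in> aux_states k \<Longrightarrow> q' \<in> states prog" for q' using k by (auto simp: states_def)
  show ?thesis
  proof (cases k)
    case Nil
    then show ?thesis using Run by (simp add: states_def)
  next
    case (Cons c k')
    then show ?thesis using Run k n a by (cases c) auto
  qed
next
  case (Drop r k)
  then have "\<exists>k0\<in>prog_conts prog. k \<in> nxt k0"
    using assms by (auto simp: states_def dest: aux_states_next)
  then show ?thesis using Drop prog_conts_closed by auto
next
  case (Back F k)
  then have "k \<in> prog_conts prog"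
    using assms prog_conts_closed by (auto simp: states_def dest!: aux_states_next)
  then show ?thesis using assms Back by auto
qed (use assms prog_conts_start in \<open>auto simp: states_def\<close>)

text \<open>The codes 0, 1, 2 are those reserved by the machine model. The others come from
  countability and leave gaps; \<open>nat_delta\<close> gives an arbitrary valid result on codes in
  the gaps.\<close>

definition code :: "ctl \<Rightarrow> nat" where
  "code q = (case q of Start \<Rightarrow> 0 | Acc \<Rightarrow> 1 | Rej \<Rightarrow> 2 | _ \<Rightarrow> 3 + to_nat q)"

lemma inj_code: "inj code"
proof (rule injI)
  fix q q' assume "code q = code q'"
  then show "q = q'" by (cases q; cases q') (auto simp: code_def)
qed

lemma code_simps [simp]: "code Start = 0" "code Acc = Suc 0" "code Rej = 2"
  "code q = 0 \<longleftrightarrow> q = Start" "code q = Suc 0 \<longleftrightarrow> q = Acc" "code q = 2 \<longleftrightarrow> q = Rej"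
  by (auto simp: code_def split: ctl.split)

definition nat_delta :: "com \<Rightarrow> nat \<Rightarrow> nat \<Rightarrow> nat \<times> nat \<times> dir" where
  "nat_delta prog q a = (if q \<in> code ` states prog then
     (case delta prog (inv code q) (set_decode a) of
        (q', S, m) \<Rightarrow> (code q', set_encode (S \<inter> {..<nflags}), m)) else (1, 0, Stay))"

definition machine :: "com \<Rightarrow> tm" where
  "machine prog = (Suc (Max (code ` states prog)), 2 ^ nflags, nat_delta prog)"

lemma set_encode_less:
  assumes "S \<subseteq> {..<n}" shows "set_encode S < 2 ^ n"
proof -
  have "set_encode S \<le> (\<Sum>i<n. 2 ^ i)" unfolding set_encode_def
    using assms by (intro sum_mono2) auto
  also have "\<dots> < 2 ^ n" by (induction n) auto
  finally show ?thesis .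
qed

lemma valid_machine: "valid_tm (machine prog)"
proof -
  have fin: "finite (code ` states prog)" using finite_states by auto
  have le: "code q < Suc (Max (code ` states prog))" if "q \<in> states prog" for q
    using that fin by (simp add: less_Suc_eq_le)
  have "code Rej < Suc (Max (code ` states prog))" "code Acc < Suc (Max (code ` states prog))"
    by (rule le, simp add: states_def)+
  moreover have "fst (nat_delta prog q a) < Suc (Max (code ` states prog))" for q a
    using le delta_closed[of "inv code q" prog "set_decode a"] calculation(2)
    by (auto simp: nat_delta_def inv_f_f[OF inj_code] split: prod.split)
  moreover have "fst (snd (nat_delta prog q a)) < 2 ^ nflags" for q a
    by (auto simp: nat_delta_def set_encode_less split: prod.split)
  ultimately show ?thesis by (auto simp: valid_tm_def machine_def nflags_def)
qed

section \<open>The machine on tapes viewed as functions of the position\<close>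

fun move :: "dir \<Rightarrow> nat \<Rightarrow> nat" where
  "move Stay p = p" | "move Rgt p = Suc p" | "move Lft p = p - 1"

text \<open>A head position and a total function replace the two lists of a configuration. Truncated
  subtraction in \<open>move\<close> agrees with the machine, which stays put at the left
  end.\<close>

fun astep :: "com \<Rightarrow> ctl \<times> nat \<times> (nat \<Rightarrow> nat set) \<Rightarrow> ctl \<times> nat \<times> (nat \<Rightarrow> nat set)" where
  "astep prog (q, p, F) = (if q = Acc \<or> q = Rej then (q, p, F) else
     (case delta prog q (F p) of (q', S, m) \<Rightarrow> (q', move m p, F(p := S \<inter> {..<nflags}))))"

definition tape :: "nat list \<Rightarrow> nat list \<Rightarrow> nat \<Rightarrow> nat set" where
  "tape ls rs i = set_decode (nth_default 0 (rev ls @ rs) i)"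

text \<open>With \<open>tl [] = []\<close> and the default 0 this also covers a head that stands
  beyond the stored part of the tape.\<close>

lemma tape_write:
  "finite S \<Longrightarrow> (\<lambda>i. set_decode (nth_default 0 (as @ set_encode S # tl rs) i)) =
    (\<lambda>i. set_decode (nth_default 0 (as @ rs) i))(length as := S)"
proof
  fix i assume "finite S"
  then show "set_decode (nth_default 0 (as @ set_encode S # tl rs) i) =
    ((\<lambda>i. set_decode (nth_default 0 (as @ rs) i))(length as := S)) i"
    by (cases rs) (auto simp: nth_default_def nth_append nth_Cons split: nat.split)
qed

lemma tape_read_decode: "set_decode (tape_read rs) = tape ls rs (length ls)"
  by (cases rs) (auto simp: tape_read_def tape_def nth_default_def nth_append)

lemma tm_step_simulates:
  assumes "q \<in> states prog" "astep prog (q, length ls, tape ls rs) = (q', p', F')"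
  shows "\<exists>ls' rs'. tm_step (machine prog) (code q, ls, rs) = (code q', ls', rs') \<and>
    length ls' = p' \<and> tape ls' rs' = F'"
proof (cases "q = Acc \<or> q = Rej")
  case True
  then show ?thesis using assms by (auto simp: tm_step_def machine_def)
next
  case False
  obtain q1 S m where d: "delta prog q (tape ls rs (length ls)) = (q1, S, m)" by (metis prod_cases3)
  define S' where "S' = S \<inter> {..<nflags}"
  have fin: "finite S'" by (simp add: S'_def)
  have nd: "nat_delta prog (code q) (tape_read rs) = (code q1, set_encode S', m)"
    using d assms(1) by (simp add: nat_delta_def inv_f_f[OF inj_code] tape_read_decode[of rs ls] S'_def)
  have as: "q' = q1" "p' = move m (length ls)" "F' = (tape ls rs)(length ls := S')"
    using assms(2) False d by (auto simp: S'_def)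
  have w: "tape ls (set_encode S' # tl rs) = F'"
    unfolding tape_def[abs_def] as using tape_write[OF fin, of "rev ls" rs]
      by (simp add: tape_def[abs_def])
  show ?thesis
  proof (cases m)
    case Lft
    then show ?thesis
    proof (cases ls)
      case (Cons l ls')
      then have "tape ls' (l # set_encode S' # tl rs) = F'" using w by (simp add: tape_def[abs_def])
      then show ?thesis using Lft Cons nd False as by (simp add: tm_step_def machine_def)
    qed (use nd False as w in \<open>simp add: tm_step_def machine_def\<close>)
  next
    case Rgt
    have "tape (set_encode S' # ls) (tl rs) = F'" using w by (simp add: tape_def[abs_def])
    then show ?thesis using Rgt nd False as by (simp add: tm_step_def machine_def)
  qed (use nd False as w in \<open>simp add: tm_step_def machine_def\<close>)
qed

lemma tm_run_simulates:
  "\<exists>ls rs. (tm_step (machine prog) ^^ n) (0, [], x) = (code (fst ((astep prog ^^ n)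
    (Start, 0, tape [] x))), ls, rs) \<and>
    fst ((astep prog ^^ n) (Start, 0, tape [] x)) \<in> states prog \<and>
    snd ((astep prog ^^ n) (Start, 0, tape [] x)) = (length ls, tape ls rs)"
proof (induction n)
  case 0
  then show ?case by (auto simp: states_def)
next
  case (Suc n)
  obtain q p F where e: "(astep prog ^^ n) (Start, 0, tape [] x) = (q, p, F)" by (metis prod_cases3)
  then obtain ls rs where 1: "(tm_step (machine prog) ^^ n) (0, [], x) = (code q, ls, rs)"
    "q \<in> states prog" "p = length ls" "F = tape ls rs" using Suc by auto
  obtain q' p' F' where s: "astep prog (q, p, F) = (q', p', F')" by (metis prod_cases3)
  have "q' \<in> states prog" using s 1(2) delta_closed[OF 1(2), of "F p"]
    by (auto split: if_splits prod.splits)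
  moreover obtain ls' rs' where "tm_step (machine prog) (code q, ls, rs) = (code q', ls', rs')"
    "length ls' = p'" "tape ls' rs' = F'"
    using tm_step_simulates[OF 1(2)] s 1(3,4) by blast
  ultimately show ?case using e 1 s by auto
qed

definition reach :: "com \<Rightarrow> nat \<Rightarrow> ctl \<times> nat \<times> (nat \<Rightarrow> nat set) \<Rightarrow> ctl \<times> nat \<times> (nat \<Rightarrow> nat set) \<Rightarrow> bool" where
  "reach prog T c c' \<longleftrightarrow> (\<exists>n\<le>T. (astep prog ^^ n) c = c')"

lemma reach_trans:
  assumes "reach prog T c c'" "reach prog T' c' c''"
  shows "reach prog (T + T') c c''"
proof -
  obtain n n' where "n \<le> T" "(astep prog ^^ n) c = c'" "n' \<le> T'" "(astep prog ^^ n') c' = c''"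
    using assms by (auto simp: reach_def)
  then show ?thesis unfolding reach_def
    by (intro exI[of _ "n' + n"]) (auto simp: funpow_add)
qed

lemma reach_mono: "reach prog T c c' \<Longrightarrow> T \<le> T' \<Longrightarrow> reach prog T' c c'"
  by (auto simp: reach_def intro: order_trans)

lemma reach_step: "astep prog c = c' \<Longrightarrow> reach prog 1 c c'"
  by (auto simp: reach_def intro!: exI[of _ 1])

lemma reach_scan:
  assumes "\<And>p. a \<le> p \<Longrightarrow> p < a + n \<Longrightarrow> delta prog q (F p) = (q, F p, Rgt)" "q \<noteq> Acc" "q \<noteq> Rej"
    "\<And>p. F p \<subseteq> {..<nflags}"
  shows "reach prog n (q, a, F) (q, a + n, F)"
  using assms(1)
proof (induction n)
  case 0
  then show ?case by (auto simp: reach_def)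
next
  case (Suc n)
  have "F (a + n) \<inter> {..<nflags} = F (a + n)" using assms(4) by auto
  then have "astep prog (q, a + n, F) = (q, a + Suc n, F)"
    using Suc.prems[of "a + n"] assms(2,3) by simp
  then show ?case using reach_trans[OF Suc.IH reach_step] Suc.prems by simp
qed

text \<open>Since \<open>HOME\<close> marks exactly the leftmost cell, the way back takes
  \<open>p\<close> moves and one more step to enter \<open>Run\<close>.\<close>

lemma reach_back:
  assumes "\<And>p. HOME \<in> F p \<longleftrightarrow> p = 0" "\<And>p. F p \<subseteq> {..<nflags}" "set_option R \<subseteq> {..<nflags}"
  shows "reach prog (Suc p) (Back R k, p, F) (Run k, 0, F(0 := F 0 \<union> set_option R))"
proof (induction p)
  case 0
  have e: "(F 0 \<union> set_option R) \<inter> {..<nflags} = F 0 \<union> set_option R" using assms by blast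
  have "delta prog (Back R k) (F 0) = (Run k, F 0 \<union> set_option R, Stay)" using assms(1) by simp
  then have "astep prog (Back R k, 0, F) = (Run k, 0, F(0 := F 0 \<union> set_option R))"
    unfolding astep.simps by (simp only: prod.case e move.simps) simp
  from reach_step[OF this] show ?case by (simp only: One_nat_def)
next
  case (Suc p)
  have "F (Suc p) \<inter> {..<nflags} = F (Suc p)" using assms(2) by auto
  then have "astep prog (Back R k, Suc p, F) = (Back R k, p, F)" using assms(1) by simp
  then show ?case using reach_trans[OF reach_step Suc] by simp
qed

section \<open>Simulation of commands on encoded states\<close>

definition cell :: "st \<Rightarrow> nat \<Rightarrow> nat set" where
  "cell s p = {f. f < nflags \<and> flag s f p}"

lemma cell_sub: "cell s p \<subseteq> {..<nflags}" by (auto simp: cell_def)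

lemma cell_Int: "cell s p \<inter> {..<nflags} = cell s p" by (auto simp: cell_def)

lemma is_reg_less: "is_reg r \<Longrightarrow> r < nflags" by (auto simp: is_reg_def nflags_def)

lemma cell_reg: "is_reg r \<Longrightarrow> r \<in> cell s p \<longleftrightarrow> reg s r = p"
  by (auto simp: cell_def flag_def is_reg_less)

lemma cell_HOME: "st_inv s \<Longrightarrow> HOME \<in> cell s p \<longleftrightarrow> p = 0"
  by (subst cell_reg) (auto simp: is_reg_def st_inv_def)

lemma cell_set_reg:
  assumes "is_reg r"
  shows "cell (set_reg r v s) p = (if p = v then insert r (cell s p) else cell s p - {r})"
  using assms is_reg_less[OF assms] by (auto simp: cell_def flag_def)

lemma reach_seek:
  assumes "is_reg r" "\<And>S. r \<notin> S \<Longrightarrow> delta prog q S = (q, S, Rgt)" "q \<noteq> Acc" "q \<noteq> Rej"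
  shows "reach prog (reg s r) (q, 0, cell s) (q, reg s r, cell s)"
proof -
  have "reach prog (reg s r) (q, 0, cell s) (q, 0 + reg s r, cell s)"
    using assms by (intro reach_scan) (simp_all add: cell_reg cell_sub)
  then show ?thesis by simp
qed

text \<open>Common pattern of \<open>Zero\<close> and \<open>Put\<close>: \<open>reg s r\<close>
  moves to the mark, one action, \<open>reg s r + 1\<close> steps back. The action \<open>g\<close>
  has to respect the mark of \<open>HOME\<close>, on which the return depends.\<close>

lemma reach_act:
  assumes r: "is_reg r" and q: "\<And>S. delta prog q S = (if r \<in> S then (Back Q k, g S, Stay) else
    (q, S, Rgt))"
    and q': "q \<noteq> Acc" "q \<noteq> Rej" and inv: "st_inv s"
    and g: "\<And>S. HOME \<in> g S \<longleftrightarrow> HOME \<in> S" "\<And>S. S \<subseteq> {..<nflags} \<Longrightarrow> g S \<subseteq> {..<nflags}"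
    and Q: "set_option Q \<subseteq> {..<nflags}"
  defines "F \<equiv> (cell s)(reg s r := g (cell s (reg s r)))"
  shows "reach prog (2 * reg s r + 2) (q, 0, cell s) (Run k, 0, F(0 := F 0 \<union> set_option Q))"
proof -
  have 1: "reach prog (reg s r) (q, 0, cell s) (q, reg s r, cell s)"
    using q q' r by (intro reach_seek) auto
  have "g (cell s (reg s r)) \<inter> {..<nflags} = g (cell s (reg s r))" using g(2) cell_sub by blast
  then have 2: "reach prog 1 (q, reg s r, cell s) (Back Q k, reg s r, F)"
    using q q' r by (intro reach_step) (simp add: cell_reg F_def)
  have 3: "reach prog (Suc (reg s r)) (Back Q k, reg s r, F) (Run k, 0, F(0 := F 0 \<union> set_option Q))"
    using Q by (intro reach_back) (simp_all add: F_def g(1) g(2)[OF cell_sub] cell_sub cell_HOME[OF inv])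
  show ?thesis using reach_trans[OF reach_trans[OF 1 2] 3] by (rule reach_mono) simp
qed

text \<open>Shared by \<open>Inc\<close> and \<open>IncCap\<close>; \<open>b\<close> tells whether
  the mark of \<open>CAP\<close> blocks the move. The mark of \<open>r\<close> is lifted from its
  cell and dropped one cell further right.\<close>

lemma reach_Inc:
  assumes r: "is_reg r" "r \<noteq> HOME" and inv: "st_inv s" and V: "Suc (reg s r) \<le> V"
    and q: "\<And>S. delta prog q S = (if r \<in> S then if b \<and> CAP \<in> S then (Back None k, S, Stay)
      else (Drop r k, S - {r}, Rgt) else (q, S, Rgt))"
    and b: "b \<Longrightarrow> reg s r \<noteq> reg s CAP" and q': "q \<noteq> Acc" "q \<noteq> Rej"
  shows "reach prog (2 * V + 5) (q, 0, cell s) (Run k, 0, cell (set_reg r (Suc (reg s r)) s))"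
proof -
  let ?p = "reg s r" and ?F = "cell (set_reg r (Suc (reg s r)) s)"
  let ?F1 = "(cell s)(?p := cell s ?p - {r})"
  have 1: "reach prog ?p (q, 0, cell s) (q, ?p, cell s)"
    using q q' r by (intro reach_seek) auto
  have cap: "b \<Longrightarrow> CAP \<notin> cell s ?p" using b by (subst cell_reg) (auto simp: is_reg_def)
  have e1: "(cell s ?p - {r}) \<inter> {..<nflags} = cell s ?p - {r}" using cell_sub by blast
  have rc: "r \<in> cell s ?p" using r by (simp add: cell_reg)
  have "delta prog q (cell s ?p) = (Drop r k, cell s ?p - {r}, Rgt)"
    unfolding q using rc cap by auto
  then have 2: "reach prog 1 (q, ?p, cell s) (Drop r k, Suc ?p, ?F1)"
    using q' by (intro reach_step) (simp add: e1)
  have e2: "insert r (cell s (Suc ?p)) \<inter> {..<nflags} = insert r (cell s (Suc ?p))"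
    using cell_sub is_reg_less[OF r(1)] by blast
  have F: "?F1(Suc ?p := insert r (cell s (Suc ?p))) = ?F"
    using r by (auto simp: cell_set_reg cell_reg fun_eq_iff)
  have 3: "reach prog 1 (Drop r k, Suc ?p, ?F1) (Back None k, Suc ?p, ?F)"
    by (intro reach_step) (simp add: e2 flip: F)
  have "reach prog (Suc (Suc ?p)) (Back None k, Suc ?p, ?F) (Run k, 0, ?F(0 := ?F 0 \<union> set_option None))"
    using r cell_HOME[OF inv] cell_sub
    by (intro reach_back) (auto simp: cell_set_reg is_reg_less dest: subsetD)
  then have 4: "reach prog (Suc (Suc ?p)) (Back None k, Suc ?p, ?F) (Run k, 0, ?F)" by simp
  show ?thesis using reach_trans[OF reach_trans[OF reach_trans[OF 1 2] 3] 4] V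
    by (rule_tac reach_mono) auto
qed

lemma sim_Inc:
  assumes "wf_com (Inc r)" "st_inv s" "reg s CAP \<le> V"
  shows "reach prog (2 * V + 5) (Run (Inc r # k), 0, cell s) (Run k, 0, cell (exec (Inc r) s))"
proof (cases "reg s r = reg s CAP")
  case True
  have r: "is_reg r" "is_reg CAP" using assms(1) by (auto simp: is_reg_def)
  have 1: "reach prog (reg s r) (Run (Inc r # k), 0, cell s) (Run (Inc r # k), reg s r, cell s)"
    using r by (intro reach_seek) auto
  have 2: "reach prog 1 (Run (Inc r # k), reg s r, cell s) (Back None k, reg s r, cell s)"
    using r True by (intro reach_step) (simp add: cell_reg cell_Int)
  have "reach prog (Suc (reg s r)) (Back None k, reg s r, cell s) (Run k, 0,
    (cell s)(0 := cell s 0 \<union> set_option None))"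
    using cell_HOME[OF assms(2)] cell_sub by (intro reach_back) auto
  then have 3: "reach prog (Suc (reg s r)) (Back None k, reg s r, cell s) (Run k, 0, cell s)" by simp
  show ?thesis using reach_trans[OF reach_trans[OF 1 2] 3] True assms(3) by (rule_tac reach_mono) auto
next
  case False
  have "Suc (reg s r) \<le> V" using False assms(2,3) unfolding st_inv_def
    by (metis Suc_leI le_neq_implies_less le_trans)
  then have "reach prog (2 * V + 5) (Run (Inc r # k), 0, cell s) (Run k, 0, cell (set_reg r (Suc
    (reg s r)) s))"
    using assms False by (intro reach_Inc[where b = True]) (auto simp: is_reg_def)
  then show ?thesis using False by simp
qed

lemma sim_Zero:
  assumes "wf_com (Zero r)" "st_inv s" "reg s CAP \<le> V"
  shows "reach prog (2 * V + 5) (Run (Zero r # k), 0, cell s) (Run k, 0, cell (exec (Zero r) s))"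
proof -
  have r: "is_reg r" using assms(1) by (auto simp: is_reg_def)
  let ?F = "(cell s)(reg s r := cell s (reg s r) - {r})"
  have "reach prog (2 * reg s r + 2) (Run (Zero r # k), 0, cell s)
    (Run k, 0, ?F(0 := ?F 0 \<union> set_option (Some r)))"
    using assms r is_reg_less[OF r]
    by (intro reach_act[where g = "\<lambda>S. S - {r}"]) auto
  moreover have "?F(0 := ?F 0 \<union> set_option (Some r)) = cell (set_reg r 0 s)"
    using r by (auto simp: cell_set_reg cell_reg fun_eq_iff)
  moreover have "reg s r \<le> V" using assms(2,3) unfolding st_inv_def by (metis le_trans)
  ultimately show ?thesis by (simp add: reach_mono)
qed

lemma sim_Put:
  assumes "wf_com (Put b f r)" "st_inv s" "reg s CAP \<le> V"
  shows "reach prog (2 * V + 5) (Run (Put b f r # k), 0, cell s) (Run k, 0, cell (exec (Put b f r) s))"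
proof -
  have r: "is_reg r" and f: "\<not> is_reg f" "f < nflags" "f \<noteq> HOME"
    using assms(1) by (auto simp: is_reg_def nflags_def)
  let ?g = "\<lambda>S. if b then insert f S else S - {f}"
  let ?F = "(cell s)(reg s r := ?g (cell s (reg s r)))"
  have "reach prog (2 * reg s r + 2) (Run (Put b f r # k), 0, cell s)
    (Run k, 0, ?F(0 := ?F 0 \<union> set_option None))"
    using assms r f by (intro reach_act[where g = ?g]) auto
  moreover have "?F(0 := ?F 0 \<union> set_option None) = cell (exec (Put b f r) s)"
    using f by (auto simp: cell_def flag_def fun_eq_iff)
  moreover have "reg s r \<le> V" using assms(2,3) unfolding st_inv_def by (metis le_trans)
  ultimately show ?thesis by (simp add: reach_mono)
qed

text \<open>Serves conditionals as well as the end test of loops: both branch on a flag in the cell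
  of a register.\<close>

lemma sim_test:
  assumes r: "is_reg r" and inv: "st_inv s" and V: "reg s CAP \<le> V" and f: "f < nflags"
    and q: "\<And>S. delta prog q S = (if r \<in> S then (Back None
      (if f \<in> S then k1 else k2), S, Stay) else (q, S, Rgt))"
    and q': "q \<noteq> Acc" "q \<noteq> Rej"
  shows "reach prog (2 * V + 5) (q, 0, cell s) (Run (if flag s f (reg s r) then k1 else k2), 0, cell s)"
proof -
  let ?p = "reg s r" and ?k = "if flag s f (reg s r) then k1 else k2"
  have 1: "reach prog ?p (q, 0, cell s) (q, ?p, cell s)" using r q q' by (intro reach_seek) auto
  have 2: "reach prog 1 (q, ?p, cell s) (Back None ?k, ?p, cell s)"
    using r q' q f by (intro reach_step) (simp add: cell_reg cell_Int, simp add: cell_def)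
  have "reach prog (Suc ?p) (Back None ?k, ?p, cell s) (Run ?k, 0,
    (cell s)(0 := cell s 0 \<union> set_option None))"
    using cell_HOME[OF inv] cell_sub by (intro reach_back) auto
  then have 3: "reach prog (Suc ?p) (Back None ?k, ?p, cell s) (Run ?k, 0, cell s)" by simp
  have "?p \<le> V" using inv V unfolding st_inv_def by (metis le_trans)
  then show ?thesis using reach_trans[OF reach_trans[OF 1 2] 3] by (rule_tac reach_mono) auto
qed

text \<open>\<open>V\<close> bounds all registers, hence the length of each sweep and the number of
  rounds of each loop. A round costs the body, a test and an increment; the remaining
  \<open>2 * (2 * V + 5) + 1\<close> are the zeroing of the counter, the last test and the unfolding
  of \<open>For\<close>.\<close>

primrec time_bound :: "com \<Rightarrow> nat \<Rightarrow> nat" where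
  "time_bound Skip V = 1"
| "time_bound (Inc r) V = 2 * V + 5"
| "time_bound IncCap V = 2 * V + 5"
| "time_bound (Zero r) V = 2 * V + 5"
| "time_bound (Put b f r) V = 2 * V + 5"
| "time_bound (CIf r f a b) V = (2 * V + 5) + (time_bound a V + time_bound b V)"
| "time_bound (Seq a b) V = 1 + (time_bound a V + time_bound b V)"
| "time_bound (For i r c) V = V * (time_bound c V + 2 * (2 * V + 5)) + 2 * (2 * V + 5) + 1"
| "time_bound (Loop i r c) V = 0"

text \<open>A bound on the final value of \<open>CAP\<close> is enough, because \<open>CAP\<close>
  never decreases during execution.\<close>

lemma sim_com:
  assumes "wf_com c" "st_inv s" "reg (exec c s) CAP \<le> V"
  shows "reach prog (time_bound c V) (Run (c # k), 0, cell s) (Run k, 0, cell (exec c s))"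
  using assms
proof (induction c arbitrary: s k)
  case Skip
  have "reach prog 1 (Run (Skip # k), 0, cell s) (Run k, 0, (cell s)(0 := cell s 0))"
    by (intro reach_step) (simp add: cell_Int)
  then show ?case by simp
next
  case (Inc r)
  then have "reg s CAP \<le> V" using exec_inv le_trans by blast
  then show ?case using sim_Inc Inc.prems by (simp del: exec.simps)
next
  case IncCap
  have "reach prog (2 * V + 5) (Run (IncCap # k), 0, cell s) (Run k, 0, cell (set_reg CAP (Suc
    (reg s CAP)) s))"
    using IncCap by (intro reach_Inc[where b = False]) (auto simp: is_reg_def)
  then show ?case by simp
next
  case (Zero r)
  then have "reg s CAP \<le> V" using exec_inv le_trans by blast
  then show ?case using sim_Zero Zero.prems by (simp del: exec.simps)
next
  case (Put b f r)
  then have "reg s CAP \<le> V" using exec_inv le_trans by blast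
  then show ?case using sim_Put Put.prems by (simp del: exec.simps)
next
  case (CIf r f a b)
  then have V: "reg s CAP \<le> V" using exec_inv le_trans by blast
  let ?c = "if flag s f (reg s r) then a else b"
  have "reach prog (2 * V + 5) (Run (CIf r f a b # k), 0, cell s)
    (Run (if flag s f (reg s r) then a # k else b # k), 0, cell s)"
    using CIf.prems V by (intro sim_test) (auto simp: is_reg_def nflags_def)
  moreover have "reach prog (time_bound a V + time_bound b V)
     (Run (if flag s f (reg s r) then a # k else b # k), 0, cell s) (Run k, 0, cell (exec (CIf r f a b) s))"
  proof (cases "flag s f (reg s r)")
    case True
    then show ?thesis using reach_mono[OF CIf.IH(1)[of s k]] CIf.prems by simp
  next
    case False
    then show ?thesis using reach_mono[OF CIf.IH(2)[of s k]] CIf.prems by simp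
  qed
  ultimately show ?case unfolding time_bound.simps by (rule reach_trans)
next
  case (Seq a b)
  have a: "st_inv (exec a s)" using exec_inv Seq.prems by auto
  then have "reg (exec a s) CAP \<le> reg (exec b (exec a s)) CAP" using exec_inv Seq.prems by auto
  then have V: "reg (exec a s) CAP \<le> V" using Seq.prems(3) by simp
  have "reach prog 1 (Run (Seq a b # k), 0, cell s) (Run (a # b # k), 0, (cell s)(0 := cell s 0))"
    by (intro reach_step) (simp add: cell_Int)
  then have 1: "reach prog 1 (Run (Seq a b # k), 0, cell s) (Run (a # b # k), 0, cell s)" by simp
  have 2: "reach prog (time_bound a V) (Run (a # b # k), 0, cell s) (Run (b # k), 0, cell (exec a s))"
    using Seq V by auto
  have 3: "reach prog (time_bound b V) (Run (b # k), 0, cell (exec a s)) (Run k, 0, cell (exec b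
    (exec a s)))"
    using Seq a by auto
  show ?case using reach_trans[OF 1 reach_trans[OF 2 3]] by simp
next
  case (For i r c)
  define t where "t j = ((\<lambda>s. set_reg i (Suc (reg s i)) (exec c s)) ^^ j) (set_reg i 0 s)" for j
  let ?n = "reg s r" and ?u = "2 * V + 5"
  let ?L = "Loop i r c # k"
  have wf: "wf_com c" "i \<noteq> CAP" "i \<notin> mods c" "r \<notin> mods c" "is_reg i" "is_reg r" "wf_com (Inc i)"
    "wf_com (Zero i)"
    using For.prems(1) by (auto simp: is_reg_def)
  have t: "st_inv (t j)" "reg s CAP \<le> reg (t j) CAP" "reg (t j) i = j" "reg (t j) r = ?n"
    if "j \<le> ?n" for j
    using For_iterate[OF For.prems(1,2) that exec_inv[OF wf(1)]] by (auto simp: t_def)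
  have tS: "t (Suc j) = set_reg i (Suc (reg (t j) i)) (exec c (t j))" for j
    using exec_reg[OF wf(3)] by (simp add: t_def)
  have ce: "reg (t (Suc j)) CAP = reg (exec c (t j)) CAP" for j using wf(2) by (simp add: tS)
  have mono: "m \<le> ?n \<Longrightarrow> j \<le> m \<Longrightarrow> reg (t j) CAP \<le> reg (t m) CAP" for j m
  proof (induction m)
    case (Suc m)
    have "reg (t m) CAP \<le> reg (t (Suc m)) CAP" unfolding ce using exec_inv[OF wf(1)] t Suc.prems by simp
    then show ?case using Suc by (cases "j = Suc m") auto
  qed simp
  have V: "reg (t j) CAP \<le> V" if "j \<le> ?n" for j
    using mono[OF order_refl that] For.prems(3) by (simp add: t_def)
  have fl: "flag (t j) i (reg (t j) r) \<longleftrightarrow> j = ?n" if "j \<le> ?n" for j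
    using t[OF that] wf by (simp add: flag_def)
  have test: "reach prog ?u (Run ?L, 0, cell (t j)) (Run
    (if j = ?n then k else c # Inc i # ?L), 0, cell (t j))"
    if "j \<le> ?n" for j
    using sim_test[OF wf(6) t(1)[OF that] V[OF that] is_reg_less[OF wf(5)], of prog "Run ?L" k "c # Inc i # ?L"] fl[OF that] by simp
  \<comment> \<open>Here \<open>j\<close> is the number of rounds still to go, so that the induction
    prepends a round to the rest of the run.\<close>
  have loop: "reach prog (j * (time_bound c V + 2 * ?u) + ?u) (Run ?L, 0, cell (t (?n - j)))
    (Run k, 0, cell (t ?n))"
    if "j \<le> ?n" for j
    using that
  proof (induction j)
    case 0
    then show ?case using test[of ?n] by simp
  next
    case (Suc j)
    let ?j = "?n - Suc j"
    have j: "?j < ?n" "Suc ?j = ?n - j" using Suc.prems by auto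
    have 1: "reach prog ?u (Run ?L, 0, cell (t ?j)) (Run (c # Inc i # ?L), 0, cell (t ?j))"
      using test[of ?j] j by simp
    have "Suc ?j \<le> ?n" using j by simp
    from V[OF this] have Vc: "reg (exec c (t ?j)) CAP \<le> V" unfolding ce .
    have 2: "reach prog (time_bound c V) (Run (c # Inc i # ?L), 0, cell (t ?j)) (Run
      (Inc i # ?L), 0, cell (exec c (t ?j)))"
      using For.IH wf(1) t(1)[of ?j] Vc j by auto
    have inv: "st_inv (exec c (t ?j))" using exec_inv[OF wf(1)] t(1)[of ?j] j by simp
    have 3: "reach prog ?u (Run (Inc i # ?L), 0, cell (exec c (t ?j))) (Run ?L, 0, cell (exec
      (Inc i) (exec c (t ?j))))"
      using sim_Inc[OF wf(7) inv Vc] .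
    have "reg (exec c (t ?j)) i = ?j" "reg (exec c (t ?j)) r = ?n"
      using exec_reg wf(3,4) t[of ?j] j by auto
    \<comment> \<open>The increment of the counter is not blocked: its old value is below the bound
      register, which is at most \<open>CAP\<close>.\<close>
    moreover have "?n \<le> reg (exec c (t ?j)) CAP" using inv calculation(2) unfolding st_inv_def by metis
    ultimately have "exec (Inc i) (exec c (t ?j)) = set_reg i (Suc ?j) (exec c (t ?j))"
      using j(1) by simp
    moreover have "t (Suc ?j) = set_reg i (Suc ?j) (exec c (t ?j))"
      unfolding tS t(3)[OF less_imp_le[OF j(1)]] by (rule refl)
    ultimately have "exec (Inc i) (exec c (t ?j)) = t (?n - j)" by (simp only: j(2))
    then have "reach prog (?u + (time_bound c V + ?u)) (Run ?L, 0, cell (t ?j)) (Run ?L, 0, cell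
      (t (?n - j)))"
      using reach_trans[OF 1 reach_trans[OF 2 3]] by simp
    from reach_trans[OF this Suc.IH] Suc.prems show ?case by (simp add: algebra_simps)
  qed
  have "reach prog 1 (Run (For i r c # k), 0, cell s) (Run (Zero i # ?L), 0, (cell s)(0 := cell s 0))"
    by (intro reach_step) (simp add: cell_Int)
  then have 1: "reach prog 1 (Run (For i r c # k), 0, cell s) (Run (Zero i # ?L), 0, cell s)" by simp
  have "reg s CAP \<le> V" using V[of 0] wf(2) by (simp add: t_def)
  from sim_Zero[OF wf(8) For.prems(2) this, of prog ?L]
  have 2: "reach prog ?u (Run (Zero i # ?L), 0, cell s) (Run ?L, 0, cell (t 0))" by (simp add: t_def)
  have 3: "reach prog (?n * (time_bound c V + 2 * ?u) + ?u) (Run ?L, 0, cell (t 0))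
    (Run k, 0, cell (t ?n))"
    using loop[of ?n] by simp
  have "?n \<le> V" using t(1)[of 0] t(4)[of 0] V[of 0] unfolding st_inv_def by (metis le_trans zero_le)
  then have "?n * (time_bound c V + 2 * ?u) \<le> V * (time_bound c V + 2 * ?u)"
    by (rule mult_right_mono) simp
  then show ?case using reach_mono[OF reach_trans[OF 1 reach_trans[OF 2 3]]]
    by (simp add: t_def)
qed simp

section \<open>Initial configuration and acceptance\<close>

definition init_st :: "nat list \<Rightarrow> st" where
  "init_st x = \<lparr>reg = (\<lambda>r. if r = CAP then length x else 0),
     arr = (\<lambda>f p. f < 2 \<and> p < length x \<and> f \<in> set_decode (x ! p))\<rparr>"

lemma st_inv_init: "st_inv (init_st x)" by (simp add: st_inv_def init_st_def)

lemma decode_symbol: "a \<in> {1, 2, 3} \<Longrightarrow> set_decode a \<subseteq> {0, 1} \<and> set_decode a \<noteq> {}"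
proof -
  assume "a \<in> {1, 2, 3}"
  then have "a < 4" "a \<noteq> 0" by auto
  have "i \<in> {0, 1}" if "i \<in> set_decode a" for i
  proof (rule ccontr)
    assume "i \<notin> {0, 1}"
    then have "2 \<le> i" by auto
    then have "(2::nat) ^ 2 \<le> 2 ^ i" by (intro power_increasing) auto
    then have "a div 2 ^ i = 0" using \<open>a < 4\<close> by (intro div_less) simp
    then show False using that by (simp add: set_decode_def)
  qed
  moreover have "set_decode a \<noteq> {}" using \<open>a \<noteq> 0\<close> by (metis set_decode_inverse set_encode_empty)
  ultimately show ?thesis by auto
qed

text \<open>No input symbol is blank, so the first blank lies at position \<open>length x\<close>,
  where the mark of \<open>CAP\<close> is put. All other registers are marked on the first cell,
  which is a different one because \<open>x\<close> is nonempty.\<close>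

lemma sim_init:
  assumes x: "x \<noteq> []" "set x \<subseteq> {1, 2, 3}"
  shows "reach prog (2 * length x + 2) (Start, 0, tape [] x) (Run [prog], 0, cell (init_st x))"
proof -
  let ?n = "length x"
  define F0 where "F0 = tape [] x"
  have F0: "F0 p = (if p < ?n then set_decode (x ! p) else {})" for p
    by (simp add: F0_def tape_def nth_default_def)
  have F0s: "F0 p \<subseteq> {0, 1}" for p using decode_symbol x(2) by (auto simp: F0 dest!: nth_mem)
  have F0n: "F0 p \<noteq> {}" if "p < ?n" for p
  proof -
    have "x ! p \<in> {1, 2, 3}" using x(2) nth_mem[OF that] by blast
    then show ?thesis using decode_symbol by (simp only: F0 that if_True) blast
  qed
  let ?F1 = "F0(0 := F0 0 \<union> {3..<32})"
  have "(F0 0 \<union> {3..<32}) \<inter> {..<nflags} = F0 0 \<union> {3..<32}" using F0s[of 0] by (auto simp: nflags_def)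
  then have 1: "reach prog 1 (Start, 0, F0) (Init, 1, ?F1)" by (intro reach_step) simp
  have "reach prog (?n - 1) (Init, 1, ?F1) (Init, 1 + (?n - 1), ?F1)"
    using F0n F0s by (intro reach_scan) (auto simp: nflags_def dest!: subsetD[OF F0s])
  then have 2: "reach prog (?n - 1) (Init, 1, ?F1) (Init, ?n, ?F1)" using x(1) by (simp add: Suc_leI)
  let ?F2 = "?F1(?n := {CAP})"
  have "{CAP} \<inter> {..<nflags} = {CAP}" by (auto simp: nflags_def)
  then have 3: "reach prog 1 (Init, ?n, ?F1) (Back None [prog], ?n, ?F2)"
    using x(1) by (intro reach_step) (simp add: F0)
  have F2: "?F2 = cell (init_st x)"
  proof
    fix p
    consider "p = 0" "?n \<noteq> 0" | "p = ?n" "p \<noteq> 0" | "p \<noteq> 0" "p \<noteq> ?n" using x(1) by auto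
    then show "?F2 p = cell (init_st x) p"
    proof cases
      case 1
      then show ?thesis using F0s[of 0] F0[of 0]
        by (auto simp: cell_def flag_def is_reg_def init_st_def nflags_def)
    next
      case 2
      then show ?thesis using F0[of p]
        by (auto simp: cell_def flag_def is_reg_def init_st_def nflags_def)
    next
      case 3
      then show ?thesis using F0s[of p] F0[of p]
        by (auto simp: cell_def flag_def is_reg_def init_st_def nflags_def)
    qed
  qed
  let ?C = "cell (init_st x)"
  have "reach prog (Suc ?n) (Back None [prog], ?n, ?C) (Run [prog], 0, ?C(0 := ?C 0 \<union> set_option None))"
    using cell_HOME[OF st_inv_init] cell_sub by (intro reach_back) auto
  then have 4: "reach prog (Suc ?n) (Back None [prog], ?n, ?C) (Run [prog], 0, ?C)" by simp
  show ?thesis using reach_trans[OF reach_trans[OF reach_trans[OF 1 2] 3[unfolded F2]] 4]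
    unfolding F0_def by (rule reach_mono) (use x(1) in \<open>cases x; simp\<close>)
qed

text \<open>Apart from the program, \<open>2 * length x + 2\<close> steps go into the initialisation
  and one into the final test of \<open>ANS\<close>.\<close>

theorem machine_decides:
  assumes "wf_com prog" "x \<noteq> []" "set x \<subseteq> {1, 2, 3}" "reg (exec prog (init_st x)) CAP \<le> V"
    and T: "2 * length x + 3 + time_bound prog V \<le> T"
  shows "tm_decides_within (machine prog) T x (arr (exec prog (init_st x)) ANS 0)"
proof -
  let ?s = "exec prog (init_st x)"
  let ?q = "if arr ?s ANS 0 then Acc else Rej"
  have 2: "reach prog (time_bound prog V) (Run [prog], 0, cell (init_st x)) (Run [], 0, cell ?s)"
    by (rule sim_com) (use assms st_inv_init in auto)
  have "reach prog 1 (Run [], 0, cell ?s) (?q, 0, (cell ?s)(0 := cell ?s 0))"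
    by (intro reach_step) (simp add: cell_Int, simp add: cell_def flag_def is_reg_def nflags_def)
  note all = reach_trans[OF reach_trans[OF sim_init[OF assms(2,3)] 2] this]
  have "reach prog T (Start, 0, tape [] x) (?q, 0, (cell ?s)(0 := cell ?s 0))"
    by (rule reach_mono[OF all]) (use T in simp)
  then obtain n where n: "n \<le> T"
    "(astep prog ^^ n) (Start, 0, tape [] x) = (?q, 0, (cell ?s)(0 := cell ?s 0))"
    unfolding reach_def by blast
  then have "fst ((tm_step (machine prog) ^^ n) (0, [], x)) = code ?q"
    using tm_run_simulates[of n prog x] by force
  then show ?thesis using n(1) unfolding tm_decides_within_def by (intro exI[of _ n]) auto
qed

section \<open>Arithmetic and parsing programs\<close>

text \<open>Roles: \<open>NN\<close> is the input length; \<open>LM\<close>, \<open>BS\<close>,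
  \<open>BG\<close> are the bound on walks, the base and the side of the table; \<open>PT\<close> is
  the reading position, \<open>P0\<close> the start of the transition list, \<open>S0\<close> the
  token of the initial state, \<open>CNT\<close> the number of transitions. \<open>LV\<close>,
  \<open>TV\<close>, \<open>QV\<close>, \<open>WV\<close> count layers, transitions, positions and
  weights; \<open>SRC\<close>, \<open>TG\<close>, \<open>WT\<close> describe the transition just
  read; \<open>VL\<close> and \<open>PW\<close> serve to decode numbers; \<open>AD\<close> is a
  table address; \<open>L1\<close> and \<open>W1\<close> are the next layer and weight.
  \<open>EQ\<close>, \<open>DONE\<close>, \<open>HAS\<close> are single bits, stored in arrays at
  cell 0.\<close>

abbreviation (input) NN :: nat where "NN \<equiv> 4"
abbreviation (input) LM :: nat where "LM \<equiv> 5"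
abbreviation (input) BS :: nat where "BS \<equiv> 6"
abbreviation (input) BG :: nat where "BG \<equiv> 7"
abbreviation (input) PT :: nat where "PT \<equiv> 8"
abbreviation (input) P0 :: nat where "P0 \<equiv> 9"
abbreviation (input) S0 :: nat where "S0 \<equiv> 10"
abbreviation (input) CNT :: nat where "CNT \<equiv> 11"
abbreviation (input) LV :: nat where "LV \<equiv> 12"
abbreviation (input) TV :: nat where "TV \<equiv> 13"
abbreviation (input) QV :: nat where "QV \<equiv> 14"
abbreviation (input) WV :: nat where "WV \<equiv> 15"
abbreviation (input) SRC :: nat where "SRC \<equiv> 16"
abbreviation (input) TG :: nat where "TG \<equiv> 17"
abbreviation (input) WT :: nat where "WT \<equiv> 18"
abbreviation (input) VL :: nat where "VL \<equiv> 19"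
abbreviation (input) PW :: nat where "PW \<equiv> 20"
abbreviation (input) I1 :: nat where "I1 \<equiv> 21"
abbreviation (input) I2 :: nat where "I2 \<equiv> 22"
abbreviation (input) AD :: nat where "AD \<equiv> 24"
abbreviation (input) X1 :: nat where "X1 \<equiv> 25"
abbreviation (input) X2 :: nat where "X2 \<equiv> 26"
abbreviation (input) L1 :: nat where "L1 \<equiv> 27"
abbreviation (input) W1 :: nat where "W1 \<equiv> 28"
abbreviation (input) A0 :: nat where "A0 \<equiv> 29"
abbreviation (input) I3 :: nat where "I3 \<equiv> 30"
abbreviation (input) EQ :: nat where "EQ \<equiv> 37"
abbreviation (input) DONE :: nat where "DONE \<equiv> 38"
abbreviation (input) HAS :: nat where "HAS \<equiv> 39"

declare exec_reg [simp] exec_arr [simp]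

lemma wf_st_inv: "wf_com c \<Longrightarrow> st_inv s \<Longrightarrow> st_inv (exec c s)"
  using exec_inv by blast

lemma st_inv_HOME: "st_inv s \<Longrightarrow> reg s HOME = 0"
  and st_inv_le: "st_inv s \<Longrightarrow> reg s r \<le> reg s CAP"
  by (auto simp: st_inv_def)

lemma flag_reg: "2 \<le> f \<Longrightarrow> f < 32 \<Longrightarrow> flag s f p \<longleftrightarrow> reg s f = p"
  by (simp add: flag_def is_reg_def)

lemma flag_arr: "f < 2 \<or> 32 \<le> f \<Longrightarrow> flag s f p \<longleftrightarrow> arr s f p"
  by (auto simp: flag_def is_reg_def)

lemma set_reg_twice [simp]: "set_reg r v (set_reg r w s) = set_reg r v s"
  by (simp add: set_reg_def)

lemma set_reg_commute: "r \<noteq> q \<Longrightarrow> set_reg r v (set_reg q w s) = set_reg q w (set_reg r v s)"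
  by (simp add: set_reg_def fun_upd_twist)

text \<open>An empty loop ends with its counter at the bound, so the counter itself is the
  copy.\<close>

definition copy :: "nat \<Rightarrow> nat \<Rightarrow> com" where "copy r a = For r a Skip"

lemma copy_simps [simp]:
  "mods (copy r a) = {r}" "puts (copy r a) = {}"
  "wf_com (copy r a) \<longleftrightarrow> 4 \<le> r \<and> r < 32 \<and> 2 \<le> a \<and> a < 32 \<and> r \<noteq> a"
  by (auto simp: copy_def)

lemma exec_copy [simp]: "r \<noteq> a \<Longrightarrow> exec (copy r a) s = set_reg r (reg s a) s"
proof -
  assume "r \<noteq> a"
  have "((\<lambda>s. set_reg r (Suc (reg s r)) s) ^^ m) (set_reg r 0 s) = set_reg r m s" for m
    by (induction m) auto
  then show ?thesis by (simp add: copy_def)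
qed

definition add :: "nat \<Rightarrow> nat \<Rightarrow> nat \<Rightarrow> com" where "add i r a = For i a (Inc r)"

lemma add_simps [simp]:
  "mods (add i r a) = {i, r}" "puts (add i r a) = {}"
  "wf_com (add i r a) \<longleftrightarrow> 4 \<le> i \<and> i < 32 \<and> 4 \<le> r \<and> r < 32 \<and> 2 \<le> a \<and> a < 32 \<and> i \<noteq> a \<and> r \<noteq> a \<and> i \<noteq> r"
  by (auto simp: add_def)

text \<open>The hypothesis on \<open>CAP\<close> ensures that no \<open>Inc\<close> is blocked; all
  further arithmetic carries such a condition.\<close>

lemma exec_add:
  assumes "i \<noteq> r" "i \<noteq> a" "r \<noteq> a" "i \<noteq> CAP" "r \<noteq> CAP" "reg s r + reg s a \<le> reg s CAP"
  shows "exec (add i r a) s = set_reg i (reg s a) (set_reg r (reg s r + reg s a) s)"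
proof -
  have "j \<le> reg s a \<Longrightarrow> ((\<lambda>s. set_reg i (Suc (reg s i)) (exec (Inc r) s)) ^^ j) (set_reg i 0 s) =
    set_reg i j (set_reg r (reg s r + j) s)" for j
  proof (induction j)
    case 0
    show ?case by (simp add: set_reg_def)
  next
    case (Suc j)
    then show ?case using assms by (simp add: set_reg_commute[of r i])
  qed
  then show ?thesis by (simp add: add_def)
qed

definition muladd :: "nat \<Rightarrow> nat \<Rightarrow> nat \<Rightarrow> nat \<Rightarrow> nat \<Rightarrow> com" where
  "muladd i j z a b = For i a (add j z b)"

lemma muladd_simps [simp]:
  "mods (muladd i j z a b) = {i, j, z}" "puts (muladd i j z a b) = {}"
  "wf_com (muladd i j z a b) \<longleftrightarrow> wf_com (add j z b) \<and> 4 \<le> i \<and> i < 32 \<and> 2 \<le> a \<and> a < 32 \<and>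
     i \<noteq> a \<and> i \<noteq> j \<and> i \<noteq> z \<and> a \<noteq> j \<and> a \<noteq> z"
  by (auto simp: muladd_def)

lemma exec_muladd:
  assumes "wf_com (muladd i j z a b)" "i \<noteq> b" "st_inv s" "reg s z + reg s a * reg s b \<le> reg s CAP"
  shows "reg (exec (muladd i j z a b) s) z = reg s z + reg s a * reg s b"
  unfolding muladd_def
proof (rule For_rule[where I = "\<lambda>m t. reg t z = reg s z + m * reg s b"])
  show "wf_com (For i a (add j z b))" using assms(1) by (simp add: muladd_def)
next
  fix m t
  assume m: "m < reg s a" and t: "st_inv t" "reg t z = reg s z + m * reg s b"
    and fr: "\<And>q. q \<notin> mods (add j z b) \<Longrightarrow> q \<noteq> i \<Longrightarrow> reg t q = reg s q"
  have b: "reg t b = reg s b" "reg t CAP = reg s CAP" using fr[of b] fr[of CAP] assms(1,2) by auto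
  have "Suc m * reg s b \<le> reg s a * reg s b" using m by (intro mult_right_mono) auto
  then have "reg t z + reg t b \<le> reg t CAP" using assms(4) b t(2) by simp
  then show "reg (set_reg i (Suc m) (exec (add j z b) t)) z = reg s z + Suc m * reg s b"
    using assms(1) t b by (subst exec_add) auto
qed (use assms in \<open>auto simp: st_inv_def\<close>)

section \<open>Reading numeral tokens from the input\<close>

definition ptr :: "nat list \<Rightarrow> nat \<Rightarrow> nat list \<Rightarrow> bool" where
  "ptr x p u \<longleftrightarrow> p \<le> length x \<and> drop p x = u"

lemma ptr_Cons: "ptr x p (a # u) \<Longrightarrow> p < length x \<and> x ! p = a \<and> ptr x (Suc p) u"
  unfolding ptr_def by (metis Cons_nth_drop_Suc Suc_leI drop_all leI list.distinct(1) list.inject)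

text \<open>\<open>CAP\<close> is strictly above the input length so that a reading position inside
  the input can always be incremented.\<close>

definition inp :: "nat list \<Rightarrow> st \<Rightarrow> bool" where
  "inp x s \<longleftrightarrow> st_inv s \<and> reg s NN = length x \<and> length x < reg s CAP \<and>
     (\<forall>p. arr s 0 p \<longleftrightarrow> p < length x \<and> (x ! p = 1 \<or> x ! p = 3)) \<and>
     (\<forall>p. arr s 1 p \<longleftrightarrow> p < length x \<and> (x ! p = 2 \<or> x ! p = 3))"

lemma inp_frame:
  "inp x s \<Longrightarrow> st_inv t \<Longrightarrow> reg t NN = reg s NN \<Longrightarrow> reg t CAP = reg s CAP \<Longrightarrow>
    arr t 0 = arr s 0 \<Longrightarrow> arr t 1 = arr s 1 \<Longrightarrow> inp x t"
  by (simp add: inp_def)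

lemma inp_exec:
  "inp x s \<Longrightarrow> wf_com c \<Longrightarrow> NN \<notin> mods c \<Longrightarrow> CAP \<notin> mods c \<Longrightarrow> 0 \<notin> puts c \<Longrightarrow> 1 \<notin> puts c \<Longrightarrow>
    inp x (exec c s)"
  by (auto intro!: inp_frame wf_st_inv simp: inp_def)

lemma inp_symbol:
  assumes "inp x s" "ptr x p (a # u)" "a \<in> {1, 2, 3}"
  shows "flag s 0 p \<longleftrightarrow> a = 1 \<or> a = 3" "flag s 1 p \<longleftrightarrow> a = 2 \<or> a = 3"
    "flag s (Suc 0) p \<longleftrightarrow> a = 2 \<or> a = 3"
  using assms ptr_Cons[OF assms(2)] by (auto simp: inp_def flag_arr)

declare bin.simps [simp del]

lemma tok_0: "tok 0 = [3]"
  by (simp add: tok_def bin.simps)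

lemma tok_pos: "0 < v \<Longrightarrow> tok v = (v mod 2 + 1) # tok (v div 2)"
  by (simp add: tok_def bin.simps[of v])

lemma tok_cases:
  obtains "v = 0" "tok v = [3]" | "0 < v" "v mod 2 = 0" "tok v = 1 # tok (v div 2)"
  | "0 < v" "v mod 2 = 1" "tok v = 2 # tok (v div 2)"
proof (cases "v = 0")
  case True
  then show ?thesis using that tok_0 by simp
next
  case False
  then show ?thesis using that tok_pos[of v] by (cases "v mod 2 = 0") auto
qed

text \<open>As loops cannot be left early, the bit \<open>DONE\<close> turns the remaining rounds
  into no-ops. The symbol 3 that ends a token is the one carrying both flags 0 and 1.\<close>

definition skip_tok :: com where
  "skip_tok = Seq (Put False DONE HOME) (For I1 NN (CIf HOME DONE Skip
     (Seq (CIf PT 0 (CIf PT 1 (Put True DONE HOME) Skip) Skip) (Inc PT))))"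

lemma skip_tok_simps [simp]:
  "mods skip_tok = {I1, PT}" "puts skip_tok = {DONE}" "wf_com skip_tok"
  by (auto simp: skip_tok_def)

lemma exec_skip_tok:
  assumes "inp x s" "ptr x (reg s PT) (tok v @ u)"
  shows "ptr x (reg (exec skip_tok s) PT) u"
proof -
  let ?b = "CIf HOME DONE Skip (Seq (CIf PT 0 (CIf PT 1 (Put True DONE HOME) Skip) Skip) (Inc PT))"
  let ?s = "exec (Put False DONE HOME) s"
  \<comment> \<open>While the token lasts, the position is at least the number of rounds done. After
    \<open>length x\<close> rounds it would be at the end of the input, where no token can be read;
    hence \<open>DONE\<close> is set by then.\<close>
  let ?I = "\<lambda>j t. (arr t DONE 0 \<and> ptr x (reg t PT) u) \<or>
     (\<not> arr t DONE 0 \<and> j \<le> reg t PT \<and> (\<exists>v. ptr x (reg t PT) (tok v @ u)))"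
  have inv: "st_inv s" "st_inv ?s" using assms(1) by (auto simp: inp_def st_inv_def)
  have inps: "inp x ?s" using assms(1) by (rule inp_frame) (use inv in auto)
  have "?I (reg ?s NN) (exec (For I1 NN ?b) ?s)"
  proof (rule For_rule[where I = ?I])
    show "?I 0 (set_reg I1 0 ?s)" using assms(2) inv by (auto simp: st_inv_HOME)
  next
    fix j t
    assume t: "st_inv t" "?I j t" and fr: "\<And>q. q \<notin> mods ?b \<Longrightarrow> q \<noteq> I1 \<Longrightarrow> reg t q = reg ?s q"
      "\<And>f. f \<notin> puts ?b \<Longrightarrow> arr t f = arr ?s f"
    have it: "inp x t" using inps t(1) by (rule inp_frame) (use fr in auto)
    have H: "reg t HOME = 0" using t(1) by (rule st_inv_HOME)
    show "?I (Suc j) (set_reg I1 (Suc j) (exec ?b t))"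
    proof (cases "arr t DONE 0")
      case True
      then show ?thesis using t(2) by (simp add: H flag_arr)
    next
      case False
      then obtain v where v: "j \<le> reg t PT" "ptr x (reg t PT) (tok v @ u)" using t(2) by auto
      have lt: "reg t PT \<noteq> reg t CAP" if "ptr x (reg t PT) (a # w)" for a w
        using ptr_Cons[OF that] it by (auto simp: inp_def)
      show ?thesis
      proof (cases v rule: tok_cases)
        case 1
        then have p: "ptr x (reg t PT) (3 # u)" using v by simp
        show ?thesis using False H inp_symbol[OF it p] lt[OF p] ptr_Cons[OF p] by (simp add: flag_arr)
      next
        case 2
        then have p: "ptr x (reg t PT) (1 # tok (v div 2) @ u)" using v by simp
        show ?thesis using False H inp_symbol[OF it p] lt[OF p] ptr_Cons[OF p] v(1)
          by (auto simp: flag_arr)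
      next
        case 3
        then have p: "ptr x (reg t PT) (2 # tok (v div 2) @ u)" using v by simp
        show ?thesis using False H inp_symbol[OF it p] lt[OF p] ptr_Cons[OF p] v(1)
          by (auto simp: flag_arr)
      qed
    qed
  qed (use inv in auto)
  moreover have "\<not> (length x \<le> p \<and> ptr x p (tok v @ u))" for p v by (auto simp: ptr_def tok_def)
  ultimately show ?thesis using inps unfolding skip_tok_def inp_def by auto
qed

text \<open>Digits come with the least significant one first, 0 as symbol 1 and 1 as symbol 2.
  Symbol 2 lacks flag 0, so the branch without that flag is the one that adds the current power of
  two.\<close>

definition decode :: com where
  "decode = Seq (Put False DONE HOME) (Seq (Zero VL) (Seq (Zero PW) (Seq (Inc PW)
     (For I1 NN (CIf HOME DONE Skip
       (Seq (CIf PT 0 (CIf PT 1 (Put True DONE HOME) Skip) (add I2 VL PW))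
         (Seq (copy X1 PW) (Seq (add I2 PW X1) (Inc PT)))))))))"

lemma decode_simps [simp]:
  "mods decode = {I1, I2, PT, VL, PW, X1}" "puts decode = {DONE}" "wf_com decode"
  by (auto simp: decode_def)

text \<open>The room \<open>2 * v + 1\<close> suffices: \<open>PW\<close> starts at 1 and is doubled
  only while a digit remains, that is, starting from a power at most \<open>v\<close>. Only letters
  and list lengths are decoded, never names of states.\<close>

lemma exec_decode:
  assumes "inp x s" "ptr x (reg s PT) (tok v @ u)" "2 * v + 1 \<le> reg s CAP"
  shows "ptr x (reg (exec decode s) PT) u" "reg (exec decode s) VL = v"
proof -
  let ?b = "CIf HOME DONE Skip
       (Seq (CIf PT 0 (CIf PT 1 (Put True DONE HOME) Skip) (add I2 VL PW))
         (Seq (copy X1 PW) (Seq (add I2 PW X1) (Inc PT))))"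
  define c where "c = Seq (Put False DONE HOME) (Seq (Zero VL) (Seq (Zero PW) (Inc PW)))"
  let ?s = "exec c s"
  let ?I = "\<lambda>j t. (arr t DONE 0 \<and> ptr x (reg t PT) u \<and> reg t VL = v) \<or>
     (\<not> arr t DONE 0 \<and> j \<le> reg t PT \<and> ptr x (reg t PT) (tok (v div 2 ^ j) @ u) \<and>
      reg t VL = v mod 2 ^ j \<and> reg t PW = 2 ^ j)"
  have inv: "st_inv s" using assms(1) by (simp add: inp_def)
  have inps: "inp x ?s" using assms(1) by (rule inp_exec) (auto simp: c_def)
  have C0: "reg s CAP \<noteq> 0" using assms(3) by auto
  have s0: "reg ?s VL = 0" "reg ?s PW = 1" "reg ?s PT = reg s PT" "\<not> arr ?s DONE 0"
    "reg ?s CAP = reg s CAP"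
    using C0 inv by (simp_all add: c_def st_inv_HOME)
  have "?I (reg ?s NN) (exec (For I1 NN ?b) ?s)"
  proof (rule For_rule[where I = ?I])
    show "?I 0 (set_reg I1 0 ?s)" using assms(2) s0 by simp
  next
    fix j t
    assume t: "st_inv t" "?I j t" and fr: "\<And>q. q \<notin> mods ?b \<Longrightarrow> q \<noteq> I1 \<Longrightarrow> reg t q = reg ?s q"
      "\<And>f. f \<notin> puts ?b \<Longrightarrow> arr t f = arr ?s f"
    have it: "inp x t" using inps t(1) by (rule inp_frame) (use fr in auto)
    have cap: "reg t CAP = reg s CAP" using fr(1)[of CAP] s0 by simp
    have H: "reg t HOME = 0" using t(1) by (rule st_inv_HOME)
    show "?I (Suc j) (set_reg I1 (Suc j) (exec ?b t))"
    proof (cases "arr t DONE 0")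
      case True
      then show ?thesis using t(2) by (simp add: H flag_arr)
    next
      case False
      then have v: "j \<le> reg t PT" "ptr x (reg t PT) (tok (v div 2 ^ j) @ u)"
        "reg t VL = v mod 2 ^ j" "reg t PW = 2 ^ j" using t(2) by auto
      have lt: "reg t PT \<noteq> reg t CAP" if "ptr x (reg t PT) (a # w)" for a w
        using ptr_Cons[OF that] it by (auto simp: inp_def)
      have dv: "v div 2 ^ j div 2 = v div (2 ^ j * 2)" by (simp add: div_mult2_eq)
      have md: "v mod (2 ^ j * 2) = 2 ^ j * (v div 2 ^ j mod 2) + v mod 2 ^ j" by (rule mod_mult2_eq)
      have pw: "2 ^ j + 2 ^ j \<le> reg t CAP" if "0 < v div 2 ^ j"
      proof -
        have "2 ^ j \<le> v" using that by (metis div_less less_nat_zero_code not_le)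
        then show ?thesis using assms(3) cap by simp
      qed
      show ?thesis
      proof (cases "v div 2 ^ j" rule: tok_cases)
        case 1
        then have p: "ptr x (reg t PT) (3 # u)" using v by simp
        have "v mod 2 ^ j = v" using 1(1) by (simp add: div_eq_0_iff)
        then show ?thesis using False H inp_symbol[OF it p] lt[OF p] ptr_Cons[OF p] v
          by (simp add: flag_arr)
      next
        case 2
        then have p: "ptr x (reg t PT) (1 # tok (v div 2 ^ j div 2) @ u)" using v by simp
        show ?thesis using False H inp_symbol[OF it p] lt[OF p] ptr_Cons[OF p] v 2 pw md
          by (auto simp: flag_arr exec_add dv mult.commute)
      next
        case 3
        then have p: "ptr x (reg t PT) (2 # tok (v div 2 ^ j div 2) @ u)" using v by simp
        have "v mod 2 ^ j < 2 ^ j" by simp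
        then have a: "v mod 2 ^ j + 2 ^ j \<le> reg t CAP" using pw 3(1) by linarith
        show ?thesis using False H inp_symbol[OF it p] lt[OF p] ptr_Cons[OF p] v 3 pw md a
          by (auto simp: flag_arr exec_add dv mult.commute)
      qed
    qed
  qed (use inps in \<open>auto simp: inp_def\<close>)
  moreover have "\<not> (length x \<le> p \<and> ptr x p (tok v @ u))" for p v by (auto simp: ptr_def tok_def)
  moreover have "reg ?s NN = length x" using inps by (simp add: inp_def)
  moreover have "exec decode s = exec (For I1 NN ?b) ?s" unfolding decode_def c_def
    by (simp only: exec.simps)
  ultimately show "ptr x (reg (exec decode s) PT) u" "reg (exec decode s) VL = v"
    by metis+
qed

definition differ :: com where
  "differ = Seq (Put False EQ HOME) (Put True DONE HOME)"

definition advance :: com where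
  "advance = Seq (Inc X1) (Inc X2)"

text \<open>The tokens at positions \<open>QV\<close> and \<open>SRC\<close> are compared symbol by
  symbol, because the numbers they denote may exceed every register.\<close>

definition str_eq :: com where
  "str_eq = Seq (Seq (copy X1 QV) (Seq (copy X2 SRC) (Seq (Put False DONE HOME) (Put True EQ HOME))))
     (For I1 NN (CIf HOME DONE Skip (CIf X1 0
       (CIf X2 0 (CIf X1 1 (CIf X2 1 (Put True DONE HOME) differ) (CIf X2 1 differ advance)) differ)
       (CIf X2 0 differ advance))))"

lemma str_eq_simps [simp]:
  "mods str_eq = {I1, X1, X2}" "puts str_eq = {DONE, EQ}" "wf_com str_eq"
  by (auto simp: str_eq_def differ_def advance_def)

lemma exec_differ: "st_inv t \<Longrightarrow> arr (exec differ t) DONE 0 \<and> \<not> arr (exec differ t) EQ 0"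
  by (simp add: differ_def st_inv_HOME)

lemma exec_advance:
  assumes "inp x t" "ptr x (reg t X1) (a # u)" "ptr x (reg t X2) (b # v)"
  shows "reg (exec advance t) X1 = Suc (reg t X1)" "reg (exec advance t) X2 = Suc (reg t X2)"
    "arr (exec advance t) = arr t"
  using assms(1) ptr_Cons[OF assms(2)] ptr_Cons[OF assms(3)] by (auto simp: advance_def inp_def)

lemma div2_eq: "0 < u \<Longrightarrow> 0 < v \<Longrightarrow> u mod 2 = v mod 2 \<Longrightarrow> u = v \<longleftrightarrow> u div 2 = v div (2::nat)"
  by (metis mult_div_mod_eq)

lemma exec_str_eq:
  assumes "inp x s" "ptr x (reg s QV) (tok u @ r1)" "ptr x (reg s SRC) (tok v @ r2)"
  shows "arr (exec str_eq s) EQ 0 \<longleftrightarrow> u = v"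
proof -
  let ?b = "CIf HOME DONE Skip (CIf X1 0
       (CIf X2 0 (CIf X1 1 (CIf X2 1 (Put True DONE HOME) differ) (CIf X2 1 differ advance)) differ)
       (CIf X2 0 differ advance))"
  define c where "c = Seq (copy X1 QV) (Seq (copy X2 SRC) (Seq (Put False DONE HOME)
    (Put True EQ HOME)))"
  let ?s = "exec c s"
  \<comment> \<open>\<open>?J\<close> describes a comparison in progress: \<open>u'\<close> and
    \<open>v'\<close> are the numbers spelled by the unread digits, and they agree iff
    \<open>u\<close> and \<open>v\<close> do.\<close>
  let ?J = "\<lambda>j t. \<exists>u' v'. ptr x (reg t X1) (tok u' @ r1) \<and> ptr x (reg t X2) (tok v' @ r2) \<and>
      (u = v \<longleftrightarrow> u' = v') \<and> j \<le> reg t X1 \<and> \<not> arr t DONE 0 \<and> arr t EQ 0"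
  let ?I = "\<lambda>j t. (arr t DONE 0 \<and> (arr t EQ 0 \<longleftrightarrow> u = v)) \<or> ?J j t"
  have inv: "st_inv s" using assms(1) by (simp add: inp_def)
  have inps: "inp x ?s" using assms(1) by (rule inp_exec) (auto simp: c_def)
  have s0: "reg ?s X1 = reg s QV" "reg ?s X2 = reg s SRC" "\<not> arr ?s DONE 0" "arr ?s EQ 0"
    using inv by (simp_all add: c_def st_inv_HOME)
  have "?I (reg ?s NN) (exec (For I1 NN ?b) ?s)"
  proof (rule For_rule[where I = ?I])
    show "wf_com (For I1 NN ?b)" by (simp add: differ_def advance_def)
  next
    show "?I 0 (set_reg I1 0 ?s)" using assms(2,3) s0 by auto
  next
    fix j t
    assume t: "st_inv t" "?I j t" and fr: "\<And>q. q \<notin> mods ?b \<Longrightarrow> q \<noteq> I1 \<Longrightarrow> reg t q = reg ?s q"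
      "\<And>f. f \<notin> puts ?b \<Longrightarrow> arr t f = arr ?s f"
    have it: "inp x t" using inps t(1)
      by (rule inp_frame) (use fr in \<open>auto simp: differ_def advance_def\<close>)
    have H: "reg t HOME = 0" using t(1) by (rule st_inv_HOME)
    have stop: "?I (Suc j) (set_reg I1 (Suc j) (exec differ t))" if "u \<noteq> v"
      using exec_differ[OF t(1)] that by simp
    show "?I (Suc j) (set_reg I1 (Suc j) (exec ?b t))"
    proof (cases "arr t DONE 0")
      case True
      then show ?thesis using t(2) by (simp add: H flag_arr)
    next
      case False
      then obtain u' v' where p: "ptr x (reg t X1) (tok u' @ r1)" "ptr x (reg t X2) (tok v' @ r2)"
        and e: "u = v \<longleftrightarrow> u' = v'" and j: "j \<le> reg t X1" and E: "arr t EQ 0" using t(2) by blast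
      obtain a w where a: "tok u' @ r1 = a # w" "a \<in> {1, 2, 3}"
        "a = 3 \<longleftrightarrow> u' = 0" "a \<noteq> 3 \<Longrightarrow> u' mod 2 + 1 = a \<and> w = tok (u' div 2) @ r1"
        by (cases u' rule: tok_cases) auto
      obtain b z where b: "tok v' @ r2 = b # z" "b \<in> {1, 2, 3}"
        "b = 3 \<longleftrightarrow> v' = 0" "b \<noteq> 3 \<Longrightarrow> v' mod 2 + 1 = b \<and> z = tok (v' div 2) @ r2"
        by (cases v' rule: tok_cases) auto
      have pa: "ptr x (reg t X1) (a # w)" and pb: "ptr x (reg t X2) (b # z)" using p a(1) b(1) by auto
      note sym = inp_symbol[OF it pa a(2)] inp_symbol[OF it pb b(2)]
      show ?thesis
      proof (cases "a = b")
        case ne: False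
        then have "u \<noteq> v" using e a b by auto
        moreover have "exec ?b t = exec differ t"
          using ne a(2) b(2) False sym H by (auto simp: flag_arr)
        ultimately show ?thesis using stop by simp
      next
        case eq: True
        show ?thesis
        proof (cases "a = 3")
          case True
          then have "u = v" using e a(3) b(3) eq by auto
          moreover have "exec ?b t = exec (Put True DONE HOME) t"
            using eq True False sym H by (simp add: flag_arr)
          ultimately show ?thesis using H E by simp
        next
          case n3: False
          have "exec ?b t = exec advance t"
            using eq n3 a(2) False sym H by (auto simp: flag_arr)
          moreover have "u' = v' \<longleftrightarrow> u' div 2 = v' div 2"
            using n3 a b eq by (intro div2_eq) auto
          moreover have "w = tok (u' div 2) @ r1" "z = tok (v' div 2) @ r2" using n3 a b eq by auto
          ultimately have "?J (Suc j) (set_reg I1 (Suc j) (exec ?b t))"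
            using exec_advance[OF it pa pb] ptr_Cons[OF pa] ptr_Cons[OF pb] e j E False by auto
          then show ?thesis by blast
        qed
      qed
    qed
  qed (use inps in \<open>auto simp: inp_def\<close>)
  moreover have "\<not> (length x \<le> p \<and> ptr x p (tok v @ u))" for p v u by (auto simp: ptr_def tok_def)
  moreover have "reg ?s NN = length x" using inps by (simp add: inp_def)
  moreover have "exec str_eq s = exec (For I1 NN ?b) ?s" unfolding str_eq_def c_def
    by (simp only: exec.simps)
  ultimately show ?thesis by metis
qed

section \<open>Addresses in the three-dimensional table\<close>

definition addr :: "nat \<Rightarrow> nat \<Rightarrow> nat \<Rightarrow> com" where
  "addr a b c = Seq (Seq (Zero AD) (muladd I1 I2 AD a BG)) (Seq (add I1 AD b) (Seq (Seq (copy X1 AD)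
     (Zero AD)) (Seq (muladd I1 I2 AD X1 BG) (add I1 AD c))))"

definition index :: "nat \<Rightarrow> nat \<Rightarrow> nat \<Rightarrow> nat \<Rightarrow> nat" where
  "index G a b c = (a * G + b) * G + c"

lemma addr_simps [simp]:
  "mods (addr a b c) = {I1, I2, AD, X1}" "puts (addr a b c) = {}"
  "wf_com (addr a b c) \<longleftrightarrow> {a, b, c} \<subseteq> {2..<32} \<and> a \<notin> {I1, I2, AD} \<and> b \<notin> {I1, AD} \<and> c \<notin> {I1, AD}"
  by (auto simp: addr_def)

text \<open>As \<open>BG\<close> is positive, the intermediate value \<open>a * BG + b\<close> is at
  most the final address, so only the latter has to fit below \<open>CAP\<close>.\<close>

lemma exec_addr:
  assumes "wf_com (addr a b c)" "{a, b, c} \<inter> {I1, I2, AD, X1} = {}" "st_inv s"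
    "index (reg s BG) (reg s a) (reg s b) (reg s c) \<le> reg s CAP"
    "0 < reg s BG"
  shows "reg (exec (addr a b c) s) AD = index (reg s BG) (reg s a) (reg s b) (reg s c)"
proof -
  let ?G = "reg s BG" and ?a = "reg s a" and ?b = "reg s b" and ?c = "reg s c"
  have wf: "wf_com (Zero AD)" "wf_com (muladd I1 I2 AD a BG)" "wf_com (add I1 AD b)"
    "wf_com (copy X1 AD)" "wf_com (muladd I1 I2 AD X1 BG)" "wf_com (add I1 AD c)" using assms(1,2)
      by auto
  have "?a * ?G + ?b \<le> (?a * ?G + ?b) * ?G" using assms(5) by simp
  then have le: "?a * ?G + ?b \<le> reg s CAP" "(?a * ?G + ?b) * ?G + ?c \<le> reg s CAP"
    using assms(4) unfolding index_def by linarith+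
  define s1 where "s1 = exec (Zero AD) s"
  define s2 where "s2 = exec (muladd I1 I2 AD a BG) s1"
  define s3 where "s3 = exec (add I1 AD b) s2"
  define s4 where "s4 = exec (Seq (copy X1 AD) (Zero AD)) s3"
  define s5 where "s5 = exec (muladd I1 I2 AD X1 BG) s4"
  define s6 where "s6 = exec (add I1 AD c) s5"
  have inv: "st_inv s1" "st_inv s2" "st_inv s3" "st_inv s4" "st_inv s5"
    unfolding s1_def s2_def s3_def s4_def s5_def using wf assms(3)
      by (auto intro!: wf_st_inv simp del: exec.simps)
  have le0: "?a * ?G \<le> reg s CAP" using le by linarith
  have 0: "reg s1 AD = 0" by (simp add: s1_def)
  have 1: "reg s1 q = reg s q" if "q \<noteq> AD" for q using that by (simp add: s1_def)
  have 2: "reg s2 AD = ?a * ?G"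
    unfolding s2_def using wf(2) inv(1) 0 1 assms(2) le0 by (subst exec_muladd) auto
  have f2: "reg s2 q = reg s q" if "q \<notin> {I1, I2, AD}" for q using that 1 by (simp add: s2_def)
  have 3: "reg s3 AD = ?a * ?G + ?b"
    unfolding s3_def using 2 f2 assms(2) le by (subst exec_add) auto
  have f3: "reg s3 q = reg s q" if "q \<notin> {I1, I2, AD}" for q using that f2 by (simp add: s3_def)
  have 4: "reg s4 AD = 0" "reg s4 X1 = ?a * ?G + ?b" using 3 by (simp_all add: s4_def)
  have f4: "reg s4 q = reg s q" if "q \<notin> {I1, I2, AD, X1}" for q using that f3 by (simp add: s4_def)
  have 5: "reg s5 AD = (?a * ?G + ?b) * ?G"
    unfolding s5_def using wf(5) inv(4) 4 f4 le by (subst exec_muladd) auto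
  have f5: "reg s5 q = reg s q" if "q \<notin> {I1, I2, AD, X1}" for q using that f4 by (simp add: s5_def)
  have 6: "reg s6 AD = (?a * ?G + ?b) * ?G + ?c"
    unfolding s6_def using 5 f5 assms(2) le by (subst exec_add) auto
  have "exec (addr a b c) s = s6"
    unfolding addr_def s1_def s2_def s3_def s4_def s5_def s6_def by (simp only: exec.simps)
  then show ?thesis using 6 by (simp add: index_def)
qed

text \<open>The address is a number in base \<open>G\<close>: \<open>mod\<close> and
  \<open>div\<close> recover its two lower digits, and what remains is \<open>a\<close>.\<close>

lemma index_inject:
  assumes "b < G" "c < G" "b' < G" "c' < G" "index G a b c = index G a' b' c'"
  shows "a = a' \<and> b = b' \<and> c = c'"
proof -
  have "(index G a b c) mod G = c" "(index G a' b' c') mod G = c'"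
    "(index G a b c) div G mod G = b" "(index G a' b' c') div G mod G = b'"
    "(index G a b c) div G div G = a" "(index G a' b' c') div G div G = a'"
    using assms(1-4) by (auto simp: index_def)
  then show ?thesis using assms(5) by metis
qed

section \<open>Reading one transition\<close>

definition weight_part :: com where
  "weight_part = CIf VL HOME (Zero WT) (Seq decode (Seq (Seq (Zero WT) (Inc WT))
     (For I1 VL (Seq (Seq (copy X1 WT) (Zero WT)) (muladd I2 I3 WT X1 BS)))))"

text \<open>The target is kept as the position \<open>TG\<close> of its token. \<open>VL\<close>
  holds the length of the target list, and the test against \<open>HOME\<close> asks whether it is
  empty.\<close>

definition target_part :: com where
  "target_part = CIf VL HOME (Put False HAS HOME)
     (Seq (Seq (Put True HAS HOME) (copy TG PT)) skip_tok)"

definition fetch :: com where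
  "fetch = Seq (copy SRC PT) (Seq skip_tok (Seq decode (Seq weight_part (Seq decode target_part))))"

lemma weight_part_simps [simp]:
  "mods weight_part = {I1, I2, I3, PT, VL, PW, X1, WT}" "puts weight_part = {DONE}" "wf_com weight_part"
  by (auto simp: weight_part_def)

lemma target_part_simps [simp]:
  "mods target_part = {TG, I1, PT}" "puts target_part = {HAS, DONE}" "wf_com target_part"
  by (auto simp: target_part_def)

lemma fetch_simps [simp]:
  "mods fetch = {SRC, I1, I2, I3, PT, VL, PW, X1, WT, TG}" "puts fetch = {DONE, HAS}" "wf_com fetch"
  by (auto simp: fetch_def)

text \<open>\<open>muladd\<close> accumulates into its result, so each round moves the old power to
  \<open>X1\<close>, restarts \<open>WT\<close> at 0 and adds the product with the base.\<close>

lemma exec_weight_loop: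
  assumes "st_inv s" "reg s WT = 1" "0 < reg s BS" "reg s BS ^ reg s VL \<le> reg s CAP"
  shows "reg (exec (For I1 VL (Seq (Seq (copy X1 WT) (Zero WT)) (muladd I2 I3 WT X1 BS))) s) WT =
    reg s BS ^ reg s VL"
proof (rule For_rule[where I = "\<lambda>j t. reg t WT = reg s BS ^ j"])
  fix j t
  let ?b = "Seq (Seq (copy X1 WT) (Zero WT)) (muladd I2 I3 WT X1 BS)"
  assume j: "j < reg s VL" and t: "st_inv t" "reg t WT = reg s BS ^ j"
    and fr: "\<And>q. q \<notin> mods ?b \<Longrightarrow> q \<noteq> I1 \<Longrightarrow> reg t q = reg s q"
  define u where "u = exec (Seq (copy X1 WT) (Zero WT)) t"
  have iu: "st_inv u" unfolding u_def by (rule wf_st_inv) (use t in auto)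
  have u: "reg u X1 = reg s BS ^ j" "reg u WT = 0" "reg u BS = reg s BS" "reg u CAP = reg s CAP"
    using t fr[of BS] fr[of CAP] by (auto simp: u_def)
  have "reg s BS ^ Suc j \<le> reg s BS ^ reg s VL" using j assms(3) by (intro power_increasing) auto
  then have "reg (exec (muladd I2 I3 WT X1 BS) u) WT = reg s BS ^ Suc j"
    using iu u assms(4) by (subst exec_muladd) (auto simp: mult.commute)
  moreover have "exec ?b t = exec (muladd I2 I3 WT X1 BS) u" unfolding u_def by (simp only: exec.simps)
  ultimately show "reg (set_reg I1 (Suc j) (exec ?b t)) WT = reg s BS ^ Suc j" by simp
qed (use assms in auto)

text \<open>The counts of \<open>M\<close> read as digits in base \<open>B\<close>
  (\<open>wsum_count\<close>). Additivity in \<open>M\<close> lets the program extend an output by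
  adding weights.\<close>

definition wsum :: "nat \<Rightarrow> nat multiset \<Rightarrow> nat" where
  "wsum B M = (\<Sum>a\<in>#M. B ^ a)"

lemma size_le_1_cases:
  assumes "size M \<le> 1" obtains "M = {#}" | a where "M = {#a#}"
  using assms by (metis One_nat_def le_Suc_eq le_zero_eq size_1_singleton_mset size_eq_0_iff_empty)

lemma exec_weight_part:
  assumes "inp x s" "ptr x (reg s PT) (concat (map tok (sorted_list_of_multiset M)) @ u)"
    "size M \<le> 1" "set_mset M \<subseteq> {0..<k}" "reg s VL = size M"
    "0 < reg s BS" "reg s BS ^ k \<le> reg s CAP" "2 * k + 1 \<le> reg s CAP"
  shows "ptr x (reg (exec weight_part s) PT) u" "reg (exec weight_part s) WT = wsum (reg s BS) M"
proof -
  have inv: "st_inv s" using assms(1) by (simp add: inp_def)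
  have "ptr x (reg (exec weight_part s) PT) u \<and> reg (exec weight_part s) WT = wsum (reg s BS) M"
    using assms(3)
  proof (cases rule: size_le_1_cases)
    case 1
    then have "exec weight_part s = set_reg WT 0 s"
      using assms(5) inv by (simp add: weight_part_def flag_reg st_inv_HOME)
    then show ?thesis using assms(2) 1 by (simp add: wsum_def)
  next
    case (2 a)
    define s1 where "s1 = exec decode s"
    define s2 where "s2 = exec (Seq (Zero WT) (Inc WT)) s1"
    have a: "a < k" using 2 assms(4) by simp
    have p: "ptr x (reg s PT) (tok a @ u)" using assms(2) 2 by simp
    have 1: "ptr x (reg s1 PT) u" "reg s1 VL = a" "st_inv s1"
      using exec_decode[OF assms(1) p] a assms(8) wf_st_inv[OF _ inv] by (auto simp: s1_def)
    have C: "reg s1 CAP = reg s CAP" "reg s1 BS = reg s BS" by (auto simp: s1_def)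
    have 2: "ptr x (reg s2 PT) u" "reg s2 VL = a" "st_inv s2" "reg s2 WT = 1"
      "reg s2 CAP = reg s CAP" "reg s2 BS = reg s BS"
      using 1 C assms(8) by (auto simp: s2_def simp del: exec.simps intro!: wf_st_inv) auto
    have "reg s BS ^ a \<le> reg s BS ^ k" using a assms(6) by (intro power_increasing) auto
    then have 3: "reg s2 BS ^ reg s2 VL \<le> reg s2 CAP" using 2 assms(7) by simp
    have "exec weight_part s = exec (For I1 VL (Seq (Seq (copy X1 WT) (Zero WT))
      (muladd I2 I3 WT X1 BS))) s2"
      using \<open>M = {#a#}\<close> assms(5) inv
        by (simp add: weight_part_def flag_reg st_inv_HOME s1_def s2_def del: exec.simps(2,3,4,5,8))
    moreover have "reg (exec (For I1 VL (Seq (Seq (copy X1 WT) (Zero WT))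
      (muladd I2 I3 WT X1 BS))) s2) PT = reg s2 PT"
      by (rule exec_reg) simp
    ultimately show ?thesis using exec_weight_loop[OF 2(3,4) _ 3] 2 assms(6) \<open>M = {#a#}\<close>
      by (simp add: wsum_def)
  qed
  then show "ptr x (reg (exec weight_part s) PT) u"
    "reg (exec weight_part s) WT = wsum (reg s BS) M" by auto
qed

lemma exec_target_part:
  assumes "inp x s" "ptr x (reg s PT) (concat (map tok (sorted_list_of_multiset M)) @ u)"
    "size M \<le> 1" "reg s VL = size M"
  shows "ptr x (reg (exec target_part s) PT) u" "arr (exec target_part s) HAS 0 \<longleftrightarrow> M \<noteq> {#}"
    "M = {#t#} \<Longrightarrow> ptr x (reg (exec target_part s) TG) (tok t @ u)"
proof -
  have inv: "st_inv s" using assms(1) by (simp add: inp_def)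
  have "ptr x (reg (exec target_part s) PT) u \<and> (arr (exec target_part s) HAS 0 \<longleftrightarrow> M \<noteq> {#}) \<and>
    (\<forall>t. M = {#t#} \<longrightarrow> ptr x (reg (exec target_part s) TG) (tok t @ u))"
    using assms(3)
  proof (cases rule: size_le_1_cases)
    case 1
    then have "exec target_part s = exec (Put False HAS HOME) s"
      using assms(4) inv by (simp add: target_part_def flag_reg st_inv_HOME)
    then show ?thesis using assms(2) 1 inv by (simp add: st_inv_HOME)
  next
    case (2 a)
    define s1 where "s1 = exec (Seq (Put True HAS HOME) (copy TG PT)) s"
    have "inp x s1" unfolding s1_def using assms(1) by (rule inp_exec) auto
    moreover have p: "ptr x (reg s1 PT) (tok a @ u)" using assms(2) 2 by (simp add: s1_def)
    ultimately have "ptr x (reg (exec skip_tok s1) PT) u" by (rule exec_skip_tok)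
    moreover have "exec target_part s = exec skip_tok s1"
      using 2 assms(4) inv by (simp add: target_part_def flag_reg st_inv_HOME s1_def)
    moreover have "reg s1 TG = reg s1 PT" "arr s1 HAS 0" using inv by (simp_all add: s1_def st_inv_HOME)
    ultimately show ?thesis using p 2 by simp
  qed
  then show "ptr x (reg (exec target_part s) PT) u" "arr (exec target_part s) HAS 0 \<longleftrightarrow> M \<noteq> {#}"
    "M = {#t#} \<Longrightarrow> ptr x (reg (exec target_part s) TG) (tok t @ u)" by auto
qed

lemma enc_natlist_mset: "enc_natlist (sorted_list_of_multiset M) = tok (size M) @ concat (map tok
  (sorted_list_of_multiset M))"
  by (metis enc_natlist_def mset_sorted_list_of_multiset size_mset)

lemma exec_fetch:
  assumes "inp x s" "ptr x (reg s PT) (enc_trans \<tau> @ u)"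
    "size (tout \<tau>) \<le> 1" "size (ttarget \<tau>) \<le> 1" "set_mset (tout \<tau>) \<subseteq> {0..<k}"
    "0 < reg s BS" "reg s BS ^ k \<le> reg s CAP" "2 * k + 3 \<le> reg s CAP"
  shows "ptr x (reg (exec fetch s) PT) u" "\<exists>r. ptr x (reg (exec fetch s) SRC) (tok (tsource \<tau>) @ r)"
    "reg (exec fetch s) WT = wsum (reg s BS) (tout \<tau>)"
    "arr (exec fetch s) HAS 0 \<longleftrightarrow> ttarget \<tau> \<noteq> {#}"
    "ttarget \<tau> = {#t#} \<Longrightarrow> ptr x (reg (exec fetch s) TG) (tok t @ u)"
proof -
  define s1 where "s1 = exec (copy SRC PT) s"
  define s2 where "s2 = exec skip_tok s1"
  define s3 where "s3 = exec decode s2"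
  define s4 where "s4 = exec weight_part s3"
  define s5 where "s5 = exec decode s4"
  define s6 where "s6 = exec target_part s5"
  have e: "exec fetch s = s6"
    unfolding fetch_def s1_def s2_def s3_def s4_def s5_def s6_def by (simp only: exec.simps)
  let ?o = "concat (map tok (sorted_list_of_multiset (tout \<tau>)))"
  let ?t = "concat (map tok (sorted_list_of_multiset (ttarget \<tau>)))"
  have p: "ptr x (reg s PT) (tok (tsource \<tau>) @ tok (size (tout \<tau>)) @ ?o @ tok (size
    (ttarget \<tau>)) @ ?t @ u)"
    using assms(2) by (simp add: enc_trans_def enc_natlist_mset)
  have i1: "inp x s1" unfolding s1_def using assms(1) by (rule inp_exec) auto
  have i2: "inp x s2" unfolding s2_def using i1 by (rule inp_exec) auto
  have i3: "inp x s3" unfolding s3_def using i2 by (rule inp_exec) auto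
  have i4: "inp x s4" unfolding s4_def using i3 by (rule inp_exec) auto
  have i5: "inp x s5" unfolding s5_def using i4 by (rule inp_exec) auto
  have C: "reg s1 CAP = reg s CAP" "reg s2 CAP = reg s CAP" "reg s3 CAP = reg s CAP"
    "reg s4 CAP = reg s CAP"
    "reg s1 BS = reg s BS" "reg s2 BS = reg s BS" "reg s3 BS = reg s BS"
    by (simp_all add: s1_def s2_def s3_def s4_def)
  have p1: "ptr x (reg s1 PT) (tok (tsource \<tau>) @ tok (size (tout \<tau>)) @ ?o @ tok (size
    (ttarget \<tau>)) @ ?t @ u)"
    using p by (simp add: s1_def)
  have p2: "ptr x (reg s2 PT) (tok (size (tout \<tau>)) @ ?o @ tok (size (ttarget \<tau>)) @ ?t @ u)"
    unfolding s2_def by (rule exec_skip_tok[OF i1 p1])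
  have c2: "2 * size (tout \<tau>) + 1 \<le> reg s2 CAP" using assms(3,8) C by simp
  have p3: "ptr x (reg s3 PT) (?o @ tok (size (ttarget \<tau>)) @ ?t @ u)" "reg s3 VL = size (tout \<tau>)"
    unfolding s3_def by (rule exec_decode[OF i2 p2 c2])+
  have p4: "ptr x (reg s4 PT) (tok (size (ttarget \<tau>)) @ ?t @ u)" "reg s4 WT = wsum (reg s3 BS) (tout \<tau>)"
    unfolding s4_def by (rule exec_weight_part[OF i3 p3(1) assms(3,5) p3(2)]; use assms C in simp)+
  have c4: "2 * size (ttarget \<tau>) + 1 \<le> reg s4 CAP" using assms(4,8) C by simp
  have p5: "ptr x (reg s5 PT) (?t @ u)" "reg s5 VL = size (ttarget \<tau>)"
    unfolding s5_def by (rule exec_decode[OF i4 p4(1) c4])+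
  note p6 = exec_target_part[OF i5 p5(1) assms(4) p5(2), folded s6_def]
  have "reg s6 SRC = reg s PT" "reg s6 WT = reg s4 WT"
    by (simp_all add: s6_def s5_def s4_def s3_def s2_def s1_def)
  then show "ptr x (reg (exec fetch s) PT) u" "\<exists>r. ptr x (reg (exec fetch s) SRC) (tok (tsource \<tau>) @ r)"
    "reg (exec fetch s) WT = wsum (reg s BS) (tout \<tau>)"
    "arr (exec fetch s) HAS 0 \<longleftrightarrow> ttarget \<tau> \<noteq> {#}"
    "ttarget \<tau> = {#t#} \<Longrightarrow> ptr x (reg (exec fetch s) TG) (tok t @ u)"
    using p6 p p4(2) C unfolding e by auto
qed

section \<open>Table filling\<close>

text \<open>Unlike \<open>walk\<close>, which consumes transitions from the front, this grows walks
  at their end, as the layers of the table do.\<close>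

inductive pth :: "('s, 'a) trans set \<Rightarrow> 's \<Rightarrow> nat \<Rightarrow> 's \<Rightarrow> 'a multiset \<Rightarrow> bool" for \<delta> s0 where
  pth_0: "pth \<delta> s0 0 s0 {#}"
| pth_Suc: "pth \<delta> s0 l s v \<Longrightarrow> \<tau> \<in> \<delta> \<Longrightarrow> tsource \<tau> = s \<Longrightarrow> ttarget \<tau> = {#s'#} \<Longrightarrow>
    pth \<delta> s0 (Suc l) s' (v + tout \<tau>)"

text \<open>\<open>l\<close> counts the transitions before the final one, so the complete walk has
  length \<open>l + 1\<close>.\<close>

definition accepts :: "('s, 'a) trans set \<Rightarrow> 's \<Rightarrow> nat \<Rightarrow> 'a multiset \<Rightarrow> bool" where
  "accepts \<delta> s0 l v \<longleftrightarrow> (\<exists>s u \<tau>. pth \<delta> s0 l s u \<and> \<tau> \<in> \<delta> \<and> tsource \<tau> = s \<and> ttarget \<tau> = {#}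
    \<and> v = u + tout \<tau>)"

section \<open>Vectors as numbers in a fixed base\<close>

lemma wsum_simps [simp]: "wsum B {#} = 0" "wsum B (M + N) = wsum B M + wsum B N"
  by (simp_all add: wsum_def)

lemma wsum_count:
  assumes "set_mset M \<subseteq> {0..<k}"
  shows "wsum B M = (\<Sum>a<k. count M a * B ^ a)"
  using assms
proof (induction M)
  case (add b M)
  have "(\<Sum>a<k. count (add_mset b M) a * B ^ a) = (\<Sum>a<k.
    (if a = b then B ^ a else 0) + count M a * B ^ a)"
    by (intro sum.cong) auto
  also have "\<dots> = B ^ b + (\<Sum>a<k. count M a * B ^ a)" using add.prems by (simp add: sum.distrib)
  finally show ?case using add by (simp add: wsum_def)
qed simp

lemma digits_less: "\<forall>a<k. c a < B \<Longrightarrow> (\<Sum>a<k. c a * B ^ a) < (B::nat) ^ k"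
proof (induction k)
  case (Suc k)
  have "(\<Sum>a<Suc k. c a * B ^ a) < B ^ k + c k * B ^ k" using Suc by simp
  also have "\<dots> = Suc (c k) * B ^ k" by simp
  also have "\<dots> \<le> B * B ^ k" using Suc.prems by (intro mult_right_mono) (auto simp: Suc_le_eq)
  finally show ?case by simp
qed simp

lemma digits_unique:
  assumes "\<forall>a<k. c a < B" "\<forall>a<k. d a < B" "(\<Sum>a<k. c a * B ^ a) = (\<Sum>a<k. d a * (B::nat) ^ a)"
  shows "\<forall>a<k. c a = d a"
  using assms
proof (induction k)
  case (Suc k)
  have l: "(\<Sum>a<k. c a * B ^ a) < B ^ k" "(\<Sum>a<k. d a * B ^ a) < B ^ k"
    using digits_less Suc.prems by auto
  have e: "(\<Sum>a<k. c a * B ^ a) + c k * B ^ k = (\<Sum>a<k. d a * B ^ a) + d k * B ^ k"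
    using Suc.prems(3) by simp
  have "0 < B ^ k" using l(1) by (rule le_less_trans[rotated]) simp
  then have "((\<Sum>a<k. c a * B ^ a) + c k * B ^ k) div B ^ k = c k"
    "((\<Sum>a<k. d a * B ^ a) + d k * B ^ k) div B ^ k = d k" using l by auto
  then have ck: "c k = d k" using e by metis
  then have "(\<Sum>a<k. c a * B ^ a) = (\<Sum>a<k. d a * B ^ a)" using e by simp
  then have "\<forall>a<k. c a = d a" using Suc.prems(1,2) by (intro Suc.IH) auto
  then show ?case using ck less_Suc_eq by metis
qed simp

lemma wsum_less:
  assumes "set_mset M \<subseteq> {0..<k}" "size M < B"
  shows "wsum B M < B ^ k"
  unfolding wsum_count[OF assms(1)]
  using assms(2) count_le_size[of M] by (intro digits_less) (auto intro: le_less_trans)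

text \<open>A vector of size below \<open>B\<close> has all counts below \<open>B\<close>, so they
  are proper digits and the number determines them.\<close>

lemma wsum_inject:
  assumes "set_mset M \<subseteq> {0..<k}" "size M < B" "set_mset N \<subseteq> {0..<k}" "size N < B" "wsum B M = wsum B N"
  shows "M = N"
proof (rule multiset_eqI)
  fix a
  have "\<forall>a<k. count M a = count N a"
    using assms(2,4,5) count_le_size[of M] count_le_size[of N]
    unfolding wsum_count[OF assms(1)] wsum_count[OF assms(3)]
    by (intro digits_unique) (auto intro: le_less_trans)
  moreover have "count M a = count N a" if "\<not> a < k"
    using that assms(1,3) by (metis atLeastLessThan_iff count_eq_zero_iff subsetD)
  ultimately show "count M a = count N a" by blast
qed

text \<open>The array \<open>tab\<close> is set at \<open>index BG l q w\<close> if a walk of length \<open>l\<close> with output of weight \<open>w\<close>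
  ends in the state whose token starts at position \<open>q\<close> of the input. States are identified by such
  positions because their names may be exponentially large.\<close>

definition inner :: "nat \<Rightarrow> nat \<Rightarrow> com" where
  "inner tab out = Seq (addr LV QV WV) (CIf AD tab (Seq str_eq (CIf HOME EQ
     (Seq (Seq (copy W1 WV) (add I1 W1 WT))
       (CIf HOME HAS (Seq (addr L1 TG W1) (Put True tab AD)) (Put True out W1))) Skip)) Skip)"

definition layer :: "nat \<Rightarrow> nat \<Rightarrow> com" where
  "layer tab out = For TV CNT (Seq fetch (For QV NN (For WV BG (inner tab out))))"

definition dp :: "nat \<Rightarrow> nat \<Rightarrow> com" where
  "dp tab out = Seq (Seq (addr HOME S0 HOME) (Put True tab AD))
     (For LV LM (Seq (Seq (copy L1 LV) (Seq (Inc L1) (copy PT P0))) (layer tab out)))"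

lemma wf_inner [simp]:
  "wf_com (inner tab out) \<longleftrightarrow> tab \<in> {32..<40} \<and> out \<in> {32..<40}"
  "mods (inner tab out) = {I1, I2, AD, X1, X2, W1}" "puts (inner tab out) = {EQ, DONE, tab, out}"
  by (auto simp: inner_def)

lemma wf_layer [simp]:
  "wf_com (layer tab out) \<longleftrightarrow> tab \<in> {32..<40} \<and> out \<in> {32..<40}"
  "mods (layer tab out) = {I1, I2, I3, AD, X1, X2, W1, SRC, PT, VL, PW, WT, TG, QV, WV, TV}"
  "puts (layer tab out) = {EQ, DONE, HAS, tab, out}"
  by (auto simp: layer_def)

lemma wf_dp [simp]:
  "wf_com (dp tab out) \<longleftrightarrow> tab \<in> {32..<40} \<and> out \<in> {32..<40}"
  "mods (dp tab out) = {I1, I2, I3, AD, X1, X2, W1, SRC, PT, VL, PW, WT, TG, QV, WV, TV, LV, L1}"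
  "puts (dp tab out) = {EQ, DONE, HAS, tab, out}"
  by (auto simp: dp_def)

text \<open>The bound \<open>lm\<close> on walks lies below the base \<open>bs\<close>, so weights
  determine outputs. The side \<open>bg\<close> exceeds layers, positions and weights, so all
  addresses lie below \<open>bg ^ 3\<close>. The bound \<open>2 * k + 3\<close> is room for decoding
  letters and list lengths. The two choices of \<open>tab\<close> and \<open>out\<close> are the
  arrays for the two grammars.\<close>

locale table_filling =
  fixes x :: "nat list" and k :: nat and ts :: "(nat, nat) trans list" and s0 :: nat
    and rest :: "nat list" and tab out lm bs bg cap :: nat
  assumes ts: "\<forall>\<tau>\<in>set ts. size (ttarget \<tau>) \<le> 1 \<and> size (tout \<tau>) \<le> 1 \<and> set_mset (tout \<tau>) \<subseteq> {0..<k}"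
    and tabs: "tab = 32 \<and> out = 33 \<or> tab = 34 \<and> out = 35"
    and num: "0 < lm" "lm < bs" "bs ^ k \<le> bg" "bs \<le> bg" "length x < bg" "bg ^ 3 \<le> cap" "2 * k + 3 \<le> cap"
begin

abbreviation "ix \<equiv> index bg"
abbreviation "path \<equiv> pth (set ts) s0"
abbreviation "acc \<equiv> accepts (set ts) s0"

lemma tab_out: "tab \<noteq> out" "32 \<le> tab" "tab < 36" "32 \<le> out" "out < 36"
  using tabs by auto

lemma bg_le: "bg \<le> bg ^ 3" using num(5) by (simp add: self_le_power)

lemma ix_less:
  assumes "a \<le> lm" "b < bg" "c < bg" shows "ix a b c < cap"
proof -
  have "a < bg" using assms(1) num(2,4) by simp
  then have "Suc (a * bg + b) \<le> Suc a * bg" using assms(2) by simp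
  also have "\<dots> \<le> bg * bg" using \<open>a < bg\<close> by (intro mult_right_mono) auto
  finally have "Suc (a * bg + b) * bg \<le> bg * bg * bg" by (rule mult_right_mono) simp
  then have "ix a b c < bg * bg * bg" using assms(3) by (simp add: index_def)
  then show ?thesis using num(6) by (simp add: power3_eq_cube)
qed

lemma path_props: "path l s v \<Longrightarrow> size v \<le> l \<and> set_mset v \<subseteq> {0..<k}"
proof (induction rule: pth.induct)
  case (pth_Suc l s v \<tau> s')
  then have "size (tout \<tau>) \<le> 1 \<and> set_mset (tout \<tau>) \<subseteq> {0..<k}" using ts by blast
  then show ?case using pth_Suc by auto
qed simp

lemma path_step_less:
  assumes "path l s v" "\<tau> \<in> set ts" "l < lm" shows "wsum bs v + wsum bs (tout \<tau>) < bg"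
proof -
  have t: "size (tout \<tau>) \<le> 1" "set_mset (tout \<tau>) \<subseteq> {0..<k}" using ts assms(2) by blast+
  have "wsum bs (v + tout \<tau>) < bs ^ k"
    using path_props[OF assms(1)] t assms(3) num(2) by (intro wsum_less) auto
  then show ?thesis using num(3) by simp
qed

definition ctx :: "st \<Rightarrow> bool" where
  "ctx t \<longleftrightarrow> inp x t \<and> reg t LM = lm \<and> reg t BS = bs \<and> reg t BG = bg \<and> reg t CAP = cap"

lemma ctx_exec:
  assumes "ctx t" "wf_com c" "mods c \<inter> {CAP, NN, LM, BS, BG} = {}" "puts c \<inter> {0, 1} = {}"
  shows "ctx (exec c t)"
  using assms inp_exec[of x t c] by (auto simp: ctx_def)

lemma ctx_frame:
  assumes "ctx t" "st_inv t'" "\<forall>q\<in>{CAP, NN, LM, BS, BG}. reg t' q = reg t q" "arr t' 0 = arr t 0"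
    "arr t' 1 = arr t 1"
  shows "ctx t'"
  using assms inp_frame[of x t t'] by (auto simp: ctx_def)

text \<open>A position stands for whatever state name can be read there, so several positions may
  represent the same state.\<close>

definition sound :: "st \<Rightarrow> bool" where
  "sound t \<longleftrightarrow> (\<forall>l q w. l \<le> lm \<longrightarrow> q < bg \<longrightarrow> w < bg \<longrightarrow> arr t tab (ix l q w) \<longrightarrow>
       (\<exists>s v r. path l s v \<and> w = wsum bs v \<and> ptr x q (tok s @ r))) \<and>
     (\<forall>w. arr t out w \<longrightarrow> (\<exists>l v. l < lm \<and> acc l v \<and> w = wsum bs v))"

definition grows :: "st \<Rightarrow> st \<Rightarrow> bool" where
  "grows s t \<longleftrightarrow> (\<forall>p. arr s tab p \<longrightarrow> arr t tab p) \<and> (\<forall>p. arr s out p \<longrightarrow> arr t out p)"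

text \<open>\<open>B\<close> is a snapshot of layer \<open>l\<close>. Processing that layer writes
  only to layer \<open>l + 1\<close> and to \<open>out\<close>, so all iterations see the same
  entries.\<close>

definition row :: "nat \<Rightarrow> (nat \<Rightarrow> nat \<Rightarrow> bool) \<Rightarrow> st \<Rightarrow> bool" where
  "row l B t \<longleftrightarrow> (\<forall>q<bg. \<forall>w<bg. arr t tab (ix l q w) \<longleftrightarrow> B q w)"

text \<open>The effect of applying \<open>\<tau>\<close> to entry \<open>(q, w)\<close> of layer
  \<open>l\<close> has been recorded. Entries are never deleted, so this persists
  (\<open>hit_grows\<close>) and the nested loops can collect it.\<close>

definition hit :: "nat \<Rightarrow> (nat \<Rightarrow> nat \<Rightarrow> bool) \<Rightarrow> (nat, nat) trans \<Rightarrow> nat \<Rightarrow> nat \<Rightarrow> st \<Rightarrow> bool" where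
  "hit l B \<tau> q w t \<longleftrightarrow> (B q w \<longrightarrow> (\<exists>r. ptr x q (tok (tsource \<tau>) @ r)) \<longrightarrow>
     (\<forall>s'. ttarget \<tau> = {#s'#} \<longrightarrow> (\<exists>q' r. q' < length x \<and> ptr x q' (tok s' @ r) \<and>
        arr t tab (ix (Suc l) q' (w + wsum bs (tout \<tau>))))) \<and>
     (ttarget \<tau> = {#} \<longrightarrow> arr t out (w + wsum bs (tout \<tau>))))"

definition fetched :: "(nat, nat) trans \<Rightarrow> st \<Rightarrow> bool" where
  "fetched \<tau> t \<longleftrightarrow> (\<exists>r. ptr x (reg t SRC) (tok (tsource \<tau>) @ r)) \<and> reg t WT = wsum bs (tout \<tau>) \<and>
     (arr t HAS 0 \<longleftrightarrow> ttarget \<tau> \<noteq> {#}) \<and>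
     (\<forall>s'. ttarget \<tau> = {#s'#} \<longrightarrow> (\<exists>r. ptr x (reg t TG) (tok s' @ r)))"

lemma grows_refl: "grows s s" and grows_trans: "grows s t \<Longrightarrow> grows t u \<Longrightarrow> grows s u"
  by (auto simp: grows_def)

lemma hit_grows: "hit l B \<tau> q w s \<Longrightarrow> grows s t \<Longrightarrow> hit l B \<tau> q w t"
  unfolding hit_def grows_def by blast

lemma same_arrays:
  assumes "arr t tab = arr s tab" "arr t out = arr s out"
  shows "sound t \<longleftrightarrow> sound s" "row l B t \<longleftrightarrow> row l B s" "grows u t \<longleftrightarrow> grows u s" "grows s t"
    "hit l B \<tau> q w t \<longleftrightarrow> hit l B \<tau> q w s"
  using assms by (auto simp: sound_def row_def grows_def hit_def)

lemma ptr_less: "ptr x q (tok s @ r) \<Longrightarrow> q < length x"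
  by (metis ptr_Cons tok_cases append_Cons)

text \<open>If the entry is set and the token at \<open>q\<close> is the source of
  \<open>\<tau>\<close>, soundness supplies a walk ending in that source. Extending it by
  \<open>\<tau>\<close> justifies the new entry, and its length bounds the new weight by
  \<open>path_step_less\<close>.\<close>

lemma exec_inner:
  assumes c: "ctx t" and S: "sound t" and R: "row l B t" and F: "fetched \<tau> t"
    and \<tau>: "\<tau> \<in> set ts" and l: "reg t LV = l" "reg t L1 = Suc l" "l < lm"
    and q: "reg t QV = q" "q < length x" and w: "reg t WV = w" "w < bg"
  defines "t' \<equiv> exec (inner tab out) t"
  shows "sound t' \<and> row l B t' \<and> grows t t' \<and> hit l B \<tau> q w t'"
proof -
  have qb: "q < bg" using q num by simp
  have inv: "st_inv t" "inp x t" "reg t BG = bg" "reg t CAP = cap" using c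
    by (auto simp: ctx_def inp_def)
  define s1 where "s1 = exec (addr LV QV WV) t"
  have ixc: "ix l q w \<le> cap" using ix_less[of l q w] l qb w by simp
  have AD1: "reg s1 AD = ix l q w"
    unfolding s1_def using inv l q w ixc num by (subst exec_addr) auto
  have a1: "arr s1 f = arr t f" for f by (simp add: s1_def)
  have tB: "arr t tab (ix l q w) \<longleftrightarrow> B q w" using R qb w by (simp add: row_def)
  have fl1: "flag s1 tab (reg s1 AD) \<longleftrightarrow> B q w" using tab_out tB by (simp add: AD1 flag_arr a1)
  have frame: "sound u \<and> row l B u \<and> grows t u" if "arr u tab = arr t tab" "arr u out = arr t out" for u
    using same_arrays[OF that] S R grows_refl by auto
  show ?thesis
  proof (cases "B q w")
    case False
    then have "t' = s1" using fl1 by (simp add: t'_def inner_def s1_def)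
    then show ?thesis using frame[of s1] False a1 by (simp add: hit_def)
  next
    case True
    then obtain s v r where sv: "path l s v" "w = wsum bs v" "ptr x q (tok s @ r)"
      using S tB l qb w unfolding sound_def by (metis less_imp_le)
    define s2 where "s2 = exec str_eq s1"
    have in1: "inp x s1" unfolding s1_def using inv(2) by (rule inp_exec) auto
    have in2: "inp x s2" unfolding s2_def using in1 by (rule inp_exec) auto
    have H2: "reg s2 HOME = 0" using in2 by (simp add: inp_def st_inv_HOME)
    have a2: "f \<noteq> DONE \<Longrightarrow> f \<noteq> EQ \<Longrightarrow> arr s2 f = arr t f" for f by (simp add: s2_def a1)
    have r2: "p \<notin> {I1, I2, AD, X1, X2} \<Longrightarrow> reg s2 p = reg t p" for p by (simp add: s2_def s1_def)
    obtain r1 where src: "ptr x (reg s1 SRC) (tok (tsource \<tau>) @ r1)" using F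
      by (auto simp: fetched_def s1_def)
    have Q1: "reg s1 QV = q" using q by (simp add: s1_def)
    have eq: "arr s2 EQ 0 \<longleftrightarrow> u = tsource \<tau>" if "ptr x q (tok u @ r')" for u r'
      unfolding s2_def using exec_str_eq[OF in1 _ src] that Q1 by simp
    show ?thesis
    proof (cases "arr s2 EQ 0")
      case False
      then have "t' = s2" using fl1 True H2 by (simp add: t'_def inner_def s1_def s2_def flag_arr)
      moreover have "hit l B \<tau> q w s2" using False eq by (auto simp: hit_def)
      ultimately show ?thesis using frame[of s2] a2 tab_out by simp
    next
      case E: True
      then have s: "s = tsource \<tau>" using eq[OF sv(3)] by simp
      define s3 where "s3 = exec (Seq (copy W1 WV) (add I1 W1 WT)) s2"
      let ?w = "w + wsum bs (tout \<tau>)"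
      have wb: "?w < bg" using path_step_less[OF sv(1) \<tau> l(3)] sv(2) by simp
      have in3: "inp x s3" unfolding s3_def using in2 by (rule inp_exec) auto
      have H3: "reg s3 HOME = 0" using in3 by (simp add: inp_def st_inv_HOME)
      have WTt: "reg t WT = wsum bs (tout \<tau>)" using F by (simp add: fetched_def)
      have W3: "reg s3 W1 = ?w"
        unfolding s3_def using WTt w(1) wb bg_le num(6) r2 inv(4) by (simp add: exec_add)
      have a3: "f \<noteq> DONE \<Longrightarrow> f \<noteq> EQ \<Longrightarrow> arr s3 f = arr t f" for f
        using a2 by (simp only: s3_def) (simp del: exec.simps)
      have r3: "p \<notin> {I1, I2, AD, X1, X2, W1} \<Longrightarrow> reg s3 p = reg t p" for p
        using r2 by (simp only: s3_def) (simp del: exec.simps)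
      have t: "t' = exec (CIf HOME HAS (Seq (addr L1 TG W1) (Put True tab AD)) (Put True out W1)) s3"
        using fl1 True E H2 by (simp add: t'_def inner_def s1_def s2_def s3_def flag_arr)
      have has: "flag s3 HAS (reg s3 HOME) \<longleftrightarrow> ttarget \<tau> \<noteq> {#}"
        using F H3 a3 by (simp add: flag_arr fetched_def)
      have tsz: "size (ttarget \<tau>) \<le> 1" using ts \<tau> by blast
      then show ?thesis
      proof (cases rule: size_le_1_cases)
        case 1
        have "t' = exec (Put True out W1) s3" using t has 1 by simp
        then have o: "arr t' out = (arr t out)(?w := True)" "arr t' tab = arr t tab"
          using W3 a3 tab_out by auto
        have "acc l (v + tout \<tau>)" using sv(1) \<tau> s 1 unfolding accepts_def by blast
        then have "sound t'" using S l(3) sv(2) unfolding sound_def o by (auto intro!: exI[of _ l])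
        moreover have "row l B t'" using R by (simp add: row_def o)
        moreover have "grows t t'" by (simp add: grows_def o)
        moreover have "hit l B \<tau> q w t'" using 1 by (simp add: hit_def o)
        ultimately show ?thesis by blast
      next
        case (2 s')
        obtain r' where tg: "ptr x (reg t TG) (tok s' @ r')" using F 2 by (auto simp: fetched_def)
        define q' where "q' = reg t TG"
        have ql: "q' < length x" using ptr_less[OF tg] by (simp add: q'_def)
        then have qb': "q' < bg" using num by simp
        define s4 where "s4 = exec (addr L1 TG W1) s3"
        have "reg s4 AD = index (reg s3 BG) (reg s3 L1) (reg s3 TG) (reg s3 W1)"
          unfolding s4_def
        proof (rule exec_addr)
          have "ix (Suc l) q' ?w < cap" using l(3) qb' wb by (intro ix_less) auto
          then show "index (reg s3 BG) (reg s3 L1) (reg s3 TG) (reg s3 W1) \<le> reg s3 CAP"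
            using r3 inv l W3 by (simp add: q'_def)
        qed (use in3 r3 inv num in \<open>auto simp: inp_def\<close>)
        then have AD4: "reg s4 AD = ix (Suc l) q' ?w" using r3 inv l W3 by (simp add: q'_def)
        have a4: "arr s4 f = arr s3 f" for f by (simp add: s4_def)
        have "t' = exec (Put True tab AD) s4" using t has 2 by (simp add: s4_def)
        then have o: "arr t' tab = (arr t tab)(ix (Suc l) q' ?w := True)" "arr t' out = arr t out"
          using AD4 a3 a4 tab_out by auto
        have np: "path (Suc l) s' (v + tout \<tau>)" using sv(1) \<tau> s 2 by (auto intro: pth_Suc)
        have "sound t'" unfolding sound_def
        proof (intro conjI allI impI)
          fix l'' q'' w''
          assume b: "l'' \<le> lm" "q'' < bg" "w'' < bg" "arr t' tab (ix l'' q'' w'')"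
          show "\<exists>s v r. path l'' s v \<and> w'' = wsum bs v \<and> ptr x q'' (tok s @ r)"
          proof (cases "ix l'' q'' w'' = ix (Suc l) q' ?w")
            case True
            then have "l'' = Suc l \<and> q'' = q' \<and> w'' = ?w" using b qb' wb by (intro index_inject) auto
            then show ?thesis using np tg sv(2) unfolding q'_def by (metis wsum_simps(2))
          next
            case False
            then show ?thesis using b S o by (auto simp: sound_def)
          qed
        qed (use S o in \<open>auto simp: sound_def\<close>)
        moreover have "row l B t'" unfolding row_def
        proof (intro allI impI)
          fix q'' w'' assume b: "q'' < bg" "w'' < bg"
          \<comment> \<open>The entry just written belongs to layer \<open>Suc l\<close>; by
            injectivity of addresses it does not touch layer \<open>l\<close>.\<close>
          have "ix l q'' w'' \<noteq> ix (Suc l) q' ?w" using index_inject[OF b qb' wb] by fastforce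
          then show "arr t' tab (ix l q'' w'') = B q'' w''" using b R by (simp add: row_def o)
        qed
        moreover have "grows t t'" by (simp add: grows_def o)
        moreover have "hit l B \<tau> q w t'" using 2 tg ql by (auto simp: hit_def o q'_def)
        ultimately show ?thesis by blast
      qed
    qed
  qed
qed

lemma fetched_frame:
  "fetched \<tau> s \<Longrightarrow> reg t SRC = reg s SRC \<Longrightarrow> reg t WT = reg s WT \<Longrightarrow> reg t TG = reg s TG \<Longrightarrow>
    arr t HAS = arr s HAS \<Longrightarrow> fetched \<tau> t"
  by (simp add: fetched_def)

lemma tabs_wf: "tab \<in> {32..<40}" "out \<in> {32..<40}" "tab \<notin> {EQ, DONE, HAS, 0, 1}"
  "out \<notin> {EQ, DONE, HAS, 0, 1}"
  using tabs by auto

lemma exec_W_loop: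
  assumes c: "ctx s" and S: "sound s" and R: "row l B s" and F: "fetched \<tau> s"
    and \<tau>: "\<tau> \<in> set ts" and l: "reg s LV = l" "reg s L1 = Suc l" "l < lm"
    and q: "reg s QV = q" "q < length x"
  defines "t \<equiv> exec (For WV BG (inner tab out)) s"
  shows "sound t \<and> row l B t \<and> grows s t \<and> (\<forall>w<bg. hit l B \<tau> q w t)"
proof -
  let ?I = "\<lambda>j t. sound t \<and> row l B t \<and> grows s t \<and> (\<forall>w<j. hit l B \<tau> q w t)"
  have "?I (reg s BG) (exec (For WV BG (inner tab out)) s)"
  proof (rule For_rule[where I = ?I])
    show "wf_com (For WV BG (inner tab out))" using tabs_wf by simp
    show "st_inv s" using c by (simp add: ctx_def inp_def)
    show "?I 0 (set_reg WV 0 s)" using S R same_arrays[of "set_reg WV 0 s" s] by simp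
  next
    fix j t
    assume j: "j < reg s BG" and inv: "st_inv t" and I: "?I j t" and jW: "reg t WV = j"
      and fr: "\<And>q. q \<notin> mods (inner tab out) \<Longrightarrow> q \<noteq> WV \<Longrightarrow> reg t q = reg s q"
      "\<And>f. f \<notin> puts (inner tab out) \<Longrightarrow> arr t f = arr s f"
    have ct: "ctx t" using c inv by (rule ctx_frame) (use fr tabs_wf in auto)
    have Ft: "fetched \<tau> t" using F by (rule fetched_frame) (use fr tabs_wf in auto)
    have jb: "j < bg" using j c by (simp add: ctx_def)
    let ?t = "exec (inner tab out) t"
    have n: "sound ?t \<and> row l B ?t \<and> grows t ?t \<and> hit l B \<tau> q j ?t"
      using I fr l q jW jb by (intro exec_inner[OF ct _ _ Ft \<tau> _ _ l(3) _ q(2)]) auto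
    have "\<forall>w<Suc j. hit l B \<tau> q w ?t"
      using I n hit_grows[of l B \<tau> q _ t ?t] by (auto simp: less_Suc_eq)
    moreover have "grows s ?t" using I n grows_trans by blast
    ultimately show "?I (Suc j) (set_reg WV (Suc j) ?t)"
      using n same_arrays[of "set_reg WV (Suc j) ?t" ?t] by simp
  qed
  then show ?thesis using c by (simp add: t_def ctx_def)
qed

lemma exec_Q_loop:
  assumes c: "ctx s" and S: "sound s" and R: "row l B s" and F: "fetched \<tau> s"
    and \<tau>: "\<tau> \<in> set ts" and l: "reg s LV = l" "reg s L1 = Suc l" "l < lm"
  defines "t \<equiv> exec (For QV NN (For WV BG (inner tab out))) s"
  shows "sound t \<and> row l B t \<and> grows s t \<and> (\<forall>q<length x. \<forall>w<bg. hit l B \<tau> q w t)"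
proof -
  let ?b = "For WV BG (inner tab out)"
  let ?I = "\<lambda>j t. sound t \<and> row l B t \<and> grows s t \<and> (\<forall>q<j. \<forall>w<bg. hit l B \<tau> q w t)"
  have "?I (reg s NN) (exec (For QV NN ?b) s)"
  proof (rule For_rule[where I = ?I])
    show "wf_com (For QV NN ?b)" using tabs_wf by simp
    show "st_inv s" using c by (simp add: ctx_def inp_def)
    show "?I 0 (set_reg QV 0 s)" using S R same_arrays[of "set_reg QV 0 s" s] by simp
  next
    fix j t
    assume j: "j < reg s NN" and inv: "st_inv t" and I: "?I j t" and jQ: "reg t QV = j"
      and fr: "\<And>q. q \<notin> mods ?b \<Longrightarrow> q \<noteq> QV \<Longrightarrow> reg t q = reg s q"
      "\<And>f. f \<notin> puts ?b \<Longrightarrow> arr t f = arr s f"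
    have ct: "ctx t" using c inv by (rule ctx_frame) (use fr tabs_wf in auto)
    have Ft: "fetched \<tau> t" using F by (rule fetched_frame) (use fr tabs_wf in auto)
    have jb: "j < length x" using j c by (simp add: ctx_def inp_def)
    let ?t = "exec ?b t"
    have n: "sound ?t \<and> row l B ?t \<and> grows t ?t \<and> (\<forall>w<bg. hit l B \<tau> j w ?t)"
      using I fr l jQ by (intro exec_W_loop[OF ct _ _ Ft \<tau> _ _ l(3) _ jb]) auto
    have "\<forall>q<Suc j. \<forall>w<bg. hit l B \<tau> q w ?t"
      using I n hit_grows[of l B \<tau> _ _ t ?t] by (auto simp: less_Suc_eq simp del: exec.simps)
    moreover have "grows s ?t" using I n grows_trans by blast
    ultimately show "?I (Suc j) (set_reg QV (Suc j) ?t)"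
      using n same_arrays[of "set_reg QV (Suc j) ?t" ?t] by simp
  qed
  then show ?thesis using c by (simp add: t_def ctx_def inp_def)
qed

lemma exec_layer:
  assumes c: "ctx s" and S: "sound s" and R: "row l B s"
    and l: "reg s LV = l" "reg s L1 = Suc l" "l < lm"
    and P: "ptr x (reg s PT) (concat (map enc_trans ts) @ rest)" and cnt: "reg s CNT = length ts"
  defines "t \<equiv> exec (layer tab out) s"
  shows "sound t \<and> grows s t \<and> ptr x (reg t PT) rest \<and>
    (\<forall>\<tau>\<in>set ts. \<forall>q<length x. \<forall>w<bg. hit l B \<tau> q w t)"
proof -
  let ?q = "For QV NN (For WV BG (inner tab out))"
  let ?b = "Seq fetch ?q"
  let ?I = "\<lambda>j t. sound t \<and> row l B t \<and> grows s t \<and>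
    ptr x (reg t PT) (concat (map enc_trans (drop j ts)) @ rest) \<and>
    (\<forall>i<j. \<forall>q<length x. \<forall>w<bg. hit l B (ts ! i) q w t)"
  have "?I (reg s CNT) (exec (For TV CNT ?b) s)"
  proof (rule For_rule[where I = ?I])
    show "wf_com (For TV CNT ?b)" using tabs_wf by simp
    show "st_inv s" using c by (simp add: ctx_def inp_def)
    show "?I 0 (set_reg TV 0 s)" using S R P same_arrays[of "set_reg TV 0 s" s] by simp
  next
    fix j t
    assume j: "j < reg s CNT" and inv: "st_inv t" and I: "?I j t"
      and fr: "\<And>q. q \<notin> mods ?b \<Longrightarrow> q \<noteq> TV \<Longrightarrow> reg t q = reg s q"
      "\<And>f. f \<notin> puts ?b \<Longrightarrow> arr t f = arr s f"
    have ct: "ctx t" using c inv by (rule ctx_frame) (use fr tabs_wf in auto)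
    have jl: "j < length ts" using j cnt by simp
    define \<tau> where "\<tau> = ts ! j"
    have \<tau>: "\<tau> \<in> set ts" using jl by (simp add: \<tau>_def)
    have p: "ptr x (reg t PT) (enc_trans \<tau> @ concat (map enc_trans (drop (Suc j) ts)) @ rest)"
      using I jl by (simp add: \<tau>_def Cons_nth_drop_Suc[symmetric])
    have \<tau>p: "size (tout \<tau>) \<le> 1" "size (ttarget \<tau>) \<le> 1" "set_mset (tout \<tau>) \<subseteq> {0..<k}" using ts \<tau>
      by blast+
    have nums: "0 < reg t BS" "reg t BS ^ k \<le> reg t CAP" "2 * k + 3 \<le> reg t CAP"
      using ct num bg_le by (auto simp: ctx_def)
    define u where "u = exec fetch t"
    note fe = exec_fetch[OF _ p \<tau>p nums, folded u_def]
    have it: "inp x t" using ct by (simp add: ctx_def)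
    have Fu: "fetched \<tau> u" unfolding fetched_def using fe[OF it] ct by (auto simp: ctx_def)
    have cu: "ctx u" unfolding u_def using ct by (rule ctx_exec) auto
    have au: "arr u tab = arr t tab" "arr u out = arr t out" using tabs_wf by (auto simp: u_def)
    have ru: "reg u LV = l" "reg u L1 = Suc l" using fr l by (auto simp: u_def)
    let ?t = "exec ?q u"
    have n: "sound ?t \<and> row l B ?t \<and> grows u ?t \<and> (\<forall>q<length x. \<forall>w<bg. hit l B \<tau> q w ?t)"
      using I same_arrays[OF au] by (intro exec_Q_loop[OF cu _ _ Fu \<tau> ru l(3)]) auto
    have gt: "grows t ?t" using n same_arrays(4)[OF au] grows_trans by blast
    have "\<forall>i<Suc j. \<forall>q<length x. \<forall>w<bg. hit l B (ts ! i) q w ?t"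
      using I n hit_grows[OF _ gt] by (auto simp: less_Suc_eq \<tau>_def)
    moreover have "grows s ?t" using I gt grows_trans by blast
    moreover have "ptr x (reg ?t PT) (concat (map enc_trans (drop (Suc j) ts)) @ rest)"
    proof -
      have "reg ?t PT = reg u PT" by (rule exec_reg) simp
      then show ?thesis using fe(1)[OF it] by simp
    qed
    moreover have "exec ?b t = ?t" by (simp only: exec.simps(7) u_def)
    ultimately show "?I (Suc j) (set_reg TV (Suc j) (exec ?b t))"
      using n same_arrays[of "set_reg TV (Suc j) ?t" ?t] by simp
  qed
  then have r: "?I (length ts) t" unfolding t_def layer_def cnt .
  have "hit l B \<tau> q w t" if "\<tau> \<in> set ts" "q < length x" "w < bg" for \<tau> q w
    using that r by (metis in_set_conv_nth)
  then show ?thesis using r by simp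
qed

text \<open>One position per walk suffices, as the next layer is computed by scanning all positions;
  other occurrences of the same name may stay unmarked.\<close>

definition complete :: "nat \<Rightarrow> st \<Rightarrow> bool" where
  "complete l t \<longleftrightarrow> (\<forall>s v. path l s v \<longrightarrow>
     (\<exists>q r. q < length x \<and> ptr x q (tok s @ r) \<and> arr t tab (ix l q (wsum bs v))))"

lemma path_less: "path l s v \<Longrightarrow> l \<le> lm \<Longrightarrow> wsum bs v < bg"
  using wsum_less[of v k bs] path_props[of l s v] num by fastforce

lemma complete_step:
  assumes C: "complete l s" and R: "row l B s" and l: "l < lm"
    and H: "\<forall>\<tau>\<in>set ts. \<forall>q<length x. \<forall>w<bg. hit l B \<tau> q w t"
  shows "complete (Suc l) t" "acc l v \<Longrightarrow> arr t out (wsum bs v)"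
proof -
  have B: "\<exists>q r. q < length x \<and> ptr x q (tok p @ r) \<and> B q (wsum bs v) \<and> wsum bs v < bg"
    if "path l p v" for p v
  proof -
    obtain q r where qr: "q < length x" "ptr x q (tok p @ r)" "arr s tab (ix l q (wsum bs v))"
      using C \<open>path l p v\<close> unfolding complete_def by blast
    have "wsum bs v < bg" using path_less[OF that] l by simp
    then show ?thesis using qr R num(5) unfolding row_def by (meson less_trans)
  qed
  show "complete (Suc l) t" unfolding complete_def
  proof (intro allI impI)
    fix s' v' assume "path (Suc l) s' v'"
    then obtain p v \<tau> where p: "path l p v" "\<tau> \<in> set ts" "tsource \<tau> = p" "ttarget \<tau> = {#s'#}"
      "v' = v + tout \<tau>"
      by (cases rule: pth.cases) auto
    obtain q r where "q < length x" "ptr x q (tok p @ r)" "B q (wsum bs v)" "wsum bs v < bg"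
      using B[OF p(1)] by blast
    moreover then have "hit l B \<tau> q (wsum bs v) t" using H p(2) by blast
    ultimately show "\<exists>q r. q < length x \<and> ptr x q (tok s' @ r) \<and> arr t tab (ix (Suc l) q (wsum bs v'))"
      unfolding hit_def p(5) wsum_simps using p(3,4) by blast
  qed
  show "arr t out (wsum bs v)" if "acc l v"
  proof -
    obtain p u \<tau> where p: "path l p u" "\<tau> \<in> set ts" "tsource \<tau> = p" "ttarget \<tau> = {#}" "v = u + tout \<tau>"
      using \<open>acc l v\<close> unfolding accepts_def by blast
    obtain q r where "q < length x" "ptr x q (tok p @ r)" "B q (wsum bs u)" "wsum bs u < bg"
      using B[OF p(1)] by blast
    moreover then have "hit l B \<tau> q (wsum bs u) t" using H p(2) by blast
    ultimately show ?thesis unfolding hit_def p(5) wsum_simps using p(3,4) by blast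
  qed
qed

lemma exec_dp:
  assumes c: "ctx s" and e: "\<forall>p. \<not> arr s tab p" "\<forall>p. \<not> arr s out p"
    and S: "\<exists>r. ptr x (reg s S0) (tok s0 @ r)"
    and P: "ptr x (reg s P0) (concat (map enc_trans ts) @ rest)" and cnt: "reg s CNT = length ts"
  defines "t \<equiv> exec (dp tab out) s"
  shows "ptr x (reg t PT) rest" "arr t out w \<longleftrightarrow> (\<exists>l v. l < lm \<and> acc l v \<and> w = wsum bs v)"
proof -
  have inv: "st_inv s" "reg s BG = bg" "reg s CAP = cap" "reg s HOME = 0"
    using c by (auto simp: ctx_def inp_def st_inv_HOME)
  obtain r0 where S: "ptr x (reg s S0) (tok s0 @ r0)" using S by blast
  have s0l: "reg s S0 < length x" using ptr_less[OF S] .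
  define s1 where "s1 = exec (Seq (addr HOME S0 HOME) (Put True tab AD)) s"
  have c1: "ctx s1" unfolding s1_def using c by (rule ctx_exec) (use tabs_wf in auto)
  have "ix 0 (reg s S0) 0 < cap" using s0l num by (intro ix_less) auto
  then have "reg (exec (addr HOME S0 HOME) s) AD = ix 0 (reg s S0) 0"
    using inv num by (subst exec_addr) auto
  then have a1: "arr s1 tab = (arr s tab)(ix 0 (reg s S0) 0 := True)" "arr s1 out = arr s out"
    using tab_out by (auto simp: s1_def)
  have r1: "reg s1 S0 = reg s S0" "reg s1 P0 = reg s P0" "reg s1 CNT = length ts" "reg s1 CAP = cap"
    using cnt inv by (auto simp: s1_def)
  have sound1: "sound s1" unfolding sound_def
  proof (intro conjI allI impI)
    fix l q w assume a: "q < bg" "w < bg" "arr s1 tab (ix l q w)"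
    then have "ix l q w = ix 0 (reg s S0) 0" using a1 e by (auto split: if_splits)
    then have "l = 0 \<and> q = reg s S0 \<and> w = 0" using a s0l num by (intro index_inject) auto
    then show "\<exists>p v r. path l p v \<and> w = wsum bs v \<and> ptr x q (tok p @ r)"
      using S by (intro exI[of _ s0] exI[of _ "{#}"]) (auto intro: pth_0)
  qed (use a1 e in auto)
  have comp1: "complete 0 s1" unfolding complete_def
  proof (intro allI impI)
    fix p v assume "path 0 p v"
    then have "p = s0" "v = {#}" by (auto elim: pth.cases)
    then show "\<exists>q r. q < length x \<and> ptr x q (tok p @ r) \<and> arr s1 tab (ix 0 q (wsum bs v))"
      using S s0l a1 by (intro exI[of _ "reg s S0"] exI[of _ r0]) auto
  qed
  let ?b = "Seq (Seq (copy L1 LV) (Seq (Inc L1) (copy PT P0))) (layer tab out)"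
  \<comment> \<open>The reading position reaches \<open>rest\<close> only when a layer has been
    processed, hence the exception for \<open>j = 0\<close>; in the end \<open>0 < lm\<close>
    removes it.\<close>
  let ?I = "\<lambda>j t. sound t \<and> complete j t \<and> (\<forall>l<j. \<forall>v. acc l v \<longrightarrow> arr t out (wsum bs v)) \<and>
     (j = 0 \<or> ptr x (reg t PT) rest)"
  have "?I (reg s1 LM) (exec (For LV LM ?b) s1)"
  proof (rule For_rule[where I = ?I])
    show "wf_com (For LV LM ?b)" using tabs_wf by simp
    show "st_inv s1" using c1 by (simp add: ctx_def inp_def)
    show "?I 0 (set_reg LV 0 s1)" using sound1 comp1 same_arrays[of "set_reg LV 0 s1" s1]
      by (simp add: complete_def)
  next
    fix j t
    assume j: "j < reg s1 LM" and inv: "st_inv t" and I: "?I j t" and jL: "reg t LV = j"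
      and fr: "\<And>q. q \<notin> mods ?b \<Longrightarrow> q \<noteq> LV \<Longrightarrow> reg t q = reg s1 q"
      "\<And>f. f \<notin> puts ?b \<Longrightarrow> arr t f = arr s1 f"
    have ct: "ctx t" using c1 inv by (rule ctx_frame) (use fr tabs_wf in auto)
    have jl: "j < lm" using j c1 by (simp add: ctx_def)
    define u where "u = exec (Seq (copy L1 LV) (Seq (Inc L1) (copy PT P0))) t"
    have cu: "ctx u" unfolding u_def using ct by (rule ctx_exec) auto
    have capt: "reg t CAP = cap" using ct by (simp add: ctx_def)
    have "j < cap" using jl num bg_le by linarith
    then have ru: "reg u LV = j" "reg u L1 = Suc j" "reg u PT = reg s P0" "reg u CNT = length ts"
      using jL fr r1 capt by (auto simp: u_def)
    have au: "arr u tab = arr t tab" "arr u out = arr t out" by (auto simp: u_def)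
    define B where "B q w = arr u tab (ix j q w)" for q w
    have Ru: "row j B u" by (simp add: row_def B_def)
    have Cu: "complete j u" using I by (simp add: complete_def au)
    let ?t = "exec (layer tab out) u"
    have P': "ptr x (reg u PT) (concat (map enc_trans ts) @ rest)" using P ru by simp
    have n: "sound ?t \<and> grows u ?t \<and> ptr x (reg ?t PT) rest \<and>
        (\<forall>\<tau>\<in>set ts. \<forall>q<length x. \<forall>w<bg. hit j B \<tau> q w ?t)"
      using I same_arrays[OF au] by (intro exec_layer[OF cu _ Ru ru(1,2) jl P' ru(4)]) auto
    have st: "complete (Suc j) ?t" "\<And>v. acc j v \<Longrightarrow> arr ?t out (wsum bs v)"
      using complete_step[OF Cu Ru jl] n by blast+
    have "\<forall>l<Suc j. \<forall>v. acc l v \<longrightarrow> arr ?t out (wsum bs v)"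
      using I st(2) n au unfolding grows_def by (metis less_SucE)
    moreover have "exec ?b t = ?t" by (simp only: exec.simps(7) u_def)
    ultimately show "?I (Suc j) (set_reg LV (Suc j) (exec ?b t))"
      using n st same_arrays[of "set_reg LV (Suc j) ?t" ?t] by (simp add: complete_def)
  qed
  moreover have "reg s1 LM = lm" using c1 by (simp add: ctx_def)
  moreover have "t = exec (For LV LM ?b) s1" unfolding t_def dp_def s1_def by (simp only: exec.simps(7))
  ultimately have I: "?I lm t" by metis
  then show "ptr x (reg t PT) rest" using num(1) by simp
  show "arr t out w \<longleftrightarrow> (\<exists>l v. l < lm \<and> acc l v \<and> w = wsum bs v)"
    using I unfolding sound_def by blast
qed

end

text \<open>It leaves \<open>PT\<close> just behind the encoded grammar, so that a second run
  continues with the second grammar.\<close>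

definition gram :: "nat \<Rightarrow> nat \<Rightarrow> com" where
  "gram tab out = Seq (copy S0 PT) (Seq skip_tok (Seq decode (Seq (Seq (copy CNT VL) (copy P0 PT))
    (dp tab out))))"

lemma gram_simps [simp]:
  "wf_com (gram tab out) \<longleftrightarrow> tab \<in> {32..<40} \<and> out \<in> {32..<40}"
  "mods (gram tab out) = {I1, I2, I3, AD, X1, X2, W1, SRC, PT, VL, PW, WT, TG, QV, WV, TV, LV, L1, S0, CNT, P0}"
  "puts (gram tab out) = {EQ, DONE, HAS, tab, out}"
  by (auto simp: gram_def)

lemma (in table_filling) exec_gram:
  assumes c: "ctx s" and e: "\<forall>p. \<not> arr s tab p" "\<forall>p. \<not> arr s out p"
    and P: "ptr x (reg s PT) (enc_grammar s0 ts @ rest)" and len: "2 * length ts + 1 \<le> cap"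
  defines "t \<equiv> exec (gram tab out) s"
  shows "ctx t" "ptr x (reg t PT) rest" "arr t out w \<longleftrightarrow> (\<exists>l v. l < lm \<and> acc l v \<and> w = wsum bs v)"
proof -
  define s1 where "s1 = exec (copy S0 PT) s"
  define s2 where "s2 = exec skip_tok s1"
  define s3 where "s3 = exec decode s2"
  define s4 where "s4 = exec (Seq (copy CNT VL) (copy P0 PT)) s3"
  have t: "t = exec (dp tab out) s4"
    unfolding t_def gram_def s1_def s2_def s3_def s4_def by (simp only: exec.simps(7))
  have c1: "ctx s1" unfolding s1_def using c by (rule ctx_exec) auto
  have c2: "ctx s2" unfolding s2_def using c1 by (rule ctx_exec) auto
  have c3: "ctx s3" unfolding s3_def using c2 by (rule ctx_exec) auto
  have c4: "ctx s4" unfolding s4_def using c3 by (rule ctx_exec) auto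
  show "ctx t" unfolding t using c4 by (rule ctx_exec) (use tabs_wf in auto)
  have p1: "ptr x (reg s1 PT) (tok s0 @ tok (length ts) @ concat (map enc_trans ts) @ rest)"
    using P by (simp add: s1_def enc_grammar_def)
  have p2: "ptr x (reg s2 PT) (tok (length ts) @ concat (map enc_trans ts) @ rest)"
    unfolding s2_def using p1 c1 by (intro exec_skip_tok) (auto simp: ctx_def)
  have p3: "ptr x (reg s3 PT) (concat (map enc_trans ts) @ rest)" "reg s3 VL = length ts"
    unfolding s3_def using p2 c2 len by (intro exec_decode; auto simp: ctx_def)+
  have r4: "reg s4 P0 = reg s3 PT" "reg s4 CNT = length ts" "reg s4 S0 = reg s1 S0"
    using p3 by (auto simp: s4_def s3_def s2_def)
  have "reg s1 S0 = reg s1 PT" by (simp add: s1_def)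
  then have S: "\<exists>r. ptr x (reg s4 S0) (tok s0 @ r)" using p1 r4 by auto
  have a4: "arr s4 tab = arr s tab" "arr s4 out = arr s out"
    using tabs_wf by (auto simp: s4_def s3_def s2_def s1_def)
  have P4: "ptr x (reg s4 P0) (concat (map enc_trans ts) @ rest)" using p3 r4 by simp
  show "ptr x (reg t PT) rest" "arr t out w \<longleftrightarrow> (\<exists>l v. l < lm \<and> acc l v \<and> w = wsum bs v)"
    unfolding t using exec_dp[OF c4 _ _ S P4 r4(2)] e a4 by auto
qed

section \<open>The decision program\<close>

definition sq :: "nat \<Rightarrow> nat" where "sq v = v + v * v"

text \<open>Only \<open>IncCap\<close> raises the bound. \<open>A0\<close> holds the old value
  because a loop bound must not change inside the loop; the increments come on top of that value,
  which gives \<open>sq\<close> instead of the plain square.\<close>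

definition square :: com where
  "square = Seq (copy A0 CAP) (For I1 A0 (For I2 A0 IncCap))"

primrec squares :: "nat \<Rightarrow> com" where
  "squares 0 = Skip"
| "squares (Suc m) = Seq (squares m) square"

lemma square_simps [simp]:
  "mods square = {A0, I1, I2, CAP}" "puts square = {}" "wf_com square"
  by (auto simp: square_def)

lemma squares_simps [simp]:
  "q \<notin> {A0, I1, I2, CAP} \<Longrightarrow> q \<notin> mods (squares m)" "puts (squares m) = {}" "wf_com (squares m)"
  by (induction m) auto

lemma exec_square: "st_inv s \<Longrightarrow> reg (exec square s) CAP = sq (reg s CAP)"
proof -
  assume inv: "st_inv s"
  define u where "u = exec (copy A0 CAP) s"
  have iu: "st_inv u" unfolding u_def by (rule wf_st_inv) (use inv in auto)
  have inner: "reg (exec (For I2 A0 IncCap) t) CAP = reg t CAP + reg t A0" if "st_inv t" for t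
  proof (rule For_rule[where I = "\<lambda>j s. reg s CAP = reg t CAP + j"])
    fix j and s' :: st assume "reg s' CAP = reg t CAP + j"
    then show "reg (set_reg I2 (Suc j) (exec IncCap s')) CAP = reg t CAP + Suc j" by simp
  qed (use that in auto)
  have "reg (exec (For I1 A0 (For I2 A0 IncCap)) u) CAP = reg u CAP + reg u A0 * reg u A0"
  proof (rule For_rule[where I = "\<lambda>j s. reg s CAP = reg u CAP + j * reg u A0"])
    fix j t
    assume t: "st_inv t" "reg t CAP = reg u CAP + j * reg u A0"
      and fr: "\<And>q. q \<notin> mods (For I2 A0 IncCap) \<Longrightarrow> q \<noteq> I1 \<Longrightarrow> reg t q = reg u q"
    have "reg t A0 = reg u A0" using fr by simp
    then show "reg (set_reg I1 (Suc j) (exec (For I2 A0 IncCap) t)) CAP = reg u CAP + Suc j * reg u A0"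
      using inner[OF t(1)] t(2) by (simp del: exec.simps)
  qed (use iu in auto)
  then show ?thesis by (simp add: square_def u_def sq_def del: exec.simps(8))
qed

lemma exec_squares: "st_inv s \<Longrightarrow> reg (exec (squares m) s) CAP = (sq ^^ m) (reg s CAP)"
proof (induction m)
  case (Suc m)
  have "st_inv (exec (squares m) s)" using Suc.prems by (intro wf_st_inv) auto
  then show ?case using Suc exec_square by simp
qed simp

lemma sq_ge_power: "v ^ 2 ^ m \<le> (sq ^^ m) v"
proof (induction m)
  case (Suc m)
  have "v ^ 2 ^ Suc m = v ^ 2 ^ m * v ^ 2 ^ m" by (simp add: mult_2 power_add)
  also have "\<dots> \<le> (sq ^^ m) v * (sq ^^ m) v" using Suc by (rule mult_le_mono) (rule Suc)
  also have "\<dots> \<le> (sq ^^ Suc m) v" by (simp add: sq_def)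
  finally show ?case .
qed simp

text \<open>\<open>m\<close> squarings give exponent \<open>2 ^ m\<close>, which is more than
  \<open>e\<close>. The waste is harmless, since only polynomial growth matters.\<close>

lemma sq_power_ge: "0 < v \<Longrightarrow> e \<le> m \<Longrightarrow> v ^ e \<le> (sq ^^ m) v"
proof -
  assume "0 < v" "e \<le> m"
  have "e \<le> 2 ^ m" using \<open>e \<le> m\<close> less_exp[of m] by linarith
  then have "v ^ e \<le> v ^ 2 ^ m" using \<open>0 < v\<close> by (intro power_increasing) auto
  then show ?thesis using sq_ge_power le_trans by blast
qed

text \<open>Each size register is a copy of \<open>CAP\<close> at some stage of its growth, which
  orders the sizes. The two last squarings take \<open>CAP\<close> to at least the fourth power of
  \<open>BG\<close>, beyond all table addresses.\<close>

definition init_bounds :: "nat \<Rightarrow> nat \<Rightarrow> com" where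
  "init_bounds a b = Seq (copy NN CAP) (Seq (squares a) (Seq (copy LM CAP) (Seq square (Seq (copy BS CAP)
     (Seq (squares b) (Seq (copy BG CAP) (Seq square square)))))))"

text \<open>33 and 35 are the output arrays of the two grammars, indexed by weight; a common weight
  refutes disjointness.\<close>

definition compare_outputs :: com where
  "compare_outputs = Seq (Put True ANS HOME)
     (For WV BG (CIf WV 33 (CIf WV 35 (Put False ANS HOME) Skip) Skip))"

definition main_prog :: "nat \<Rightarrow> nat \<Rightarrow> com" where
  "main_prog a b = Seq (init_bounds a b) (Seq (gram 32 33) (Seq (gram 34 35) compare_outputs))"

lemma wf_init_bounds [simp]: "wf_com (init_bounds a b)" by (simp add: init_bounds_def)

lemma wf_main: "wf_com (main_prog a b)" by (simp add: main_prog_def compare_outputs_def)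

lemma mods_init_bounds: "q \<notin> {A0, I1, I2, CAP, NN, LM, BS, BG} \<Longrightarrow> q \<notin> mods (init_bounds a b)"
  by (simp add: init_bounds_def)

lemma puts_init_bounds [simp]: "puts (init_bounds a b) = {}" by (simp add: init_bounds_def)

lemma exec_init_bounds:
  fixes a b :: nat and s :: st
  assumes "st_inv s"
  defines "t \<equiv> exec (init_bounds a b) s" and "lm \<equiv> (sq ^^ a) (reg s CAP)"
  defines "bg \<equiv> (sq ^^ b) (sq lm)"
  shows "reg t NN = reg s CAP" "reg t LM = lm" "reg t BS = sq lm" "reg t BG = bg"
    "reg t CAP = sq (sq bg)"
proof -
  define s1 where "s1 = exec (copy NN CAP) s"
  define s2 where "s2 = exec (squares a) s1"
  define s3 where "s3 = exec (copy LM CAP) s2"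
  define s4 where "s4 = exec square s3"
  define s5 where "s5 = exec (copy BS CAP) s4"
  define s6 where "s6 = exec (squares b) s5"
  define s7 where "s7 = exec (copy BG CAP) s6"
  define s8 where "s8 = exec square s7"
  have t: "t = exec square s8"
    unfolding t_def init_bounds_def s1_def s2_def s3_def s4_def s5_def s6_def s7_def s8_def
    by (simp only: exec.simps(7))
  have i1: "st_inv s1" unfolding s1_def using assms(1) by (rule wf_st_inv[rotated]) simp
  have i2: "st_inv s2" unfolding s2_def using i1 by (rule wf_st_inv[rotated]) simp
  have i3: "st_inv s3" unfolding s3_def using i2 by (rule wf_st_inv[rotated]) simp
  have i4: "st_inv s4" unfolding s4_def using i3 by (rule wf_st_inv[rotated]) simp
  have i5: "st_inv s5" unfolding s5_def using i4 by (rule wf_st_inv[rotated]) simp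
  have i6: "st_inv s6" unfolding s6_def using i5 by (rule wf_st_inv[rotated]) simp
  have i7: "st_inv s7" unfolding s7_def using i6 by (rule wf_st_inv[rotated]) simp
  have i8: "st_inv s8" unfolding s8_def using i7 by (rule wf_st_inv[rotated]) simp
  have 1: "reg s1 CAP = reg s CAP" "reg s1 NN = reg s CAP" by (simp_all add: s1_def)
  have 2: "reg s2 CAP = lm" "reg s2 NN = reg s CAP"
    unfolding s2_def using exec_squares[OF i1, of a] 1 by (simp_all add: lm_def)
  have 3: "reg s3 CAP = lm" "reg s3 NN = reg s CAP" "reg s3 LM = lm" using 2 by (simp_all add: s3_def)
  have 4: "reg s4 CAP = sq lm" "reg s4 NN = reg s CAP" "reg s4 LM = lm"
    unfolding s4_def using exec_square[OF i3] 3 by simp_all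
  have 5: "reg s5 CAP = sq lm" "reg s5 NN = reg s CAP" "reg s5 LM = lm" "reg s5 BS = sq lm"
    using 4 by (simp_all add: s5_def)
  have 6: "reg s6 CAP = bg" "reg s6 NN = reg s CAP" "reg s6 LM = lm" "reg s6 BS = sq lm"
    unfolding s6_def using exec_squares[OF i5, of b] 5 by (simp_all add: bg_def)
  have 7: "reg s7 CAP = bg" "reg s7 NN = reg s CAP" "reg s7 LM = lm" "reg s7 BS = sq lm" "reg s7 BG = bg"
    using 6 by (simp_all add: s7_def)
  have 8: "reg s8 CAP = sq bg" "reg s8 NN = reg s CAP" "reg s8 LM = lm" "reg s8 BS = sq lm"
    "reg s8 BG = bg"
    unfolding s8_def using exec_square[OF i7] 7 by simp_all
  show "reg t NN = reg s CAP" "reg t LM = lm" "reg t BS = sq lm" "reg t BG = bg" "reg t CAP = sq (sq bg)"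
    unfolding t using exec_square[OF i8] 8 by simp_all
qed

lemma exec_compare_outputs:
  assumes "st_inv s"
  shows "arr (exec compare_outputs s) ANS 0 \<longleftrightarrow> \<not> (\<exists>w<reg s BG. arr s 33 w \<and> arr s 35 w)"
proof -
  define u where "u = exec (Put True ANS HOME) s"
  let ?b = "CIf WV 33 (CIf WV 35 (Put False ANS HOME) Skip) Skip"
  have iu: "st_inv u" unfolding u_def by (rule wf_st_inv) (use assms in auto)
  have H: "reg t HOME = 0" if "st_inv t" for t using that by (rule st_inv_HOME)
  have "arr (exec (For WV BG ?b) u) ANS 0 \<longleftrightarrow> \<not> (\<exists>w<reg u BG. arr u 33 w \<and> arr u 35 w)"
  proof (rule For_rule[where I = "\<lambda>j t. arr t ANS 0 \<longleftrightarrow> \<not> (\<exists>w<j. arr u 33 w \<and> arr u 35 w)"])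
    fix j t
    assume t: "st_inv t" "arr t ANS 0 \<longleftrightarrow> \<not> (\<exists>w<j. arr u 33 w \<and> arr u 35 w)" "reg t WV = j"
      and fa: "\<And>f. f \<notin> puts ?b \<Longrightarrow> arr t f = arr u f"
    have "arr t 33 = arr u 33" "arr t 35 = arr u 35" using fa by auto
    then show "arr (set_reg WV (Suc j) (exec ?b t)) ANS 0 \<longleftrightarrow> \<not> (\<exists>w<Suc j. arr u 33 w \<and> arr u 35 w)"
      using t H[OF t(1)] by (auto simp: flag_arr less_Suc_eq)
  qed (use iu assms H in \<open>auto simp: u_def\<close>)
  then show ?thesis using assms by (simp add: compare_outputs_def u_def st_inv_HOME del: exec.simps(8))
qed

section \<open>Table entries as outputs of runs\<close>

lemma pth_iff_walk:
  "pth \<delta> s0 l s v \<longleftrightarrow> (\<exists>ps. walk s0 ps {#s#} \<and> set ps \<subseteq> \<delta> \<and> length ps = l \<and> v = mout (mset ps))"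
proof
  assume "pth \<delta> s0 l s v"
  then show "\<exists>ps. walk s0 ps {#s#} \<and> set ps \<subseteq> \<delta> \<and> length ps = l \<and> v = mout (mset ps)"
  proof induction
    case pth_0
    then show ?case by (intro exI[of _ "[]"]) simp
  next
    case (pth_Suc l s v \<tau> s')
    then obtain ps where "walk s0 ps {#s#}" "set ps \<subseteq> \<delta>" "length ps = l" "v = mout (mset ps)" by blast
    moreover have "walk s [\<tau>] {#s'#}" using pth_Suc by simp
    ultimately show ?case using pth_Suc walk_append[of s0 ps s "[\<tau>]"]
      by (intro exI[of _ "ps @ [\<tau>]"]) (auto simp: add.commute)
  qed
next
  assume "\<exists>ps. walk s0 ps {#s#} \<and> set ps \<subseteq> \<delta> \<and> length ps = l \<and> v = mout (mset ps)"
  then obtain ps where "walk s0 ps {#s#}" "set ps \<subseteq> \<delta>" "length ps = l" "v = mout (mset ps)" by blast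
  then show "pth \<delta> s0 l s v"
  proof (induction ps arbitrary: l s v rule: rev_induct)
    case Nil
    then show ?case by (auto intro: pth_0)
  next
    case (snoc \<tau> ps)
    have w: "walk s0 ps {#tsource \<tau>#}" "walk (tsource \<tau>) [\<tau>] {#s#}"
      using walk_append_ConsD[OF snoc.prems(1)] by auto
    have "pth \<delta> s0 (length ps) (tsource \<tau>) (mout (mset ps))" using snoc.IH w(1) snoc.prems(2) by simp
    then have "pth \<delta> s0 (Suc (length ps)) s (mout (mset ps) + tout \<tau>)"
      using w(2) snoc.prems(2) by (intro pth_Suc) auto
    then show ?case using snoc.prems by (simp add: add.commute)
  qed
qed

lemma accepts_iff_walk:
  "accepts \<delta> s0 l v \<longleftrightarrow> (\<exists>ps. walk s0 ps {#} \<and> set ps \<subseteq> \<delta> \<and> length ps = Suc l \<and> v = mout (mset ps))"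
proof
  assume "accepts \<delta> s0 l v"
  then obtain s u \<tau> where a: "pth \<delta> s0 l s u" "\<tau> \<in> \<delta>" "tsource \<tau> = s" "ttarget \<tau> = {#}" "v = u + tout \<tau>"
    by (auto simp: accepts_def)
  then obtain ps where "walk s0 ps {#s#}" "set ps \<subseteq> \<delta>" "length ps = l" "u = mout (mset ps)"
    by (auto simp: pth_iff_walk)
  moreover have "walk s [\<tau>] {#}" using a by simp
  ultimately show "\<exists>ps. walk s0 ps {#} \<and> set ps \<subseteq> \<delta> \<and> length ps = Suc l \<and> v = mout (mset ps)"
    using a walk_append[of s0 ps s "[\<tau>]"] by (intro exI[of _ "ps @ [\<tau>]"]) (auto simp: add.commute)
next
  assume "\<exists>ps. walk s0 ps {#} \<and> set ps \<subseteq> \<delta> \<and> length ps = Suc l \<and> v = mout (mset ps)"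
  then obtain ps where ps: "walk s0 ps {#}" "set ps \<subseteq> \<delta>" "length ps = Suc l" "v = mout (mset ps)"
    by blast
  then obtain qs \<tau> where q: "ps = qs @ [\<tau>]" by (metis length_Suc_conv_rev)
  have w: "walk s0 qs {#tsource \<tau>#}" "walk (tsource \<tau>) [\<tau>] {#}"
    using walk_append_ConsD[OF ps(1)[unfolded q]] by auto
  have "pth \<delta> s0 l (tsource \<tau>) (mout (mset qs))" unfolding pth_iff_walk using w ps q by auto
  moreover have "\<tau> \<in> \<delta>" "ttarget \<tau> = {#}" "v = mout (mset qs) + tout \<tau>"
    using w ps q by (auto simp: add.commute)
  ultimately show "accepts \<delta> s0 l v" unfolding accepts_def by blast
qed

lemma accepts_cg_out:
  assumes "\<forall>\<tau>\<in>\<delta>. size (ttarget \<tau>) \<le> 1" "accepts \<delta> s0 l v"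
  shows "v \<in> cg_out (\<Sigma>, S, s0, \<delta>)"
  using assms(2) unfolding accepts_iff_walk cg_out_def is_run_iff_walk[OF assms(1)] by blast

lemma run_accepts:
  assumes "\<forall>\<tau>\<in>\<delta>. size (ttarget \<tau>) \<le> 1" "is_run (\<Sigma>, S, s0, \<delta>) D"
  shows "\<exists>l. accepts \<delta> s0 l (mout D) \<and> size D = Suc l"
proof -
  obtain ps where "walk s0 ps {#}" "set ps \<subseteq> \<delta>" "D = mset ps"
    using assms(2) unfolding is_run_iff_walk[OF assms(1)] by blast
  moreover then have "length ps = Suc (length ps - 1)" by (cases ps) auto
  ultimately show ?thesis unfolding accepts_iff_walk by (metis size_mset)
qed

section \<open>Polynomial bounds\<close>

definition poly_bounded :: "(nat \<Rightarrow> nat) \<Rightarrow> bool" where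
  "poly_bounded f \<longleftrightarrow> (\<exists>d. \<forall>n. f n \<le> (n + 2) ^ d)"

lemma poly_bounded_const: "poly_bounded (\<lambda>n. c)"
proof -
  have "c \<le> (n + 2) ^ c" for n
  proof -
    have "c \<le> 2 ^ c" using less_exp[of c] by simp
    also have "\<dots> \<le> (n + 2) ^ c" by (intro power_mono) auto
    finally show ?thesis .
  qed
  then show ?thesis unfolding poly_bounded_def by blast
qed

lemma poly_bounded_id: "poly_bounded (\<lambda>n. n)"
  unfolding poly_bounded_def by (intro exI[of _ 1]) simp

lemma poly_bounded_mult: "poly_bounded f \<Longrightarrow> poly_bounded g \<Longrightarrow> poly_bounded (\<lambda>n. f n * g n)"
  unfolding poly_bounded_def by (metis mult_le_mono power_add)

text \<open>The base \<open>n + 2\<close> is at least 2 for every \<open>n\<close>, so the factor 2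
  of a sum is absorbed by raising the exponent by one.\<close>

lemma poly_bounded_add:
  assumes "poly_bounded f" "poly_bounded g" shows "poly_bounded (\<lambda>n. f n + g n)"
proof -
  obtain d e where "\<forall>n. f n \<le> (n + 2) ^ d" "\<forall>n. g n \<le> (n + 2) ^ e"
    using assms unfolding poly_bounded_def by blast
  then have "f n \<le> (n + 2) ^ (d + e)" "g n \<le> (n + 2) ^ (d + e)" for n
    by (meson le_add1 le_add2 le_trans one_le_numeral power_increasing trans_le_add2)+
  then have "f n + g n \<le> 2 * (n + 2) ^ (d + e)" for n by (metis add_mono mult_2)
  moreover have "2 * (n + 2) ^ (d + e) \<le> (n + 2) ^ Suc (d + e)" for n :: nat by simp
  ultimately show ?thesis unfolding poly_bounded_def by (meson le_trans)
qed

lemma poly_bounded_comp: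
  assumes "poly_bounded f" "poly_bounded g" shows "poly_bounded (\<lambda>n. f (g n))"
proof -
  obtain d where d: "\<forall>n. f n \<le> (n + 2) ^ d" using assms(1) unfolding poly_bounded_def by blast
  have "poly_bounded (\<lambda>n. g n + 2)" using assms(2) poly_bounded_const by (rule poly_bounded_add)
  then obtain e where e: "\<forall>n. g n + 2 \<le> (n + 2) ^ e" unfolding poly_bounded_def by blast
  have "f (g n) \<le> (n + 2) ^ (e * d)" for n
  proof -
    have "f (g n) \<le> (g n + 2) ^ d" using d by blast
    also have "\<dots> \<le> ((n + 2) ^ e) ^ d" using e by (intro power_mono) auto
    finally show ?thesis by (simp add: power_mult)
  qed
  then show ?thesis unfolding poly_bounded_def by blast
qed

text \<open>For positive \<open>n\<close>, \<open>n + 2\<close> is at most \<open>3 * n\<close>; the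
  value \<open>3 ^ d\<close> is large enough to be factor, exponent and, for \<open>n = 0\<close>,
  summand at once.\<close>

lemma poly_bounded_explicit:
  assumes "poly_bounded f" shows "\<exists>c. \<forall>n. f n \<le> c * n ^ c + c"
proof -
  obtain d where d: "\<forall>n. f n \<le> (n + 2) ^ d" using assms unfolding poly_bounded_def by blast
  have "f n \<le> 3 ^ d * n ^ 3 ^ d + 3 ^ d" for n
  proof (cases "n = 0")
    case True
    have "f n \<le> 2 ^ d" using d True by (metis add_0)
    also have "\<dots> \<le> (3::nat) ^ d" by (intro power_mono) auto
    finally show ?thesis by simp
  next
    case False
    have "d \<le> 3 ^ d" using less_exp[of d] power_mono[of 2 "3::nat" d] by linarith
    have "f n \<le> (n + 2) ^ d" using d by blast
    also have "\<dots> \<le> (3 * n) ^ d" using False by (intro power_mono) auto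
    also have "\<dots> = 3 ^ d * n ^ d" by (rule power_mult_distrib)
    also have "\<dots> \<le> 3 ^ d * n ^ 3 ^ d" using False \<open>d \<le> 3 ^ d\<close>
      by (intro mult_left_mono power_increasing) auto
    finally show ?thesis by simp
  qed
  then show ?thesis by blast
qed

lemmas poly_bounded_intros = poly_bounded_const poly_bounded_id poly_bounded_mult poly_bounded_add

lemma poly_bounded_time: "poly_bounded (time_bound c)"
proof (induction c)
  case (For i r c)
  show ?case unfolding time_bound.simps[abs_def] by (intro poly_bounded_intros For)
qed (simp only: time_bound.simps[abs_def]; intro poly_bounded_intros; assumption)+

lemma poly_bounded_sq: "poly_bounded (sq ^^ m)"
proof (induction m)
  case 0
  show ?case by (simp add: id_def poly_bounded_id)
next
  case (Suc m)
  have "poly_bounded sq" unfolding sq_def[abs_def] by (intro poly_bounded_intros)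
  then show ?case using poly_bounded_comp Suc by (simp add: comp_def)
qed

section \<open>Size of the encoding and final assembly\<close>

lemma set_bin: "set (bin n) \<subseteq> {1, 2}"
proof (induction n rule: less_induct)
  case (less n)
  show ?case
  proof (cases "n = 0")
    case True
    then show ?thesis by (simp add: bin.simps)
  next
    case False
    then show ?thesis using less[of "n div 2"] by (subst bin.simps) auto
  qed
qed

lemma set_tok: "set (tok n) \<subseteq> {1, 2, 3}"
  using set_bin[of n] by (auto simp: tok_def)

lemma set_enc_grammar: "set (enc_grammar s0 ts) \<subseteq> {1, 2, 3}"
  using set_tok by (fastforce simp: enc_grammar_def enc_trans_def enc_natlist_def)

lemma length_tok: "0 < length (tok n)" by (simp add: tok_def)

lemma length_enc_trans: "0 < length (enc_trans \<tau>)" by (simp add: enc_trans_def tok_def)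

text \<open>Every transition takes at least one symbol, so the input length can replace the number
  of transitions in \<open>run_bound\<close>.\<close>

lemma length_enc_grammar: "length ts + 2 \<le> length (enc_grammar s0 ts)"
proof -
  have "length ts \<le> length (concat (map enc_trans ts))"
  proof (induction ts)
    case (Cons \<tau> ts)
    then show ?case using length_enc_trans[of \<tau>] by (simp del: length_greater_0_conv)
  qed simp
  then show ?thesis using length_tok[of s0] length_tok[of "length ts"]
    by (simp add: enc_grammar_def del: length_greater_0_conv)
qed

lemma regular_grammar_transitions:
  assumes "regular_grammar ({0..<k}, S, s0, \<delta>)"
  shows "\<forall>\<tau>\<in>\<delta>. size (ttarget \<tau>) \<le> 1 \<and> size (tout \<tau>) \<le> 1 \<and> set_mset (tout \<tau>) \<subseteq> {0..<k}"
  using assms by (auto simp: regular_grammar_def comm_grammar_def)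

lemma inp_init:
  assumes "set x \<subseteq> {1, 2, 3}" "st_inv t" "arr t = arr (init_st x)" "reg t NN = length x"
    "length x < reg t CAP"
  shows "inp x t"
proof -
  have "(0 \<in> set_decode (x ! p) \<longleftrightarrow> x ! p = 1 \<or> x ! p = 3) \<and> (1 \<in> set_decode (x ! p)
    \<longleftrightarrow> x ! p = 2 \<or> x ! p = 3)"
    if "p < length x" for p
  proof -
    have "x ! p = 1 \<or> x ! p = 2 \<or> x ! p = 3" using assms(1) nth_mem[OF that] by blast
    then show ?thesis by (auto simp: set_decode_def)
  qed
  then show ?thesis using assms by (auto simp: inp_def init_st_def)
qed

text \<open>The first two summands are the exponent of \<open>run_bound_le\<close>; the rest keeps the registers above the
  values that depend only on \<open>k\<close>.\<close>

definition size_exp :: "nat \<Rightarrow> nat" where "size_exp k = 4 + 3 * zs_exp k + (k + 3)"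

definition prog :: "nat \<Rightarrow> com" where "prog k = main_prog (size_exp k) k"

definition cap_bound :: "nat \<Rightarrow> nat \<Rightarrow> nat" where
  "cap_bound k n = sq (sq ((sq ^^ k) (sq ((sq ^^ size_exp k) n))))"

lemma prog_correct:
  fixes k :: nat
  assumes G: "regular_grammar ({0..<k}, S, s0, set ts)"
    and H: "regular_grammar ({0..<k}, S', s0', set ts')"
  defines "x \<equiv> enc_grammar s0 ts @ enc_grammar s0' ts'"
  defines "t \<equiv> exec (prog k) (init_st x)"
  shows "arr t ANS 0 \<longleftrightarrow> cg_out ({0..<k}, S, s0, set ts) \<inter> cg_out ({0..<k}, S', s0', set ts') = {}"
    "reg t CAP = cap_bound k (length x)"
proof -
  let ?n = "length x"
  define lm where "lm = (sq ^^ size_exp k) ?n"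
  define bs where "bs = sq lm"
  define bg where "bg = (sq ^^ k) bs"
  define cap where "cap = sq (sq bg)"
  note tG = regular_grammar_transitions[OF G] and tH = regular_grammar_transitions[OF H]
  have len: "length ts + 2 \<le> ?n" "length ts' + 2 \<le> ?n"
    using length_enc_grammar[of ts s0] length_enc_grammar[of ts' s0'] by (auto simp: x_def)
  then have n2: "2 \<le> ?n" by simp
  have "?n ^ (4 + 3 * zs_exp k) \<le> lm" unfolding lm_def
    using n2 by (intro sq_power_ge) (auto simp: size_exp_def)
  then have rb: "run_bound k ?n \<le> lm" using run_bound_le[OF n2] le_trans by blast
  have "?n ^ 1 \<le> lm" unfolding lm_def using n2 by (intro sq_power_ge) (auto simp: size_exp_def)
  then have nlm: "?n \<le> lm" by simp
  \<comment> \<open>This power serves twice: it exceeds \<open>k + 3\<close>, and being at least 8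
    it makes \<open>4 * bg\<close> at most \<open>cap\<close>.\<close>
  have "2 ^ (k + 3) \<le> ?n ^ (k + 3)" using n2 by (rule power_mono) simp
  also have "\<dots> \<le> lm" unfolding lm_def using n2 by (intro sq_power_ge) (auto simp: size_exp_def)
  finally have k2: "2 ^ (k + 3) \<le> lm" .
  have lb: "lm < bs" using nlm n2 by (simp add: bs_def sq_def)
  have bsk: "bs ^ k \<le> bg" unfolding bg_def using lb by (intro sq_power_ge) auto
  \<comment> \<open>The bound on \<open>bs ^ k\<close> says nothing about \<open>bs\<close> when
    \<open>k = 0\<close>; the exponent \<open>2 ^ k\<close>, which is at least 1, does.\<close>
  have bsb: "bs \<le> bg"
  proof -
    have "bs ^ 2 ^ 0 \<le> bs ^ 2 ^ k" using lb by (intro power_increasing) auto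
    then show ?thesis using sq_ge_power[of bs k] by (simp add: bg_def)
  qed
  have "bg * bg \<le> sq bg" by (simp add: sq_def)
  then have "(bg * bg) * (bg * bg) \<le> cap" unfolding cap_def sq_def[of "sq bg"]
    by (intro trans_le_add2 mult_le_mono)
  moreover have "(bg * bg) * (bg * 1) \<le> (bg * bg) * (bg * bg)" using bsb lb by (intro mult_le_mono) auto
  moreover have "bg ^ 3 = (bg * bg) * (bg * 1)" by (simp add: power3_eq_cube)
  ultimately have b3: "bg ^ 3 \<le> cap" by linarith
  have "(2::nat) ^ 3 \<le> 2 ^ (k + 3)" by (intro power_increasing) auto
  then have "4 \<le> bg" using k2 lb bsb by simp
  then have "4 * bg \<le> bg * bg" by (rule mult_right_mono) simp
  also have "\<dots> \<le> bg ^ 3" using \<open>4 \<le> bg\<close> by (simp add: power3_eq_cube)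
  finally have b4: "4 * bg \<le> cap" using b3 by simp
  have "k + 3 < 2 ^ (k + 3)" by (rule less_exp)
  then have kc: "2 * k + 3 \<le> cap" using k2 b4 lb bsb by linarith
  have ncap: "?n < cap" "2 * length ts + 1 \<le> cap" "2 * length ts' + 1 \<le> cap"
    using b4 nlm lb bsb len by linarith+
  define u where "u = exec (init_bounds (size_exp k) k) (init_st x)"
  have r0: "reg (init_st x) CAP = ?n" by (simp add: init_st_def)
  note su = exec_init_bounds[OF st_inv_init, of "size_exp k" k x, folded u_def, unfolded r0, folded lm_def bs_def, folded bg_def, folded cap_def]
  have au: "arr u = arr (init_st x)" by (rule ext) (simp add: u_def)
  have iu: "st_inv u" unfolding u_def using st_inv_init by (rule wf_st_inv[rotated]) simp
  have "set x \<subseteq> {1, 2, 3}" using set_enc_grammar by (simp add: x_def)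
  then have inpu: "inp x u" using iu au su ncap by (intro inp_init) auto
  have ptu: "reg u PT = 0"
  proof -
    have "reg u PT = reg (init_st x) PT" unfolding u_def by (rule exec_reg) (rule mods_init_bounds, simp)
    then show ?thesis by (simp add: init_st_def)
  qed
  interpret g: table_filling x k ts s0 "enc_grammar s0' ts'" 32 33 lm bs bg cap
    using tG nlm n2 lb bsk bsb b3 kc by unfold_locales auto
  interpret h: table_filling x k ts' s0' "[]" 34 35 lm bs bg cap
    using tH nlm n2 lb bsk bsb b3 kc by unfold_locales auto
  have cu: "g.ctx u" using inpu su by (simp add: g.ctx_def)
  define v where "v = exec (gram 32 33) u"
  have ea: "\<not> arr u f p" if "32 \<le> f" for f p using that by (simp add: au init_st_def)
  have pu: "ptr x (reg u PT) (enc_grammar s0 ts @ enc_grammar s0' ts')"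
    by (simp add: ptu ptr_def x_def)
  have gv: "g.ctx v" "ptr x (reg v PT) (enc_grammar s0' ts')"
    "arr v 33 w \<longleftrightarrow> (\<exists>l z. l < lm \<and> accepts (set ts) s0 l z \<and> w = wsum bs z)" for w
    unfolding v_def using g.exec_gram[OF cu _ _ pu ncap(2)] ea by auto
  define w where "w = exec (gram 34 35) v"
  have "h.ctx v" using gv(1) by (simp add: g.ctx_def h.ctx_def)
  moreover have "\<forall>p. \<not> arr v 34 p" "\<forall>p. \<not> arr v 35 p" using ea by (auto simp: v_def)
  moreover have "ptr x (reg v PT) (enc_grammar s0' ts' @ [])" using gv(2) by simp
  ultimately have hw: "h.ctx w"
    "arr w 35 p \<longleftrightarrow> (\<exists>l z. l < lm \<and> accepts (set ts') s0' l z \<and> p = wsum bs z)" for p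
    unfolding w_def using h.exec_gram(1,3) ncap(3) by auto
  have gw: "arr w 33 p \<longleftrightarrow> (\<exists>l z. l < lm \<and> accepts (set ts) s0 l z \<and> p = wsum bs z)" for p
    using gv(3) by (simp add: w_def)
  have te: "t = exec compare_outputs w"
    unfolding t_def prog_def main_prog_def w_def v_def u_def by (simp only: exec.simps(7))
  have "reg t CAP = reg w CAP" unfolding te by (rule exec_reg) (simp add: compare_outputs_def)
  moreover have "reg w CAP = cap" using hw(1) by (simp add: h.ctx_def)
  moreover have "cap = cap_bound k ?n" by (simp add: cap_bound_def cap_def bg_def bs_def lm_def)
  ultimately show "reg t CAP = cap_bound k ?n" by simp
  have accp: "size z \<le> Suc l \<and> set_mset z \<subseteq> {0..<k}"
    if a: "accepts \<delta> s l z" and \<delta>: "\<forall>\<tau>\<in>\<delta>. size (ttarget \<tau>) \<le> 1 \<and> size (tout \<tau>) \<le> 1 \<and> set_mset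
      (tout \<tau>) \<subseteq> {0..<k}"
    for \<delta> and s :: nat and l z
  proof -
    obtain ps where ps: "set ps \<subseteq> \<delta>" "length ps = Suc l" "z = mout (mset ps)"
      using a unfolding accepts_iff_walk by blast
    have "size z \<le> size (mset ps)" unfolding ps(3) using ps(1) \<delta> by (intro size_mout_le) auto
    moreover have "set_mset z \<subseteq> {0..<k}" using ps(1,3) \<delta> by (fastforce simp: mout_def)
    ultimately show ?thesis using ps(2) by simp
  qed
  have "(\<exists>p<bg. arr w 33 p \<and> arr w 35 p) \<longleftrightarrow>
    cg_out ({0..<k}, S, s0, set ts) \<inter> cg_out ({0..<k}, S', s0', set ts') \<noteq> {}" (is "?L \<longleftrightarrow> ?R")
  proof
    assume ?L
    then obtain l z l' z' where a: "l < lm" "accepts (set ts) s0 l z" "l' < lm"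
      "accepts (set ts') s0' l' z'"
      "wsum bs z = wsum bs z'" unfolding gw hw(2) by metis
    \<comment> \<open>Both outputs have size at most \<open>lm\<close>, which is below the base, so
      equal weights mean equal vectors.\<close>
    then have "z = z'" using accp[OF a(2) tG] accp[OF a(4) tH] lb
      by (intro wsum_inject[of z k bs z']) auto
    then have "z \<in> cg_out ({0..<k}, S, s0, set ts)" "z \<in> cg_out ({0..<k}, S', s0', set ts')"
      using accepts_cg_out[OF _ a(2)] accepts_cg_out[OF _ a(4)] tG tH by auto
    then show ?R by blast
  next
    assume ne: ?R
    have cards: "card (set ts) \<le> ?n" "card (set ts') \<le> ?n"
      using len card_length[of ts] card_length[of ts'] by linarith+
    obtain D1 D2 where D: "is_run ({0..<k}, S, s0, set ts) D1" "is_run ({0..<k}, S', s0', set ts') D2"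
      "mout D1 = mout D2" "size D1 \<le> run_bound k ?n" "size D2 \<le> run_bound k ?n"
      using small_common_output[OF tG _ cards(1) tH _ cards(2) ne] by blast
    obtain l where l: "accepts (set ts) s0 l (mout D1)" "size D1 = Suc l"
      using run_accepts[OF _ D(1)] tG by blast
    obtain l' where l': "accepts (set ts') s0' l' (mout D2)" "size D2 = Suc l'"
      using run_accepts[OF _ D(2)] tH by blast
    \<comment> \<open>A run of size \<open>Suc l\<close> has \<open>l\<close> transitions before the
      final one, so a size of at most \<open>lm\<close> gives the strict inequality.\<close>
    have "l < lm" "l' < lm" using l(2) l'(2) D(4,5) rb by linarith+
    moreover have "wsum bs (mout D1) < bs ^ k"
      using accp[OF l(1) tG] \<open>l < lm\<close> lb by (intro wsum_less) auto
    then have "wsum bs (mout D1) < bg" using bsk by simp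
    ultimately show ?L unfolding gw hw(2) using l(1) l'(1) D(3) by metis
  qed
  moreover have "st_inv w" "reg w BG = bg" using hw(1) by (auto simp: h.ctx_def inp_def)
  ultimately show "arr t ANS 0 \<longleftrightarrow> cg_out ({0..<k}, S, s0, set ts) \<inter> cg_out
    ({0..<k}, S', s0', set ts') = {}"
    unfolding te exec_compare_outputs[OF \<open>st_inv w\<close>] by blast
qed

text \<open>Machine and polynomial are chosen after \<open>k\<close> and before the grammars.
  \<open>k\<close> enters the program text through the numbers of squarings, so the degree grows
  with the alphabet.\<close>

theorem theorem3:
  fixes k :: nat
  shows "\<exists>M c. valid_tm M \<and>
    (\<forall>S s0 ts S' s0' ts'.
       regular_grammar ({0..<k}, S, s0, set ts) \<and> distinct ts \<and>
       regular_grammar ({0..<k}, S', s0', set ts') \<and> distinct ts' \<longrightarrow>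
       (let x = enc_grammar s0 ts @ enc_grammar s0' ts' in
        tm_decides_within M (c * length x ^ c + c) x
          (cg_out ({0..<k}, S, s0, set ts) \<inter> cg_out ({0..<k}, S', s0', set ts') = {})))"
proof -
  let ?T = "\<lambda>n. 2 * n + 3 + time_bound (prog k) (cap_bound k n)"
  have "poly_bounded (cap_bound k)"
    \<comment> \<open>\<open>cap_bound k\<close> is a composition of iterates of \<open>sq\<close>:
      \<open>size_exp k + 1\<close> of them up to the base and \<open>k + 2\<close> more up to
      \<open>cap\<close>.\<close>
    using poly_bounded_comp[OF poly_bounded_sq[of "Suc (Suc k)"] poly_bounded_sq[of "Suc (size_exp k)"]]
    unfolding cap_bound_def[abs_def] by (simp add: comp_def)
  then have "poly_bounded (\<lambda>n. time_bound (prog k) (cap_bound k n))"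
    by (rule poly_bounded_comp[OF poly_bounded_time])
  then have "poly_bounded ?T" by (intro poly_bounded_intros)
  then obtain c where c: "\<forall>n. ?T n \<le> c * n ^ c + c" using poly_bounded_explicit by blast
  show ?thesis
  proof (intro exI[of _ "machine (prog k)"] exI[of _ c] conjI allI impI)
    show "valid_tm (machine (prog k))" by (rule valid_machine)
  next
    fix S S' :: "nat set" and s0 s0' :: nat and ts ts' :: "(nat, nat) trans list"
    assume a: "regular_grammar ({0..<k}, S, s0, set ts) \<and> distinct ts \<and>
       regular_grammar ({0..<k}, S', s0', set ts') \<and> distinct ts'"
    define x where "x = enc_grammar s0 ts @ enc_grammar s0' ts'"
    have pc: "arr (exec (prog k) (init_st x)) ANS 0 \<longleftrightarrow>
        cg_out ({0..<k}, S, s0, set ts) \<inter> cg_out ({0..<k}, S', s0', set ts') = {}"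
      "reg (exec (prog k) (init_st x)) CAP = cap_bound k (length x)"
      unfolding x_def using prog_correct a by blast+
    have "x \<noteq> []" using length_enc_grammar[of ts s0] by (auto simp: x_def)
    moreover have "set x \<subseteq> {1, 2, 3}" using set_enc_grammar by (simp add: x_def)
    ultimately have "tm_decides_within (machine (prog k)) (c * length x ^ c + c) x
        (arr (exec (prog k) (init_st x)) ANS 0)"
      using pc(2) c by (intro machine_decides) (auto simp: prog_def wf_main)
    then show "let x = enc_grammar s0 ts @ enc_grammar s0' ts' in
        tm_decides_within (machine (prog k)) (c * length x ^ c + c) x
          (cg_out ({0..<k}, S, s0, set ts) \<inter> cg_out ({0..<k}, S', s0', set ts') = {})"
      unfolding pc(1) by (simp add: x_def)
  qed
qed

end
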